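(* Let $\rho,\sigma$ be finite dimensional unitary representations of $\mathrm{Mp}_2(\mathbb{Z})$, and let $k,l\in\frac12\mathbb{Z}$ with $k+l\ge2$ and $k\ne1$. Let $F\in\mathbb{S}_k(\rho)$ with non-holomorphic part $F^-$, let $G\in\mathrm{M}_l(\sigma)$ with Fourier expansion $G(\tau)=\sum_{\tilde m\ge0}c(G;\tilde m)q^{\tilde m}$, and write $F^-G:=F^-\otimes G$. Let $\pi_{\rm hol}=\pi^{(k+l)}_{\rm hol}$ be the holomorphic projection of weight $k+l$. If $n>0$, then the $n$-th Fourier coefficient of $\pi_{\rm hol}(F^-G)$ is $$c(\pi_{\rm hol}(F^-G);n)=\frac{-(4\pi)^{k-1}\,\Gamma(l)}{\Gamma(k+l)}\,n^{k-1}\sum_{\substack{m+\tilde m=n\\ m<0}}c^-(F;m)\,c(G;\tilde m)\left(\frac{n}{\tilde m}\right)^{l}{}_2F_1\!\left(1,l,k+l;\frac{n}{\tilde m}\right),$$ where the product $c^-(F;m)\,c(G;\tilde m)$ denotes the tensor product.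
   Context: $\mathbb{H}=\{\tau=x+iy: y>0\}$, $q^m=e^{2\pi im\tau}$. The metaplectic group $\mathrm{Mp}_2(\mathbb{Z})$ consists of pairs $(g,\omega)$ with $g=\begin{pmatrix}a&b\\c&d\end{pmatrix}\in\mathrm{SL}_2(\mathbb{Z})$ and $\omega$ a holomorphic choice of $\tau\mapsto\sqrt{c\tau+d}$ on $\mathbb{H}$, with group law $(g_1,\omega_1)(g_2,\omega_2)=(g_1g_2,(\omega_1\circ g_2)\cdot\omega_2)$. $V(\rho)$ is the representation space of $\rho$, $\overline\rho$ the complex conjugate representation, and for $\gamma=(\begin{pmatrix}a&b\\c&d\end{pmatrix},\sqrt{c\tau+d})$ and $F:\mathbb{H}\to V(\rho)$ $$(F|_{k,\rho}\gamma)(\tau):=\rho(\gamma)^{-1}(\sqrt{c\tau+d})^{-2k}F\!\left(\tfrac{a\tau+b}{c\tau+d}\right).$$ $\mathrm{M}_l(\sigma)$: holomorphic $|_{l,\sigma}$-invariant functions $\mathbb{H}\to V(\sigma)$ bounded at infinity. $\mathrm{S}_l(\sigma)$: the subspace of cusp forms. Harmonic weak Maass forms: $\mathbb{M}_k(\rho)$ is the space of smooth $F:\mathbb{H}\to V(\rho)$ with (1) $F|_{k,\rho}\gamma=F$ for all $\gamma\in\mathrm{Mp}_2(\mathbb{Z})$; (2) $\Delta_kF=0$, where $\Delta_k=-4y^2\frac{\partial}{\partial\tau}\frac{\partial}{\partial\overline\tau}+2kiy\frac{\partial}{\partial\overline\tau}$; (3) $F(\tau)=O(e^{ay})$ as $y\to\infty$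 for some $a>0$. Put $\xi_kF:=2iy^k\overline{\frac{\partial F}{\partial\overline\tau}}$. $\mathbb{S}_k(\rho)$ is the space of $F\in\mathbb{M}_k(\rho)$ with $\xi_k(F)\in\mathrm{S}_{2-k}(\overline\rho)$. Every $F\in\mathbb{S}_k(\rho)$ is written $F=F^++F^-$ with $$F^+(\tau)=\sum_{-\infty\ll m}c^+(F;m)q^m,\qquad F^-(\tau)=-(4\pi)^{k-1}\sum_{m<0}c^-(F;m)\,|m|^{k-1}\,\Gamma(1-k,4\pi|m|y)\,q^m,$$ which defines the coefficients $c^-(F;m)$; here $\Gamma(s,y)=\int_y^\infty e^{-t}t^{s-1}dt$ is the incomplete Gamma function. One has $\xi_k(F)=\sum_{m>0}\overline{c^-(F;-m)}q^m$. Holomorphic projection of weight $\kappa$: let $V$ be a finite dimensional complex vector space and $H:\mathbb{H}\to V$ continuous with Fourier expansion $H(\tau)=\sum_{m\in\mathbb{Q}}c(H;m;y)q^m$, satisfying 1) $H(\tau)=c_0+O(y^{-\epsilon})$ as $y\to\infty$ for some $\epsilon>0$, $c_0\in V$; 2) $c(H;m;y)=O(y^{2-\kappa})$ as $y\to0$ for all $m>0$. Then $$\pi^{(\kappa)}_{\rm hol}(H):=c_0+\sum_{0<m\in\mathbb{Q}}c(m)q^m,\qquad c(m):=\frac{(4\pi m)^{\kappa-1}}{\Gamma(\kappa-1)}\int_0^\infty c(H;m;y)e^{-4\pi my}y^{\kappa-2}\,dy,$$ and $c(\pi_{\rm hol}(H);m):=c(m)$, where $\Gamma$ with one argument is the Gamma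 function. Hypergeometric series: ${}_2F_1(a,b,c;z)=\sum_{n\ge0}\frac{(a)_n(b)_n}{(c)_n}\frac{z^n}{n!}$ with $(p)_n=p(p+1)\cdots(p+n-1)$.
   Formalization: The series on the right can diverge (e.g. k=-10, l=12, ξ_k F=Δ, G=E_12), so its convergence is assumed: the sum is read as the limit of the partial sums over m̃≤X as X→∞, and this limit is assumed to exist. *)

theory Defs
  imports "HOL-Analysis.Analysis" "HOL-Algebra.Group"
begin

definition uhp :: "complex set" where
  "uhp = {\<tau>. Im \<tau> > 0}"

subsection \<open>The metaplectic group and its unitary representations\<close>

type_synonym mp2_elt = "(int^2^2) \<times> (complex \<Rightarrow> complex)"

definition aut_factor :: "int^2^2 \<Rightarrow> complex \<Rightarrow> complex" where
  "aut_factor g \<tau> = of_int (g$2$1) * \<tau> + of_int (g$2$2)"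

definition moebius_act :: "int^2^2 \<Rightarrow> complex \<Rightarrow> complex" where
  "moebius_act g \<tau> = (of_int (g$1$1) * \<tau> + of_int (g$1$2)) / aut_factor g \<tau>"

text \<open>The function component of an element is a function on \<^term>\<open>uhp\<close>; it is represented by
  an element of \<^term>\<open>extensional uhp\<close>, so that equal elements are equal as HOL values.\<close>

definition Mp2 :: "mp2_elt monoid" where
  "Mp2 = \<lparr> carrier = {(g, \<omega>). det g = 1 \<and> \<omega> \<in> extensional uhp \<and> \<omega> holomorphic_on uhp \<and>
                                (\<forall>\<tau>\<in>uhp. (\<omega> \<tau>)\<^sup>2 = aut_factor g \<tau>)},
           mult = (\<lambda>(g1, \<omega>1) (g2, \<omega>2).
                     (g1 ** g2, restrict (\<lambda>\<tau>. \<omega>1 (moebius_act g2 \<tau>) * \<omega>2 \<tau>) uhp)),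
           one = (mat 1, restrict (\<lambda>\<tau>. 1) uhp) \<rparr>"

definition conj_transpose :: "complex^'m^'n \<Rightarrow> complex^'n^'m" where
  "conj_transpose A = (\<chi> i j. cnj (A$j$i))"

definition unitary_group :: "(complex^'m^'m) monoid" where
  "unitary_group = \<lparr> carrier = {A. A ** conj_transpose A = mat 1 \<and> conj_transpose A ** A = mat 1},
                     mult = (**), one = mat 1 \<rparr>"

text \<open>A finite dimensional unitary representation, written in an orthonormal basis of its
  representation space.\<close>

type_synonym 'm mp2_rep = "mp2_elt \<Rightarrow> complex^'m^'m"

definition unitary_rep :: "'m::finite mp2_rep \<Rightarrow> bool" where
  "unitary_rep \<rho> \<longleftrightarrow> \<rho> \<in> hom Mp2 unitary_group"

definition conj_vec :: "complex^'m \<Rightarrow> complex^'m" where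
  "conj_vec v = (\<chi> i. cnj (v$i))"

definition conj_rep :: "'m::finite mp2_rep \<Rightarrow> 'm mp2_rep" where
  "conj_rep \<rho> \<gamma> = (\<chi> i j. cnj (\<rho> \<gamma> $ i $ j))"

definition tensor_vec :: "complex^'m \<Rightarrow> complex^'n \<Rightarrow> complex^('m \<times> 'n)" (infixl "\<otimes>\<^sub>v" 75) where
  "v \<otimes>\<^sub>v w = (\<chi> p. v $ fst p * w $ snd p)"

subsection \<open>Modular forms\<close>

text \<open>Weights are real numbers \<open>k\<close> with \<open>2 * k\<close> an integer, so \<^term>\<open>\<lfloor>2 * k\<rfloor>\<close> is that integer.\<close>

definition slash :: "real \<Rightarrow> 'm::finite mp2_rep \<Rightarrow> (complex \<Rightarrow> complex^'m) \<Rightarrow>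
    mp2_elt \<Rightarrow> complex \<Rightarrow> complex^'m" where
  "slash k \<rho> F \<gamma> \<tau> =
     matrix_inv (\<rho> \<gamma>) *v ((snd \<gamma> \<tau> powi (- \<lfloor>2 * k\<rfloor>)) *s F (moebius_act (fst \<gamma>) \<tau>))"

definition slash_invariant :: "real \<Rightarrow> 'm::finite mp2_rep \<Rightarrow> (complex \<Rightarrow> complex^'m) \<Rightarrow> bool" where
  "slash_invariant k \<rho> F \<longleftrightarrow> (\<forall>\<gamma>\<in>carrier Mp2. \<forall>\<tau>\<in>uhp. slash k \<rho> F \<gamma> \<tau> = F \<tau>)"

text \<open>The filter of \<open>\<tau>\<close> with \<open>Im \<tau> \<rightarrow> \<infinity>\<close>, uniformly in \<open>Re \<tau>\<close>.\<close>

abbreviation at_i_infty :: "complex filter" where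
  "at_i_infty \<equiv> filtercomap Im at_top"

definition modular_forms :: "real \<Rightarrow> 'm::finite mp2_rep \<Rightarrow> (complex \<Rightarrow> complex^'m) set" where
  "modular_forms l \<sigma> = {G. (\<forall>i. (\<lambda>\<tau>. G \<tau> $ i) holomorphic_on uhp) \<and> slash_invariant l \<sigma> G \<and>
                            (\<exists>B. eventually (\<lambda>\<tau>. norm (G \<tau>) \<le> B) at_i_infty)}"

definition cusp_forms :: "real \<Rightarrow> 'm::finite mp2_rep \<Rightarrow> (complex \<Rightarrow> complex^'m) set" where
  "cusp_forms l \<sigma> = {G \<in> modular_forms l \<sigma>. (G \<longlongrightarrow> 0) at_i_infty}"

subsection \<open>Harmonic weak Maass forms\<close>

definition partial_x :: "(complex \<Rightarrow> complex^'m) \<Rightarrow> complex \<Rightarrow> complex^'m" where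
  "partial_x F \<tau> = vector_derivative (\<lambda>t::real. F (\<tau> + of_real t)) (at 0)"

definition partial_y :: "(complex \<Rightarrow> complex^'m) \<Rightarrow> complex \<Rightarrow> complex^'m" where
  "partial_y F \<tau> = vector_derivative (\<lambda>t::real. F (\<tau> + \<i> * of_real t)) (at 0)"

fun continuously_differentiable :: "nat \<Rightarrow> (complex \<Rightarrow> complex^'m::finite) \<Rightarrow> bool" where
  "continuously_differentiable 0 F \<longleftrightarrow> continuous_on uhp F"
| "continuously_differentiable (Suc r) F \<longleftrightarrow>
     F differentiable_on uhp \<and> continuously_differentiable r (partial_x F) \<and>
     continuously_differentiable r (partial_y F)"

definition smooth :: "(complex \<Rightarrow> complex^'m::finite) \<Rightarrow> bool" where
  "smooth F \<longleftrightarrow> (\<forall>r. continuously_differentiable r F)"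

text \<open>The Wirtinger derivatives with respect to \<open>\<tau>\<close> and to its conjugate.\<close>

definition wirtinger :: "(complex \<Rightarrow> complex^'m) \<Rightarrow> complex \<Rightarrow> complex^'m" where
  "wirtinger F \<tau> = (1/2) *s (partial_x F \<tau> - \<i> *s partial_y F \<tau>)"

definition wirtinger_bar :: "(complex \<Rightarrow> complex^'m) \<Rightarrow> complex \<Rightarrow> complex^'m" where
  "wirtinger_bar F \<tau> = (1/2) *s (partial_x F \<tau> + \<i> *s partial_y F \<tau>)"

definition weight_laplacian :: "real \<Rightarrow> (complex \<Rightarrow> complex^'m) \<Rightarrow> complex \<Rightarrow> complex^'m" where
  "weight_laplacian k F \<tau> =
     of_real (- 4 * (Im \<tau>)\<^sup>2) *s wirtinger (wirtinger_bar F) \<tau> +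
     (2 * of_real k * \<i> * of_real (Im \<tau>)) *s wirtinger_bar F \<tau>"

definition harmonic_weak_maass :: "real \<Rightarrow> 'm::finite mp2_rep \<Rightarrow> (complex \<Rightarrow> complex^'m) set" where
  "harmonic_weak_maass k \<rho> =
     {F. smooth F \<and> slash_invariant k \<rho> F \<and> (\<forall>\<tau>\<in>uhp. weight_laplacian k F \<tau> = 0) \<and>
         (\<exists>a>0. (\<lambda>\<tau>. norm (F \<tau>)) \<in> O[at_i_infty](\<lambda>\<tau>. exp (a * Im \<tau>)))}"

definition xi_op :: "real \<Rightarrow> (complex \<Rightarrow> complex^'m) \<Rightarrow> complex \<Rightarrow> complex^'m" where
  "xi_op k F \<tau> = (2 * \<i> * of_real (Im \<tau> powr k)) *s conj_vec (wirtinger_bar F \<tau>)"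

definition harmonic_maass_cuspidal ::
    "real \<Rightarrow> 'm::finite mp2_rep \<Rightarrow> (complex \<Rightarrow> complex^'m) set" where
  "harmonic_maass_cuspidal k \<rho> =
     {F \<in> harmonic_weak_maass k \<rho>. xi_op k F \<in> cusp_forms (2 - k) (conj_rep \<rho>)}"

subsection \<open>Fourier expansions\<close>

text \<open>Exponents are real numbers: the eigenvalues of a unitary operator have the form
  \<open>exp (2 * pi * \<i> * \<alpha>)\<close> with \<open>\<alpha>\<close> real. Expansions in rational exponents are those whose
  coefficients vanish at the irrational ones. All sums are unconditional.\<close>

definition q_pow :: "real \<Rightarrow> complex \<Rightarrow> complex" where
  "q_pow m \<tau> = exp (2 * of_real pi * \<i> * of_real m * \<tau>)"

definition holomorphic_expansion ::
    "(complex \<Rightarrow> complex^'m::finite) \<Rightarrow> (real \<Rightarrow> complex^'m) \<Rightarrow> bool" where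
  "holomorphic_expansion G c \<longleftrightarrow> (\<forall>\<tau>\<in>uhp. ((\<lambda>m. q_pow m \<tau> *s c m) has_sum G \<tau>) {0..})"

definition upper_Gamma :: "real \<Rightarrow> real \<Rightarrow> real" where
  "upper_Gamma s y = integral {y..} (\<lambda>t. exp (- t) * t powr (s - 1))"

text \<open>\<open>F = Fp + Fm\<close> is the splitting of \<open>F\<close> into its holomorphic and non-holomorphic part, with
  coefficients \<open>cp\<close> and \<open>cm\<close>; only the values of \<open>cm\<close> at negative exponents matter.\<close>

definition maass_splitting ::
    "real \<Rightarrow> (complex \<Rightarrow> complex^'m::finite) \<Rightarrow> (complex \<Rightarrow> complex^'m) \<Rightarrow> (complex \<Rightarrow> complex^'m) \<Rightarrow>
     (real \<Rightarrow> complex^'m) \<Rightarrow> (real \<Rightarrow> complex^'m) \<Rightarrow> bool" where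
  "maass_splitting k F Fp Fm cp cm \<longleftrightarrow>
     (\<exists>m0. \<forall>m<m0. cp m = 0) \<and>
     (\<forall>\<tau>\<in>uhp.
        F \<tau> = Fp \<tau> + Fm \<tau> \<and>
        ((\<lambda>m. q_pow m \<tau> *s cp m) has_sum Fp \<tau>) UNIV \<and>
        ((\<lambda>m. (- of_real ((4 * pi) powr (k - 1) * \<bar>m\<bar> powr (k - 1) *
                           upper_Gamma (1 - k) (4 * pi * \<bar>m\<bar> * Im \<tau>)) * q_pow m \<tau>) *s cm m)
           has_sum Fm \<tau>) {m. m < 0})"

definition has_fourier_expansion ::
    "(complex \<Rightarrow> complex^'m::finite) \<Rightarrow> (real \<Rightarrow> real \<Rightarrow> complex^'m) \<Rightarrow> bool" where
  "has_fourier_expansion H c \<longleftrightarrow>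
     (\<forall>\<tau>\<in>uhp. ((\<lambda>m. q_pow m \<tau> *s c m (Im \<tau>)) has_sum H \<tau>) UNIV)"

text \<open>For \<open>y > 0\<close> the value at \<open>y\<close> is uniquely determined by \<open>H\<close>.\<close>

definition fourier_coeff ::
    "(complex \<Rightarrow> complex^'m::finite) \<Rightarrow> real \<Rightarrow> real \<Rightarrow> complex^'m" where
  "fourier_coeff H m y = (THE v. \<exists>c. has_fourier_expansion H c \<and> c m y = v)"

subsection \<open>Holomorphic projection\<close>

text \<open>The coefficient of \<open>q_pow m\<close>, for \<open>m > 0\<close>, in the holomorphic projection of weight \<open>\<kappa>\<close> of
  \<open>H\<close>. The growth conditions usually imposed on \<open>H\<close> serve to make the integral converge.\<close>

definition hol_proj_coeff ::
    "real \<Rightarrow> (complex \<Rightarrow> complex^'m::finite) \<Rightarrow> real \<Rightarrow> complex^'m" where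
  "hol_proj_coeff \<kappa> H m =
     of_real ((4 * pi * m) powr (\<kappa> - 1) / Gamma (\<kappa> - 1)) *s
     integral {0<..} (\<lambda>y. of_real (exp (- 4 * pi * m * y) * y powr (\<kappa> - 2)) *s fourier_coeff H m y)"

definition hypergeo_2F1 :: "real \<Rightarrow> real \<Rightarrow> real \<Rightarrow> real \<Rightarrow> real" where
  "hypergeo_2F1 a b c z = (\<Sum>n. pochhammer a n * pochhammer b n / pochhammer c n * (z ^ n / fact n))"

end

theory Submission
  imports Defs "HOL-Complex_Analysis.Conformal_Mappings"
begin

text \<open>Integrating the \<open>n\<close>-th Fourier coefficient of \<open>F\<^sup>- G\<close> term by term over \<open>(0, \<infinity>)\<close> yields the
  claimed series, but that series need not converge absolutely, so the interchange is done over
  \<open>(\<epsilon>, \<infinity>)\<close>, where it is dominated. By Tonelli, with \<open>s = 4 \<pi> n\<close> and \<open>p = 4 \<pi> \<bar>m\<bar>\<close>, the truncated term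
  is \<open>\<integral>\<^sub>p\<^sup>\<infinity> t\<^sup>-\<^sup>k (t + s)\<^sup>-\<^sup>l \<Gamma>(l, (t + s) \<epsilon>) dt\<close>. For \<open>\<epsilon> = 0\<close> a binomial expansion of this integral gives
  the hypergeometric series; for \<open>\<epsilon> > 0\<close> its quotient by the value at \<open>0\<close> is an average of a decreasing
  function, hence decreasing in \<open>\<bar>m\<bar>\<close>, with values in \<open>(0, 1]\<close> and tending to \<open>1\<close> as \<open>\<epsilon> \<rightarrow> 0\<close>. Abel
  summation then gives the limit \<open>\<epsilon> \<rightarrow> 0\<close>. The argument needs \<open>l > 0\<close>; for \<open>l \<le> 0\<close> the coefficients of \<open>G\<close>
  at positive exponents vanish and both sides are \<open>0\<close>.\<close>

subsection \<open>Infinite sums and Abel summation\<close>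

text \<open>The ordered sum S may converge only conditionally, whereas unordered summation in finite
  dimension means absolute convergence. In general there is no summable majorant independent of
  \<epsilon>, so the limit has to come from summation by parts. That requires multipliers that are
  monotone in the exponent and bounded by 1, which dictates comparing the truncated integral with
  its untruncated value as a quotient. On the integral side the gauge integral, being closed under
  improper limits at 0, tolerates the same conditional convergence. A second obstacle is that the
  exponents are arbitrary reals without a common period. Coefficients are therefore recovered by
  averaging over an arithmetic progression whose step resonates with none of the countably many
  frequencies present. These averages show that \<open>fourier_coeff\<close> is well defined and
  also settle l \<le> 0: negative weight by a growth estimate at y \<rightarrow> 0, weight 0 by an
  inequality between two coefficients that feeds the maximum modulus principle.\<close>

lemma summable_on_euclidean_iff_abs_summable_on:
  fixes f :: "'a \<Rightarrow> 'b::euclidean_space"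
  shows "f summable_on A \<longleftrightarrow> (\<lambda>x. norm (f x)) summable_on A"
proof
  assume f: "f summable_on A"
  have abs_summable: "(\<lambda>x. \<bar>f x \<bullet> b\<bar>) summable_on A" for b
  proof -
    have "(\<lambda>x. f x \<bullet> b) summable_on A"
      using summable_on_bounded_linear[OF bounded_linear_inner_left f] .
    then show ?thesis
      by (subst (asm) summable_on_iff_abs_summable_on_real) simp
  qed
  \<comment> \<open>The norm is at most the sum of the absolute coordinates, so the real case
    suffices.\<close>
  have "(\<lambda>x. \<Sum>b\<in>B. \<bar>f x \<bullet> b\<bar>) summable_on A" if "finite B" for B
    using that
  proof (induction B rule: finite_induct)
    case (insert b B)
    then show ?case using summable_on_add[OF abs_summable[of b]] by simp
  qed simp
  from this[OF finite_Basis] show "(\<lambda>x. norm (f x)) summable_on A"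
    by (rule summable_on_comparison_test) (auto intro: norm_le_l1)
qed (rule abs_summable_summable)

lemma abs_summable_on_bounded:
  fixes f :: "'a \<Rightarrow> 'b::banach"
  assumes "M summable_on A" "\<And>x. x \<in> A \<Longrightarrow> norm (f x) \<le> M x"
  shows "(\<lambda>x. norm (f x)) summable_on A" and "f summable_on A"
  using summable_on_comparison_test[OF assms(1), of "\<lambda>x. norm (f x)"] assms(2)
    abs_summable_summable[of f A] by auto

text \<open>Tannery's theorem along an arbitrary filter: the majorant makes the finite partial sums
  converge uniformly where it dominates, and a uniform limit commutes with a pointwise one. It
  serves limits at infinity, at 0 from the right, along sequences and at the cusp.\<close>

lemma tendsto_infsum_dominated:
  fixes f :: "'a \<Rightarrow> 'i \<Rightarrow> 'b::banach"
  assumes lim: "\<And>x. x \<in> A \<Longrightarrow> ((\<lambda>y. f y x) \<longlongrightarrow> g x) F"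
    and bound: "eventually (\<lambda>y. \<forall>x\<in>A. norm (f y x) \<le> M x) F"
    and M: "M summable_on A" and F: "F \<noteq> bot"
  shows "((\<lambda>y. infsum (f y) A) \<longlongrightarrow> infsum g A) F"
proof -
  define S where "S = {y. \<forall>x\<in>A. norm (f y x) \<le> M x}"
  have unif: "uniform_limit S (\<lambda>X y. \<Sum>x\<in>X. f y x) (\<lambda>y. infsum (f y) A) (finite_subsets_at_top A)"
    by (rule Weierstrass_m_test_general[where M = M]) (use M in \<open>auto simp: S_def\<close>)
  have g: "norm (g x) \<le> M x" if "x \<in> A" for x
    by (rule tendsto_upperbound[OF tendsto_norm[OF lim[OF that]]])
       (use bound F that in \<open>auto elim: eventually_mono\<close>)
  have "(g has_sum infsum g A) A"
    by (rule has_sum_infsum, rule abs_summable_on_bounded[OF M g])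
  then have sum_g: "(sum g \<longlongrightarrow> infsum g A) (finite_subsets_at_top A)"
    by (simp add: has_sum_def)
  show ?thesis
  proof (rule swap_uniform_limit'[OF _ sum_g unif])
    show "\<forall>\<^sub>F X in finite_subsets_at_top A. ((\<lambda>y. \<Sum>x\<in>X. f y x) \<longlongrightarrow> sum g X) F"
      by (rule eventually_finite_subsets_at_top_weakI) (auto intro!: tendsto_sum lim)
    show "\<forall>\<^sub>F y in F. y \<in> S"
      using bound by (simp add: S_def)
  qed (auto simp: finite_subsets_at_top_neq_bot)
qed

text \<open>The index set may be uncountable, while dominated convergence speaks of sequences. The
  majorant bridges the two: a sequence of finite sets \<open>B n\<close> that captures
  \<open>M\<close> up to \<open>1 / (n + 1)\<close> gives convergent partial sums at every y and for
  the integrals, all bounded by \<open>C * g y\<close>.\<close>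

lemma has_integral_infsum:
  fixes f :: "'i \<Rightarrow> real \<Rightarrow> 'b::euclidean_space"
  assumes f: "\<And>i. i \<in> A \<Longrightarrow> (f i has_integral I i) E"
    and bound: "\<And>i y. i \<in> A \<Longrightarrow> y \<in> E \<Longrightarrow> norm (f i y) \<le> M i * g y"
    and M: "M summable_on A" "\<And>i. i \<in> A \<Longrightarrow> 0 \<le> M i"
    and g: "g integrable_on E" "\<And>y. y \<in> E \<Longrightarrow> 0 \<le> g y"
  shows "((\<lambda>y. \<Sum>\<^sub>\<infinity>i\<in>A. f i y) has_integral (\<Sum>\<^sub>\<infinity>i\<in>A. I i)) E"
    and "(\<lambda>i. norm (I i)) summable_on A"
proof -
  have I_le: "norm (I i) \<le> M i * integral E g" if "i \<in> A" for i
  proof -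
    have "norm (integral E (f i)) \<le> integral E (\<lambda>y. M i * g y)"
      by (rule integral_norm_bound_integral)
         (use f[OF that] g bound[OF that] integrable_cmul[OF g(1), of "M i"] in auto)
    then show ?thesis using f[OF that] by (simp add: integral_unique)
  qed
  have sum_I: "(I has_sum (\<Sum>\<^sub>\<infinity>i\<in>A. I i)) A"
    by (rule has_sum_infsum, rule abs_summable_on_bounded[OF _ I_le])
       (use M summable_on_cmult_left[OF M(1)] in auto)
  have sum_f: "((\<lambda>i. f i y) has_sum (\<Sum>\<^sub>\<infinity>i\<in>A. f i y)) A" if "y \<in> E" for y
    by (rule has_sum_infsum, rule abs_summable_on_bounded[where M = "\<lambda>i. M i * g y"])
       (use M that bound summable_on_cmult_left[OF M(1)] in auto)
  define C where "C = infsum M A"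
  have M_le: "sum M B \<le> C" if "finite B" "B \<subseteq> A" for B
    unfolding C_def by (rule finite_sum_le_infsum) (use M that in auto)
  obtain B :: "nat \<Rightarrow> 'i set" where B: "\<And>n. finite (B n)" "\<And>n. B n \<subseteq> A"
     "\<And>n X. finite X \<Longrightarrow> B n \<subseteq> X \<Longrightarrow> X \<subseteq> A \<Longrightarrow> dist (sum M X) C < inverse (Suc n)"
  proof -
    have "\<exists>B. finite B \<and> B \<subseteq> A \<and> (\<forall>X. finite X \<and> B \<subseteq> X \<and> X \<subseteq> A \<longrightarrow> dist (sum M X) C < inverse (Suc n))" for n
    proof -
      have "(M has_sum C) A" using M by (simp add: C_def)
      then have "eventually (\<lambda>X. dist (sum M X) C < inverse (Suc n)) (finite_subsets_at_top A)"
        unfolding has_sum_def by (rule tendstoD) auto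
      then show ?thesis by (simp add: eventually_finite_subsets_at_top)
    qed
    then show ?thesis using that by metis
  qed
  \<comment> \<open>The sums over \<open>X \<union> B n\<close> and over \<open>B n\<close> are both
    within \<open>1 / (n + 1)\<close> of \<open>C\<close>, whence the factor 2.\<close>
  have tail: "sum M (X - B n) \<le> 2 * inverse (Suc n)" if "finite X" "X \<subseteq> A" for n X
  proof -
    have "sum M (X \<union> B n) = sum M (X - B n) + sum M (B n)"
      by (subst sum.union_disjoint[symmetric]) (use that B in \<open>auto intro: sum.cong\<close>)
    moreover have "dist (sum M (X \<union> B n)) C < inverse (Suc n)" "dist (sum M (B n)) C < inverse (Suc n)"
      using B(3)[of "X \<union> B n" n] B(3)[of "B n" n] B that by auto
    ultimately show ?thesis by (auto simp: dist_real_def)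
  qed
  \<comment> \<open>Abstract in \<open>h\<close> because it is used twice: for the values at y with
    \<open>c = g y\<close>, and for the integrals with \<open>c = integral E g\<close>.\<close>
  have close: "norm (S - sum h (B n)) \<le> 2 * inverse (Suc n) * c"
    if h: "(h has_sum S) A" and le: "\<And>i. i \<in> A \<Longrightarrow> norm (h i) \<le> M i * c" and c: "0 \<le> c"
    for h :: "'i \<Rightarrow> 'b" and S c n
  proof -
    have "((\<lambda>X. norm (sum h X - sum h (B n))) \<longlongrightarrow> norm (S - sum h (B n))) (finite_subsets_at_top A)"
      by (intro tendsto_intros) (use h in \<open>simp add: has_sum_def\<close>)
    then show ?thesis
    proof (rule tendsto_upperbound)
      show "\<forall>\<^sub>F X in finite_subsets_at_top A. norm (sum h X - sum h (B n)) \<le> 2 * inverse (Suc n) * c"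
        unfolding eventually_finite_subsets_at_top
      proof (intro exI[of _ "B n"] conjI allI impI)
        fix X assume X: "finite X \<and> B n \<subseteq> X \<and> X \<subseteq> A"
        have "sum h X - sum h (B n) = sum h (X - B n)"
          by (rule sum_diff[symmetric]) (use X in auto)
        also have "norm \<dots> \<le> (\<Sum>i\<in>X - B n. M i * c)"
          by (rule sum_norm_le) (use X le in auto)
        also have "\<dots> = sum M (X - B n) * c" by (simp add: sum_distrib_right)
        also have "\<dots> \<le> 2 * inverse (Suc n) * c"
          by (rule mult_right_mono) (use tail X c in auto)
        finally show "norm (sum h X - sum h (B n)) \<le> 2 * inverse (Suc n) * c" .
      qed (use B in auto)
    qed auto
  qed
  have zero: "(\<lambda>n. 2 * inverse (real (Suc n)) * c) \<longlonglongrightarrow> 0" for c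
    using tendsto_mult_right[OF tendsto_mult_left[OF LIMSEQ_inverse_real_of_nat, of 2], of c] by simp
  have int_B: "((\<lambda>y. \<Sum>i\<in>B n. f i y) has_integral (\<Sum>i\<in>B n. I i)) E" for n
    by (rule has_integral_sum) (use B f in blast)+
  have conv_f: "(\<lambda>n. \<Sum>i\<in>B n. f i y) \<longlonglongrightarrow> (\<Sum>\<^sub>\<infinity>i\<in>A. f i y)" if "y \<in> E" for y
  proof (rule Lim_transform2[OF tendsto_const])
    show "(\<lambda>n. (\<Sum>\<^sub>\<infinity>i\<in>A. f i y) - (\<Sum>i\<in>B n. f i y)) \<longlonglongrightarrow> 0"
      by (rule Lim_null_comparison[OF _ zero[of "g y"]])
         (intro always_eventually allI close sum_f that bound g(2))
  qed
  have conv_I: "(\<lambda>n. \<Sum>i\<in>B n. I i) \<longlonglongrightarrow> (\<Sum>\<^sub>\<infinity>i\<in>A. I i)"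
  proof (rule Lim_transform2[OF tendsto_const])
    show "(\<lambda>n. (\<Sum>\<^sub>\<infinity>i\<in>A. I i) - (\<Sum>i\<in>B n. I i)) \<longlonglongrightarrow> 0"
      by (rule Lim_null_comparison[OF _ zero[of "integral E g"]])
         (intro always_eventually allI close sum_I I_le integral_nonneg g; simp)
  qed
  have bnd: "norm (\<Sum>i\<in>B n. f i y) \<le> C * g y" if "y \<in> E" for n y
  proof -
    have "norm (\<Sum>i\<in>B n. f i y) \<le> (\<Sum>i\<in>B n. M i * g y)"
      by (rule sum_norm_le) (use bound B(2) that in blast)
    also have "\<dots> = sum M (B n) * g y" by (simp add: sum_distrib_right)
    also have "\<dots> \<le> C * g y" by (intro mult_right_mono M_le B g that)
    finally show ?thesis .
  qed
  have 1: "(\<lambda>y. \<Sum>i\<in>B n. f i y) integrable_on E" for n using int_B by blast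
  have 2: "(\<lambda>y. C * g y) integrable_on E" using integrable_cmul[OF g(1), of C] by simp
  note dct = dominated_convergence[OF 1 2 bnd conv_f]
  have "(\<lambda>n. \<Sum>i\<in>B n. I i) \<longlonglongrightarrow> integral E (\<lambda>y. \<Sum>\<^sub>\<infinity>i\<in>A. f i y)"
    using dct(2) by (simp only: integral_unique[OF int_B])
  then have "integral E (\<lambda>y. \<Sum>\<^sub>\<infinity>i\<in>A. f i y) = (\<Sum>\<^sub>\<infinity>i\<in>A. I i)"
    using conv_I LIMSEQ_unique by blast
  with dct(1) show "((\<lambda>y. \<Sum>\<^sub>\<infinity>i\<in>A. f i y) has_integral (\<Sum>\<^sub>\<infinity>i\<in>A. I i)) E"
    by (simp add: has_integral_integral)
  show "(\<lambda>i. norm (I i)) summable_on A"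
    by (rule abs_summable_on_bounded[OF _ I_le]) (use summable_on_cmult_left[OF M(1)] in auto)
qed

section \<open>Summation by parts over real indices\<close>

text \<open>Summation by parts as an induction that adds the largest index \<open>b\<close>:
  splitting off the constant \<open>\<phi> b\<close> leaves multipliers of height at most
  \<open>c - \<phi> b\<close> on the smaller indices, and the bounds
  \<open>(c - \<phi> b) * C\<close> and \<open>\<phi> b * C\<close> add up.\<close>

lemma Abel_bound_finite:
  fixes a :: "real \<Rightarrow> 'b::real_normed_vector"
  assumes "finite B" "antimono_on B \<phi>" "\<And>x. x \<in> B \<Longrightarrow> 0 \<le> \<phi> x" "\<And>x. x \<in> B \<Longrightarrow> \<phi> x \<le> c"
    and "\<And>X. norm (\<Sum>x | x \<in> B \<and> x \<le> X. a x) \<le> C" "0 \<le> c"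
  shows "norm (\<Sum>x\<in>B. \<phi> x *\<^sub>R a x) \<le> c * C"
  using assms
proof (induction B arbitrary: \<phi> c rule: finite_linorder_max_induct)
  case empty
  have "0 \<le> C" using empty.prems(4)[of 0] norm_ge_zero order_trans by blast
  then show ?case using empty by simp
next
  case (insert b B)
  have notin: "b \<notin> B" using insert by auto
  define d where "d = \<phi> b"
  have d: "0 \<le> d" "d \<le> c" using insert.prems by (auto simp: d_def)
  have ge: "d \<le> \<phi> x" if "x \<in> B" for x
    using insert.prems(1) insert.hyps(2) that unfolding monotone_on_def d_def by force
  have "norm (\<Sum>x\<in>B. (\<phi> x - d) *\<^sub>R a x) \<le> (c - d) * C"
  proof (rule insert.IH)
    show "norm (\<Sum>x | x \<in> B \<and> x \<le> X. a x) \<le> C" for X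
    proof (cases "X < b")
      case True
      then have "{x. x \<in> B \<and> x \<le> X} = {x. x \<in> insert b B \<and> x \<le> X}" by auto
      then show ?thesis using insert.prems(4)[of X] by simp
    next
      case False
      \<comment> \<open>For a cut-off at or above \<open>b\<close> the smaller set is selected
        entirely; to use the bound for \<open>insert b B\<close>, the cut-off is lowered to a point
        below \<open>b\<close> that still covers all of \<open>B\<close>.\<close>
      define Y where "Y = (if B = {} then b - 1 else Max B)"
      have "{x. x \<in> B \<and> x \<le> X} = {x. x \<in> insert b B \<and> x \<le> Y}"
      proof (cases "B = {}")
        case False
        then have "Max B \<in> B" using insert.hyps by simp
        then have "Y < b" "\<And>x. x \<in> B \<Longrightarrow> x \<le> Y" using insert.hyps False by (auto simp: Y_def)
        then show ?thesis using insert.hyps \<open>\<not> X < b\<close> by force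
      qed (auto simp: Y_def)
      then show ?thesis using insert.prems(4)[of Y] by simp
    qed
  qed (use insert.prems d ge in \<open>auto simp: monotone_on_def\<close>)
  moreover have "norm (d *\<^sub>R (\<Sum>x\<in>insert b B. a x)) \<le> d * C"
  proof -
    have "{x. x \<in> insert b B \<and> x \<le> b} = insert b B" using insert.hyps by auto
    then show ?thesis using insert.prems(4)[of b] d by (simp add: mult_left_mono)
  qed
  moreover have "(\<Sum>x\<in>insert b B. \<phi> x *\<^sub>R a x) = (\<Sum>x\<in>B. (\<phi> x - d) *\<^sub>R a x) + d *\<^sub>R (\<Sum>x\<in>insert b B. a x)"
    using insert.hyps notin
    by (simp add: scaleR_left_diff_distrib sum_subtractf scaleR_sum_right scaleR_right_distrib d_def)
  ultimately have "norm (\<Sum>x\<in>insert b B. \<phi> x *\<^sub>R a x) \<le> (c - d) * C + d * C"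
    by (simp only:) (rule norm_triangle_mono)
  then show ?case by (simp add: algebra_simps)
qed

text \<open>A single finite set captures both the norms and the weighted sum up to
  \<open>e/2\<close>. Discarding the remaining indices alters every ordered partial sum by at most
  \<open>e/2\<close>, uniformly in the cut-off, so the finite bound applies with
  \<open>C + e/2\<close>.\<close>

lemma Abel_bound_infsum:
  fixes a :: "real \<Rightarrow> 'b::banach"
  assumes mono: "antimono_on {u<..v} \<phi>" and \<phi>: "\<And>x. x \<in> {u<..v} \<Longrightarrow> 0 \<le> \<phi> x \<and> \<phi> x \<le> 1"
    and a: "(\<lambda>x. norm (a x)) summable_on {u<..v}"
    and C: "\<And>X. X \<in> {u<..v} \<Longrightarrow> norm (infsum a {u<..X}) \<le> C" and "0 \<le> C"
  shows "norm (\<Sum>\<^sub>\<infinity>x\<in>{u<..v}. \<phi> x *\<^sub>R a x) \<le> C"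
proof (rule field_le_epsilon)
  fix e :: real assume "e > 0"
  have \<phi>a: "(\<lambda>x. \<phi> x *\<^sub>R a x) summable_on {u<..v}"
    by (rule abs_summable_on_bounded[OF a]) (use \<phi> in \<open>auto intro: mult_left_le_one_le\<close>)
  define N where "N = infsum (\<lambda>x. norm (a x)) {u<..v}"
  have "((\<lambda>x. norm (a x)) has_sum N) {u<..v}" using a by (simp add: N_def)
  then have "eventually (\<lambda>X. dist (\<Sum>x\<in>X. norm (a x)) N < e/2) (finite_subsets_at_top {u<..v})"
    unfolding has_sum_def by (rule tendstoD) (use \<open>e > 0\<close> in auto)
  moreover have "((\<lambda>x. \<phi> x *\<^sub>R a x) has_sum (\<Sum>\<^sub>\<infinity>x\<in>{u<..v}. \<phi> x *\<^sub>R a x)) {u<..v}"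
    using \<phi>a by simp
  then have "eventually (\<lambda>X. dist (\<Sum>x\<in>X. \<phi> x *\<^sub>R a x) (\<Sum>\<^sub>\<infinity>x\<in>{u<..v}. \<phi> x *\<^sub>R a x) < e/2) (finite_subsets_at_top {u<..v})"
    unfolding has_sum_def by (rule tendstoD) (use \<open>e > 0\<close> in auto)
  moreover have "eventually (\<lambda>X. finite X \<and> X \<subseteq> {u<..v}) (finite_subsets_at_top {u<..v})"
    by (rule eventually_finite_subsets_at_top_weakI) auto
  ultimately have "eventually (\<lambda>X. (finite X \<and> X \<subseteq> {u<..v}) \<and> dist (\<Sum>x\<in>X. norm (a x)) N < e/2 \<and>
     dist (\<Sum>x\<in>X. \<phi> x *\<^sub>R a x) (\<Sum>\<^sub>\<infinity>x\<in>{u<..v}. \<phi> x *\<^sub>R a x) < e/2) (finite_subsets_at_top {u<..v})"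
    by (simp only: eventually_conj_iff)
  from eventually_happens'[OF finite_subsets_at_top_neq_bot this] obtain B where B: "finite B" "B \<subseteq> {u<..v}" "dist (\<Sum>x\<in>B. norm (a x)) N < e/2"
     "dist (\<Sum>x\<in>B. \<phi> x *\<^sub>R a x) (\<Sum>\<^sub>\<infinity>x\<in>{u<..v}. \<phi> x *\<^sub>R a x) < e/2"
    by auto
  have tail: "(\<Sum>\<^sub>\<infinity>x\<in>{u<..v} - B. norm (a x)) \<le> e/2"
  proof -
    have "N = (\<Sum>\<^sub>\<infinity>x\<in>({u<..v} - B) \<union> B. norm (a x))" using B by (simp add: N_def Un_absorb2)
    also have "\<dots> = (\<Sum>\<^sub>\<infinity>x\<in>{u<..v} - B. norm (a x)) + (\<Sum>x\<in>B. norm (a x))"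
      by (subst infsum_Un_disjoint) (use B in \<open>auto intro: summable_on_subset_banach[OF a]\<close>)
    finally show ?thesis using B(3) by (auto simp: dist_real_def)
  qed
  have part: "norm (\<Sum>x | x \<in> B \<and> x \<le> X. a x) \<le> C + e/2" for X
  proof -
    consider "X \<le> u" | "u < X" by linarith
    then show ?thesis
    proof cases
      case 1
      then have empty: "{x. x \<in> B \<and> x \<le> X} = {}" using B(2) by force
      show ?thesis unfolding empty using \<open>0 \<le> C\<close> \<open>e > 0\<close> by simp
    next
      case 2
      \<comment> \<open>Cut-offs beyond \<open>v\<close> select the same indices as
        \<open>v\<close>, where the bound \<open>C\<close> is available.\<close>
      define Y where "Y = min X v"
      show ?thesis
      proof (cases "u < v")
        case False
        then have "B = {}" using B by auto
        then show ?thesis using \<open>0 \<le> C\<close> \<open>e > 0\<close> by simp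
      next
        case True
        have Y: "Y \<in> {u<..v}" using 2 True by (auto simp: Y_def)
        define B' where "B' = {x. x \<in> B \<and> x \<le> X}"
        have B': "B' \<subseteq> {u<..Y}" "finite B'" "{u<..Y} - B' \<subseteq> {u<..v} - B" using B by (auto simp: B'_def Y_def)
        have abs_Y: "(\<lambda>x. norm (a x)) summable_on {u<..Y} - B'"
          by (rule summable_on_subset_banach[OF a]) (auto simp: Y_def)
        have "infsum a {u<..Y} = infsum a (({u<..Y} - B') \<union> B')" using B' by (simp add: Un_absorb2)
        also have "\<dots> = infsum a ({u<..Y} - B') + sum a B'"
          by (subst infsum_Un_disjoint) (use B' abs_summable_summable[OF abs_Y] in auto)
        finally have "sum a B' = infsum a {u<..Y} - infsum a ({u<..Y} - B')" by simp
        moreover have "norm (infsum a ({u<..Y} - B')) \<le> (\<Sum>\<^sub>\<infinity>x\<in>{u<..Y} - B'. norm (a x))"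
          by (rule norm_infsum_bound[OF abs_Y])
        moreover have "\<dots> \<le> (\<Sum>\<^sub>\<infinity>x\<in>{u<..v} - B. norm (a x))"
          by (rule infsum_mono2) (use B' abs_Y in \<open>auto intro: summable_on_subset_banach[OF a]\<close>)
        moreover have "norm (infsum a {u<..Y} - infsum a ({u<..Y} - B')) \<le> norm (infsum a {u<..Y}) + norm (infsum a ({u<..Y} - B'))"
          by (rule norm_triangle_ineq4)
        ultimately have "norm (sum a B') \<le> C + e/2" using C[OF Y] tail by simp
        then show ?thesis by (simp add: B'_def)
      qed
    qed
  qed
  have "norm (\<Sum>x\<in>B. \<phi> x *\<^sub>R a x) \<le> 1 * (C + e/2)"
  proof (rule Abel_bound_finite[OF B(1) monotone_on_subset[OF mono B(2)]])
    show "0 \<le> \<phi> x" "\<phi> x \<le> 1" if "x \<in> B" for x using \<phi>[of x] B(2) that by blast+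
    show "norm (\<Sum>x | x \<in> B \<and> x \<le> X. a x) \<le> C + e/2" for X by (rule part)
  qed simp
  then show "norm (\<Sum>\<^sub>\<infinity>x\<in>{u<..v}. \<phi> x *\<^sub>R a x) \<le> C + e"
    using B(4) norm_triangle_sub[of "\<Sum>\<^sub>\<infinity>x\<in>{u<..v}. \<phi> x *\<^sub>R a x" "\<Sum>x\<in>B. \<phi> x *\<^sub>R a x"]
    by (simp add: dist_norm norm_minus_commute)
qed

text \<open>Abel's theorem for a family of multipliers. Beyond some \<open>X0\<close> all segments
  of the undamped series are small by the Cauchy criterion, and summation by parts carries this over
  to the damped tail uniformly in \<epsilon>; the initial segment converges absolutely and is
  handled by domination.\<close>

lemma Abel_summation_limit:
  fixes a :: "real \<Rightarrow> 'b::banach" and \<phi> :: "real \<Rightarrow> real \<Rightarrow> real"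
  assumes mono: "\<And>\<epsilon>. 0 < \<epsilon> \<Longrightarrow> antimono_on {u<..} (\<phi> \<epsilon>)"
    and \<phi>: "\<And>\<epsilon> t. 0 < \<epsilon> \<Longrightarrow> u < t \<Longrightarrow> 0 < \<phi> \<epsilon> t \<and> \<phi> \<epsilon> t \<le> 1"
    and summable: "\<And>\<epsilon>. 0 < \<epsilon> \<Longrightarrow> (\<lambda>t. norm (\<phi> \<epsilon> t *\<^sub>R a t)) summable_on {u<..}"
    and lim: "\<And>t. u < t \<Longrightarrow> ((\<lambda>\<epsilon>. \<phi> \<epsilon> t) \<longlongrightarrow> 1) (at_right 0)"
    and S: "((\<lambda>X. infsum a {u<..X}) \<longlongrightarrow> S) at_top"
  shows "((\<lambda>\<epsilon>. \<Sum>\<^sub>\<infinity>t\<in>{u<..}. \<phi> \<epsilon> t *\<^sub>R a t) \<longlongrightarrow> S) (at_right 0)"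
proof (rule tendstoI)
  fix e :: real assume "e > 0"
  \<comment> \<open>Error budget: d for the initial segment, 2d for the tail, d for the distance of
    the partial sum from \<open>S\<close>.\<close>
  define d where "d = e/5"
  have d: "d > 0" using \<open>e > 0\<close> by (simp add: d_def)
  have abs_a: "(\<lambda>t. norm (a t)) summable_on {u<..X}" for X
  proof (cases "u < X")
    case True
    \<comment> \<open>The multiplier at \<epsilon> = 1 decreases, so on \<open>{u<..X}\<close> it is
      at least \<open>\<phi> 1 X > 0\<close>; dividing by this value transfers absolute summability
      to the undamped terms.\<close>
    have "(\<lambda>t. norm (\<phi> 1 t *\<^sub>R a t) * inverse (\<phi> 1 X)) summable_on {u<..X}"
      by (rule summable_on_cmult_left, rule summable_on_subset_banach[OF summable[of 1]]) auto
    then have "(\<lambda>t. norm (norm (a t))) summable_on {u<..X}"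
    proof (rule abs_summable_on_bounded)
      fix t assume t: "t \<in> {u<..X}"
      have "\<phi> 1 X \<le> \<phi> 1 t" "0 < \<phi> 1 X" using mono[of 1] \<phi>[of 1 X] t True by (auto simp: monotone_on_def)
      then have "\<phi> 1 X * norm (a t) \<le> \<phi> 1 t * norm (a t)" by (intro mult_right_mono) auto
      then show "norm (norm (a t)) \<le> norm (\<phi> 1 t *\<^sub>R a t) * inverse (\<phi> 1 X)"
        using \<open>0 < \<phi> 1 X\<close> \<open>\<phi> 1 X \<le> \<phi> 1 t\<close> by (simp add: field_simps)
    qed
    then show ?thesis by simp
  qed auto
  note summable_a = abs_summable_summable[OF abs_a]
  obtain X0 where X0: "X0 > u" "\<And>X. X \<ge> X0 \<Longrightarrow> dist (infsum a {u<..X}) S < d"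
  proof -
    have "eventually (\<lambda>X. dist (infsum a {u<..X}) S < d \<and> X > u) at_top"
      using tendstoD[OF S d] eventually_gt_at_top[of u] by eventually_elim auto
    then obtain X0 where "\<And>X. X \<ge> X0 \<Longrightarrow> dist (infsum a {u<..X}) S < d \<and> X > u"
      by (auto simp: eventually_at_top_linorder)
    then show ?thesis using that[of X0] by auto
  qed
  have seg: "norm (infsum a {X0<..X}) \<le> 2 * d" if "X > X0" for X
  proof -
    have "{u<..X} = {u<..X0} \<union> {X0<..X}" using that X0(1) by auto
    then have "infsum a {u<..X} = infsum a {u<..X0} + infsum a {X0<..X}"
      by (simp only:) (rule infsum_Un_disjoint[OF summable_a summable_on_subset_banach[OF summable_a[of X]]];
        use X0(1) in auto)
    then have "infsum a {X0<..X} = (infsum a {u<..X} - S) - (infsum a {u<..X0} - S)" by simp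
    also have "norm \<dots> \<le> norm (infsum a {u<..X} - S) + norm (infsum a {u<..X0} - S)"
      by (rule norm_triangle_ineq4)
    moreover have "norm (infsum a {u<..X} - S) < d" "norm (infsum a {u<..X0} - S) < d"
      using X0(2)[OF less_imp_le[OF that]] X0(2)[OF order_refl] by (simp_all only: dist_norm)
    ultimately show ?thesis by (simp only:)
  qed
  have tail: "norm (\<Sum>\<^sub>\<infinity>t\<in>{X0<..}. \<phi> \<epsilon> t *\<^sub>R a t) \<le> 2 * d" if \<epsilon>: "\<epsilon> > 0" for \<epsilon>
  proof -
    \<comment> \<open>The Abel bound is for bounded intervals; the cut-off at \<open>X\<close> is
      removed afterwards by domination.\<close>
    define f where "f = (\<lambda>X t. if t \<le> X then \<phi> \<epsilon> t *\<^sub>R a t else 0)"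
    have "((\<lambda>X. infsum (f X) {X0<..}) \<longlongrightarrow> (\<Sum>\<^sub>\<infinity>t\<in>{X0<..}. \<phi> \<epsilon> t *\<^sub>R a t)) at_top"
    proof (rule tendsto_infsum_dominated)
      show "(\<lambda>t. norm (\<phi> \<epsilon> t *\<^sub>R a t)) summable_on {X0<..}"
        by (rule summable_on_subset_banach[OF summable[OF \<epsilon>]]) (use X0(1) in auto)
      show "((\<lambda>X. f X t) \<longlongrightarrow> \<phi> \<epsilon> t *\<^sub>R a t) at_top" for t
        by (rule tendsto_eventually, rule eventually_mono[OF eventually_ge_at_top[of t]]) (simp add: f_def)
      show "\<forall>\<^sub>F X in at_top. \<forall>t\<in>{X0<..}. norm (f X t) \<le> norm (\<phi> \<epsilon> t *\<^sub>R a t)"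
        unfolding f_def by (intro always_eventually allI ballI) simp
    qed simp
    then show ?thesis
    proof (rule tendsto_upperbound[OF tendsto_norm])
      have "norm (infsum (f X) {X0<..}) \<le> 2 * d" if X: "X > X0" for X
      proof -
        have "infsum (f X) {X0<..} = (\<Sum>\<^sub>\<infinity>t\<in>{X0<..X}. \<phi> \<epsilon> t *\<^sub>R a t)"
          by (rule infsum_cong_neutral) (auto simp: f_def)
        also have "norm \<dots> \<le> 2 * d"
        proof (rule Abel_bound_infsum)
          show "norm (infsum a {X0<..Y}) \<le> 2 * d" if "Y \<in> {X0<..X}" for Y
            using seg that by simp
          show "0 \<le> \<phi> \<epsilon> x \<and> \<phi> \<epsilon> x \<le> 1" if "x \<in> {X0<..X}" for x
            using \<phi>[OF \<epsilon>, of x] that X0(1) by simp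
          show "antimono_on {X0<..X} (\<phi> \<epsilon>)"
            by (rule monotone_on_subset[OF mono[OF \<epsilon>]]) (use X0(1) in auto)
          show "(\<lambda>t. norm (a t)) summable_on {X0<..X}"
            by (rule summable_on_subset_banach[OF abs_a[of X]]) (use X0(1) in auto)
        qed (use d in simp)
        finally show ?thesis .
      qed
      then show "\<forall>\<^sub>F X in at_top. norm (infsum (f X) {X0<..}) \<le> 2 * d"
        by (rule eventually_mono[OF eventually_gt_at_top[of X0]])
    qed auto
  qed
  have pos: "\<forall>\<^sub>F \<epsilon> in at_right (0::real). \<epsilon> > 0" by (simp add: eventually_at_right_less)
  have "((\<lambda>\<epsilon>. \<Sum>\<^sub>\<infinity>t\<in>{u<..X0}. \<phi> \<epsilon> t *\<^sub>R a t) \<longlongrightarrow> infsum a {u<..X0}) (at_right 0)"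
  proof (rule tendsto_infsum_dominated[OF _ _ abs_a])
    show "((\<lambda>\<epsilon>. \<phi> \<epsilon> t *\<^sub>R a t) \<longlongrightarrow> a t) (at_right 0)" if "t \<in> {u<..X0}" for t
      by (rule tendsto_eq_rhs[OF tendsto_scaleR[OF lim tendsto_const]]) (use that in auto)
    show "\<forall>\<^sub>F \<epsilon> in at_right 0. \<forall>t\<in>{u<..X0}. norm (\<phi> \<epsilon> t *\<^sub>R a t) \<le> norm (a t)"
    proof (rule eventually_mono[OF pos], intro ballI)
      fix \<epsilon> t :: real assume "0 < \<epsilon>" "t \<in> {u<..X0}"
      then have "0 < \<phi> \<epsilon> t \<and> \<phi> \<epsilon> t \<le> 1" using \<phi> by simp
      then show "norm (\<phi> \<epsilon> t *\<^sub>R a t) \<le> norm (a t)" by (simp add: mult_left_le_one_le)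
    qed
  qed simp
  from tendstoD[OF this d] pos
  show "\<forall>\<^sub>F \<epsilon> in at_right 0. dist (\<Sum>\<^sub>\<infinity>t\<in>{u<..}. \<phi> \<epsilon> t *\<^sub>R a t) S < e"
  proof eventually_elim
    case (elim \<epsilon>)
    let ?g = "\<lambda>t. \<phi> \<epsilon> t *\<^sub>R a t"
    note sg = abs_summable_summable[OF summable[OF elim(2)]]
    have "?g summable_on {u<..X0}" "?g summable_on {X0<..}"
      using X0(1) by (auto intro!: summable_on_subset_banach[OF sg])
    then have "infsum ?g ({u<..X0} \<union> {X0<..}) = infsum ?g {u<..X0} + infsum ?g {X0<..}"
      by (rule infsum_Un_disjoint) auto
    moreover have "{u<..X0} \<union> {X0<..} = {u<..}" using X0(1) by auto
    ultimately have split: "infsum ?g {u<..} = infsum ?g {u<..X0} + infsum ?g {X0<..}" by simp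
    have "infsum ?g {u<..} - S = (infsum ?g {u<..X0} - infsum a {u<..X0}) + infsum ?g {X0<..}
        + (infsum a {u<..X0} - S)"
      unfolding split by simp
    also have "norm \<dots> \<le> norm (infsum ?g {u<..X0} - infsum a {u<..X0}) + norm (infsum ?g {X0<..})
        + norm (infsum a {u<..X0} - S)"
      by (intro norm_triangle_mono order_refl)
    also have "\<dots> < d + 2 * d + d"
      using elim(1)[unfolded dist_norm] tail[OF elim(2)] X0(2)[OF order_refl, unfolded dist_norm] by linarith
    finally show ?case using d unfolding dist_norm d_def by linarith
  qed
qed

subsection \<open>The incomplete Gamma function\<close>

text \<open>Passage between the nonnegative Lebesgue integral, where Tonelli and the interchange
  with series are available, and the gauge integral in which \<open>upper_Gamma\<close> and
  \<open>hol_proj_coeff\<close> are expressed.\<close>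

lemma nn_integral_atLeast_eq_iff:
  fixes f :: "real \<Rightarrow> real"
  assumes "(\<lambda>t. f t * indicator {a..} t) \<in> borel_measurable borel" "\<And>t. t \<ge> a \<Longrightarrow> 0 \<le> f t" "0 \<le> r"
  shows "(\<integral>\<^sup>+t. ennreal (f t) * indicator {a..} t \<partial>lborel) = ennreal r \<longleftrightarrow> (f has_integral r) {a..}"
proof
  assume L: "(\<integral>\<^sup>+t. ennreal (f t) * indicator {a..} t \<partial>lborel) = ennreal r"
  have "(\<integral>\<^sup>+t. ennreal (f t) * indicator {a..} t \<partial>lborel) = (\<integral>\<^sup>+t. ennreal (f t * indicator {a..} t) \<partial>lborel)"
    by (intro nn_integral_cong) (auto simp: indicator_def)
  with L have "((\<lambda>t. f t * indicator {a..} t) has_integral r) UNIV"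
    by (intro nn_integral_has_integral) (use assms in \<open>auto simp: indicator_def\<close>)
  then have "((\<lambda>t. if t \<in> {a..} then f t else 0) has_integral r) UNIV"
    by (rule has_integral_eq[rotated]) (auto simp: indicator_def)
  then show "(f has_integral r) {a..}"
    by (simp only: has_integral_restrict_UNIV)
next
  assume "(f has_integral r) {a..}"
  then show "(\<integral>\<^sup>+t. ennreal (f t) * indicator {a..} t \<partial>lborel) = ennreal r"
    by (intro nn_integral_has_integral_lebesgue') (use assms in auto)
qed

lemma upper_Gamma_has_integral:
  assumes x: "0 < x"
  shows "((\<lambda>t. exp (- t) * t powr (a - 1)) has_integral upper_Gamma a x) {x..}"
proof -
  \<comment> \<open>A positive exponent not below \<open>a\<close>: the Gamma integral for
    \<open>b\<close> converges, and on \<open>{x..}\<close> the quotient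
    \<open>t powr (a - b)\<close> is at most its value at x. This covers nonpositive
    \<open>a\<close>, as needed for \<open>a = 1 - k\<close>.\<close>
  define b where "b = \<bar>a\<bar> + 1"
  have b: "b > 0" "a \<le> b" by (auto simp: b_def)
  have "(\<lambda>t. t powr (b - 1) / exp t) absolutely_integrable_on {0..}"
    using Gamma_integral_real[OF b(1)] by (intro nonnegative_absolutely_integrable_1) auto
  then have "(\<lambda>t. t powr (b - 1) / exp t) absolutely_integrable_on {x..}"
    by (rule set_integrable_subset) (use x in auto)
  then have "(\<lambda>t. t powr (b - 1) / exp t) integrable_on {x..}"
    by (rule set_lebesgue_integral_eq_integral(1))
  then have g: "(\<lambda>t. x powr (a - b) * (t powr (b - 1) / exp t)) integrable_on {x..}"
    by (subst real_scaleR_def[symmetric]) (rule integrable_cmul)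
  have "(\<lambda>t. exp (- t) * t powr (a - 1)) integrable_on {x..}"
  proof (rule measurable_bounded_by_integrable_imp_integrable[OF _ g])
    show "(\<lambda>t. exp (- t) * t powr (a - 1)) \<in> borel_measurable (lebesgue_on {x..})"
      by (rule measurable_restrict_space1, rule measurable_completion) measurable
    show "norm (exp (- t) * t powr (a - 1)) \<le> x powr (a - b) * (t powr (b - 1) / exp t)"
      if "t \<in> {x..}" for t
    proof -
      have "t powr (a - 1) = t powr (a - b) * t powr (b - 1)" by (simp flip: powr_add)
      also have "\<dots> \<le> x powr (a - b) * t powr (b - 1)"
        by (intro mult_right_mono powr_mono2') (use that x b in auto)
      finally show ?thesis
        by (simp add: exp_minus divide_simps)
    qed
  qed auto
  then show ?thesis unfolding upper_Gamma_def by (rule integrable_integral)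
qed

lemma upper_Gamma_nonneg: "0 < x \<Longrightarrow> 0 \<le> upper_Gamma a x"
  using has_integral_nonneg[OF upper_Gamma_has_integral] by simp

lemma upper_Gamma_antimono: "0 < x \<Longrightarrow> x \<le> y \<Longrightarrow> upper_Gamma a y \<le> upper_Gamma a x"
  by (rule has_integral_subset_le[OF _ upper_Gamma_has_integral upper_Gamma_has_integral]) auto

lemma upper_Gamma_diff:
  assumes "0 < x" "x \<le> y"
  shows "((\<lambda>t. exp (- t) * t powr (a - 1)) has_integral (upper_Gamma a x - upper_Gamma a y)) {x..y}"
proof -
  have "(\<lambda>t. exp (- t) * t powr (a - 1)) integrable_on {x..y}"
    by (intro integrable_continuous_interval continuous_intros) (use assms in auto)
  then obtain I where I: "((\<lambda>t. exp (- t) * t powr (a - 1)) has_integral I) {x..y}" by blast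
  have "negligible ({x..y} \<inter> {y..})"
    by (rule negligible_subset[of "{y}"]) auto
  then have "((\<lambda>t. exp (- t) * t powr (a - 1)) has_integral (I + upper_Gamma a y)) ({x..y} \<union> {y..})"
    by (intro has_integral_Un I upper_Gamma_has_integral) (use assms in auto)
  moreover have "{x..y} \<union> {y..} = {x..}" using assms by auto
  ultimately have "I + upper_Gamma a y = upper_Gamma a x"
    using upper_Gamma_has_integral[OF assms(1)] has_integral_unique by metis
  then have "I = upper_Gamma a x - upper_Gamma a y" by simp
  then show ?thesis using I by simp
qed

lemma upper_Gamma_pos:
  assumes "0 < x" shows "0 < upper_Gamma a x"
proof -
  have "upper_Gamma a x - upper_Gamma a (x + 1) \<noteq> 0"
  proof
    assume "upper_Gamma a x - upper_Gamma a (x + 1) = 0"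
    then have z: "((\<lambda>t. exp (- t) * t powr (a - 1)) has_integral 0) (cbox x (x + 1))"
      using upper_Gamma_diff[of x "x + 1" a] assms by simp
    have "exp (- x) * x powr (a - 1) = 0"
      by (rule has_integral_0_cbox_imp_0[OF _ _ z]) (use assms in \<open>auto intro!: continuous_intros\<close>)
    then show False using assms by simp
  qed
  then show ?thesis
    using upper_Gamma_antimono[of x "x + 1" a] upper_Gamma_nonneg[of "x + 1" a] assms by simp
qed

lemma continuous_on_upper_Gamma: "continuous_on {0<..} (upper_Gamma a)"
  unfolding continuous_on_eq_continuous_at[OF open_greaterThan]
proof
  fix x :: real assume "x \<in> {0<..}"
  then have x: "0 < x" by simp
  have int: "(\<lambda>t. exp (- t) * t powr (a - 1)) integrable_on {x/2..2*x}"
    by (intro integrable_continuous_interval continuous_intros) (use x in auto)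
  have "continuous_on {x/2..2*x} (\<lambda>y. upper_Gamma a (x/2) - integral {x/2..y} (\<lambda>t. exp (- t) * t powr (a - 1)))"
    by (intro continuous_intros indefinite_integral_continuous_1 int)
  then have "continuous_on {x/2..2*x} (upper_Gamma a)"
  proof (rule continuous_on_eq)
    fix y assume "y \<in> {x/2..2*x}"
    then show "upper_Gamma a (x/2) - integral {x/2..y} (\<lambda>t. exp (- t) * t powr (a - 1)) = upper_Gamma a y"
      using integral_unique[OF upper_Gamma_diff[of "x/2" y a]] x by simp
  qed
  then show "isCont (upper_Gamma a) x"
    by (rule continuous_on_interior) (use x in auto)
qed

text \<open>The complementary integral over \<open>{0..x}\<close> is continuous in x up to 0,
  because for a > 0 the Gamma integral converges at 0.\<close>

lemma tendsto_upper_Gamma: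
  assumes a: "0 < a"
  shows "(upper_Gamma a \<longlongrightarrow> Gamma a) (at_right 0)"
proof -
  let ?f = "\<lambda>t. exp (- t) * t powr (a - 1)"
  have G: "(?f has_integral Gamma a) {0..}"
    using Gamma_integral_real[OF a] by (simp add: exp_minus field_simps)
  then have abs: "?f absolutely_integrable_on {0..}"
    by (intro nonnegative_absolutely_integrable_1) auto
  have int: "?f integrable_on {0..y}" for y
    by (rule set_lebesgue_integral_eq_integral(1), rule set_integrable_subset[OF abs]) auto
  have eq: "upper_Gamma a x = Gamma a - integral {0..x} ?f" if "0 < x" for x
  proof -
    have "negligible ({0..x} \<inter> {x..})" by (rule negligible_subset[of "{x}"]) auto
    then have "(?f has_integral (integral {0..x} ?f + upper_Gamma a x)) ({0..x} \<union> {x..})"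
      by (intro has_integral_Un upper_Gamma_has_integral integrable_integral int that)
    moreover have "{0..x} \<union> {x..} = {0..}" using that by auto
    ultimately show ?thesis using has_integral_unique[OF G] by fastforce
  qed
  have "continuous_on {0..1} (\<lambda>x. Gamma a - integral {0..x} ?f)"
    by (intro continuous_intros indefinite_integral_continuous_1 int)
  then have "((\<lambda>x. Gamma a - integral {0..x} ?f) \<longlongrightarrow> Gamma a - integral {0..0} ?f) (at 0 within {0..1})"
    unfolding continuous_on_def by (rule bspec) simp
  then have "((\<lambda>x. Gamma a - integral {0..x} ?f) \<longlongrightarrow> Gamma a) (at_right 0)"
    by (simp add: at_within_Icc_at_right)
  then show ?thesis
    by (rule Lim_transform_eventually) (auto simp: eq eventually_at_right_field intro!: exI[of _ 1])
qed

lemma upper_Gamma_le_Gamma: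
  assumes "0 < a" "0 < x" shows "upper_Gamma a x \<le> Gamma a"
proof (rule tendsto_lowerbound[OF tendsto_upper_Gamma[OF assms(1)]])
  show "\<forall>\<^sub>F y in at_right 0. upper_Gamma a x \<le> upper_Gamma a y"
    using assms by (auto simp: eventually_at_right_field intro!: exI[of _ x] upper_Gamma_antimono)
qed simp

text \<open>The substitution \<open>t \<mapsto> c * t\<close>. Both inner integrals of the later
  Tonelli argument have this shape.\<close>

lemma nn_integral_exp_powr:
  assumes c: "0 < c" and x: "0 < x"
  shows "(\<integral>\<^sup>+t. ennreal (exp (- c * t) * t powr (a - 1)) * indicator {x..} t \<partial>lborel) =
           ennreal (c powr (- a) * upper_Gamma a (c * x))"
proof -
  have "ennreal (upper_Gamma a (c * x)) =
      (\<integral>\<^sup>+t. ennreal (exp (- t) * t powr (a - 1)) * indicator {c * x..} t \<partial>lborel)"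
    by (rule nn_integral_atLeast_eq_iff[THEN iffD2, symmetric])
       (use c x upper_Gamma_has_integral upper_Gamma_nonneg in auto)
  also have "\<dots> = ennreal \<bar>c\<bar> * (\<integral>\<^sup>+t. ennreal (exp (- (0 + c * t)) * (0 + c * t) powr (a - 1)) * indicator {c * x..} (0 + c * t) \<partial>lborel)"
    by (rule nn_integral_real_affine) (use c in auto)
  also have "(\<integral>\<^sup>+t. ennreal (exp (- (0 + c * t)) * (0 + c * t) powr (a - 1)) * indicator {c * x..} (0 + c * t) \<partial>lborel)
      = (\<integral>\<^sup>+t. ennreal (c powr (a - 1)) * (ennreal (exp (- c * t) * t powr (a - 1)) * indicator {x..} t) \<partial>lborel)"
    by (intro nn_integral_cong)
       (use c x in \<open>auto simp: indicator_def powr_mult ennreal_mult' [symmetric] algebra_simps\<close>)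
  also have "\<dots> = ennreal (c powr (a - 1)) * (\<integral>\<^sup>+t. ennreal (exp (- c * t) * t powr (a - 1)) * indicator {x..} t \<partial>lborel)"
    by (rule nn_integral_cmult) measurable
  finally have "ennreal (upper_Gamma a (c * x)) = ennreal (c powr a) *
      (\<integral>\<^sup>+t. ennreal (exp (- c * t) * t powr (a - 1)) * indicator {x..} t \<partial>lborel)"
    using c by (simp add: mult.assoc[symmetric] ennreal_mult'[symmetric] powr_mult_base)
  then have "ennreal (c powr (- a)) * ennreal (upper_Gamma a (c * x)) = (ennreal (c powr (- a)) * ennreal (c powr a)) *
      (\<integral>\<^sup>+t. ennreal (exp (- c * t) * t powr (a - 1)) * indicator {x..} t \<partial>lborel)"
    by (simp only: mult.assoc)
  also have "ennreal (c powr (- a)) * ennreal (c powr a) = 1"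
    using c by (simp add: ennreal_mult'[symmetric] powr_minus)
  finally show ?thesis by (simp add: ennreal_mult')
qed

subsection \<open>An integral representation of the hypergeometric series\<close>

text \<open>With \<open>v = p / t\<close> this is the Beta integral B(\<kappa> - 1, n + 1). The
  induction builds an antiderivative vanishing at infinity, so the fundamental theorem is applied
  only once.\<close>

lemma nn_integral_powr_one_minus_power:
  fixes \<kappa> p :: real
  assumes \<kappa>: "1 < \<kappa>" and p: "0 < p"
  shows "(\<integral>\<^sup>+t. ennreal (t powr (- \<kappa>) * (1 - p / t) ^ n) * indicator {p..} t \<partial>lborel) =
           ennreal (p powr (1 - \<kappa>) * fact n / ((\<kappa> - 1) * pochhammer \<kappa> n))"
proof -
  define f where "f n t = t powr (- \<kappa>) * (1 - p / t) ^ n" for n t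
  define B where "B n = p powr (1 - \<kappa>) * fact n / ((\<kappa> - 1) * pochhammer \<kappa> n)" for n :: nat
  have "\<exists>\<Phi>. (\<forall>t\<ge>p. (\<Phi> has_real_derivative f n t) (at t)) \<and> (\<Phi> \<longlongrightarrow> 0) at_top \<and> \<Phi> p = - B n"
  proof (induction n)
    case 0
    have "((\<lambda>t. t powr (1 - \<kappa>) / (1 - \<kappa>)) has_real_derivative f 0 t) (at t)" if "t \<ge> p" for t
      using that p \<kappa> by (auto intro!: derivative_eq_intros simp: f_def)
    moreover have "((\<lambda>t. t powr (1 - \<kappa>) / (1 - \<kappa>)) \<longlongrightarrow> 0 / (1 - \<kappa>)) at_top"
      by (intro tendsto_divide tendsto_const tendsto_neg_powr filterlim_ident) (use \<kappa> in auto)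
    ultimately show ?case
      using \<kappa> by (intro exI[of _ "\<lambda>t. t powr (1 - \<kappa>) / (1 - \<kappa>)"]) (auto simp: B_def field_simps)
  next
    case (Suc n)
    then obtain \<Phi> where \<Phi>: "\<And>t. t \<ge> p \<Longrightarrow> (\<Phi> has_real_derivative f n t) (at t)" "(\<Phi> \<longlongrightarrow> 0) at_top" "\<Phi> p = - B n"
      by blast
    define N where "N = real (Suc n)"
    have N: "N > 0" by (simp add: N_def)
    \<comment> \<open>Its derivative combines \<open>f n\<close> and \<open>f (Suc n)\<close>, so
      the antiderivative of the latter follows by solving. It contributes no boundary term: it
      vanishes at p by its positive power and at infinity because \<kappa> > 1.\<close>
    define h where "h t = t powr (1 - \<kappa>) * (1 - p / t) ^ Suc n" for t
    have h: "(h has_real_derivative (N * f n t - (\<kappa> - 1 + N) * f (Suc n) t)) (at t)" if t: "t \<ge> p" for t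
    proof -
      have "t > 0" using t p by simp
      have "(h has_real_derivative ((1 - \<kappa>) * t powr (- \<kappa>) * (1 - p / t) ^ Suc n +
              t powr (1 - \<kappa>) * (N * (1 - p / t) ^ n * (p / t\<^sup>2)))) (at t)"
      proof -
        have "((\<lambda>t. t powr (1 - \<kappa>)) has_real_derivative (1 - \<kappa>) * t powr (- \<kappa>)) (at t)"
          using \<open>t > 0\<close> by (auto intro!: derivative_eq_intros)
        moreover have "((\<lambda>t. 1 - p / t) has_real_derivative p / t\<^sup>2) (at t)"
          using \<open>t > 0\<close> by (auto intro!: derivative_eq_intros simp: power2_eq_square)
        ultimately show ?thesis
          using DERIV_mult[OF _ DERIV_power[of "\<lambda>t. 1 - p / t" "p / t\<^sup>2" t UNIV "Suc n"]]
          unfolding h_def N_def by (fastforce simp: mult_ac)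
      qed
      also have "t powr (1 - \<kappa>) * (N * (1 - p / t) ^ n * (p / t\<^sup>2)) = N * t powr (- \<kappa>) * (1 - p / t) ^ n * (1 - (1 - p / t))"
        using \<open>t > 0\<close> by (simp add: powr_diff powr_minus power2_eq_square field_simps)
      also have "(1 - \<kappa>) * t powr (- \<kappa>) * u ^ Suc n + N * t powr (- \<kappa>) * u ^ n * (1 - u) =
          N * (t powr (- \<kappa>) * u ^ n) - (\<kappa> - 1 + N) * (t powr (- \<kappa>) * u ^ Suc n)" for u
        by (simp add: algebra_simps)
      finally show ?thesis by (simp add: f_def)
    qed
    have "(h \<longlongrightarrow> 0 * (1 - 0) ^ Suc n) at_top"
      unfolding h_def
      by (intro tendsto_mult tendsto_power tendsto_diff tendsto_const tendsto_neg_powr filterlim_ident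
            tendsto_divide_0[OF tendsto_const] filterlim_at_top_imp_at_infinity) (use \<kappa> in auto)
    then have h0: "(h \<longlongrightarrow> 0) at_top" by simp
    define \<Psi> where "\<Psi> t = (N * \<Phi> t - h t) / (\<kappa> - 1 + N)" for t
    have "(\<Psi> has_real_derivative f (Suc n) t) (at t)" if t: "t \<ge> p" for t
    proof -
      have "(\<Psi> has_real_derivative ((N * f n t - (N * f n t - (\<kappa> - 1 + N) * f (Suc n) t)) / (\<kappa> - 1 + N))) (at t)"
        unfolding \<Psi>_def by (intro DERIV_cdivide DERIV_diff DERIV_cmult \<Phi>(1) h t)
      then show ?thesis using \<kappa> N by simp
    qed
    moreover have "(\<Psi> \<longlongrightarrow> (N * 0 - 0) / (\<kappa> - 1 + N)) at_top"
      unfolding \<Psi>_def by (intro tendsto_intros \<Phi> h0) (use \<kappa> N in auto)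
    moreover have "\<Psi> p = - B (Suc n)"
    proof -
      have "B (Suc n) = N * B n / (\<kappa> + real n)"
        by (simp add: B_def pochhammer_Suc N_def mult_ac)
      moreover have "h p = 0" using p by (simp add: h_def)
      moreover have "\<kappa> - 1 + N = \<kappa> + real n" by (simp add: N_def)
      ultimately show ?thesis by (simp add: \<Psi>_def \<Phi>(3))
    qed
    ultimately show ?case by (intro exI[of _ \<Psi>]) simp
  qed
  then obtain \<Phi> where \<Phi>: "\<And>t. t \<ge> p \<Longrightarrow> (\<Phi> has_real_derivative f n t) (at t)" "(\<Phi> \<longlongrightarrow> 0) at_top" "\<Phi> p = - B n"
    by blast
  have "(\<integral>\<^sup>+t. ennreal (f n t) * indicator {p..} t \<partial>lborel) = ennreal (0 - \<Phi> p)"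
    by (rule nn_integral_FTC_atLeast[OF _ \<Phi>(1) _ \<Phi>(2)]) (use p in \<open>auto simp: f_def\<close>)
  then show ?thesis by (simp add: f_def \<Phi>(3) B_def)
qed

lemma negative_binomial_series:
  fixes l x :: real
  assumes "0 \<le> x" "x < 1"
  shows "(\<lambda>n. pochhammer l n / fact n * x ^ n) sums (1 - x) powr (- l)"
proof -
  have "(\<lambda>n. ((- l) gchoose n) * (- x) ^ n) sums (1 + (- x)) powr (- l)"
    by (rule gen_binomial_real) (use assms in auto)
  moreover have "((- l) gchoose n) * (- x) ^ n = pochhammer l n / fact n * x ^ n" for n
    by (simp add: gbinomial_pochhammer power_mult_distrib[symmetric] field_simps)
  ultimately show ?thesis by simp
qed

definition gamma_weight :: "real \<Rightarrow> real \<Rightarrow> real \<Rightarrow> real \<Rightarrow> real" where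
  "gamma_weight k l s t = t powr (- k) * (t + s) powr (- l)"

text \<open>Euler's integral for the hypergeometric function in the variable
  \<open>1 - p / t\<close>. As l > 0, the coefficients of the binomial series are nonnegative, so
  series and integral interchange, and each term is a Beta integral.\<close>

lemma gamma_weight_has_integral:
  assumes l: "0 < l" and kl: "1 < k + l" and s: "0 < s" and p: "0 < p"
  shows "(gamma_weight k l s has_integral
           p powr (1 - k) * (p + s) powr (- l) / (k + l - 1) * hypergeo_2F1 1 l (k + l) (s / (p + s))) {p..}"
proof -
  define \<kappa> where "\<kappa> = k + l"
  define z where "z = s / (p + s)"
  define C where "C = p powr l * (p + s) powr (- l)"
  define c where "c n = pochhammer l n / fact n" for n
  have \<kappa>: "1 < \<kappa>" and z: "0 < z" "z < 1" and C: "C > 0"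
    using kl s p by (auto simp: \<kappa>_def z_def C_def)
  have c: "c n \<ge> 0" for n unfolding c_def using l by (intro divide_nonneg_pos pochhammer_nonneg) auto
  have [measurable]: "gamma_weight k l s \<in> borel_measurable borel"
    unfolding gamma_weight_def by measurable
  have nonneg: "0 \<le> gamma_weight k l s t" for t by (simp add: gamma_weight_def)
  \<comment> \<open>\<open>t + s\<close> is normalised by its value at the endpoint p: the quotient
    of \<open>(t + s) / t\<close> by \<open>(p + s) / p\<close> is
    \<open>1 - z * (1 - p / t)\<close>, where the subtracted term lies in [0, 1).\<close>
  have factor: "gamma_weight k l s t = C * (t powr (- \<kappa>) * (1 - z * (1 - p / t)) powr (- l))" if t: "t \<ge> p" for t
  proof -
    have "t > 0" using t p by simp
    have ge: "1 - z * (1 - p / t) > 0"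
    proof -
      have "z * (1 - p / t) \<le> z * 1" using z \<open>t > 0\<close> p by (intro mult_left_mono) auto
      then show ?thesis using z by linarith
    qed
    have "t + s = t * ((p + s) / p) * (1 - z * (1 - p / t))"
    proof -
      have "z * (p + s) = s" using p s by (simp add: z_def)
      moreover have "t * (q / p) * (1 - z * (1 - p / t)) = t / p * (q - z * q * (1 - p / t))" for q
        by (simp add: algebra_simps)
      ultimately have "t * ((p + s) / p) * (1 - z * (1 - p / t)) = t / p * ((p + s) - s * (1 - p / t))"
        by metis
      also have "\<dots> = t + s" using \<open>t > 0\<close> p by (simp add: field_simps)
      finally show ?thesis by simp
    qed
    also have "\<dots> powr (- l) = t powr (- l) * ((p + s) / p) powr (- l) * (1 - z * (1 - p / t)) powr (- l)"
    proof -
      have "(t * ((p + s) / p) * (1 - z * (1 - p / t))) powr (- l) = (t * ((p + s) / p)) powr (- l) * (1 - z * (1 - p / t)) powr (- l)"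
        by (rule powr_mult)
      also have "(t * ((p + s) / p)) powr (- l) = t powr (- l) * ((p + s) / p) powr (- l)"
        by (rule powr_mult)
      finally show ?thesis .
    qed
    also have "((p + s) / p) powr (- l) = C"
      using p s by (simp add: C_def powr_divide powr_minus field_simps)
    finally show ?thesis
      by (simp add: gamma_weight_def \<kappa>_def powr_add powr_minus powr_diff field_simps)
  qed
  \<comment> \<open>An \<open>ennreal\<close> identity alone would permit infinity on both sides;
    finiteness is what makes the real series summable.\<close>
  have finite: "(\<integral>\<^sup>+t. ennreal (gamma_weight k l s t) * indicator {p..} t \<partial>lborel) < \<infinity>"
  proof -
    have "(\<integral>\<^sup>+t. ennreal (gamma_weight k l s t) * indicator {p..} t \<partial>lborel) \<le>
          (\<integral>\<^sup>+t. ennreal (t powr (- \<kappa>) * (1 - p / t) ^ 0) * indicator {p..} t \<partial>lborel)"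
    proof (intro nn_integral_mono)
      fix t
      show "ennreal (gamma_weight k l s t) * indicator {p..} t \<le> ennreal (t powr (- \<kappa>) * (1 - p / t) ^ 0) * indicator {p..} t"
      proof (cases "t \<ge> p")
        case True
        have "gamma_weight k l s t \<le> t powr (- k) * t powr (- l)"
          unfolding gamma_weight_def by (intro mult_left_mono powr_mono2') (use True p s l in auto)
        also have "\<dots> = t powr (- \<kappa>)" by (simp add: \<kappa>_def flip: powr_add)
        finally show ?thesis using True by (simp add: ennreal_leI)
      qed auto
    qed
    also have "\<dots> < \<infinity>" by (subst nn_integral_powr_one_minus_power[OF \<kappa> p]) simp
    finally show ?thesis .
  qed
  define T where "T n = C * c n * z ^ n * (p powr (1 - \<kappa>) * fact n / ((\<kappa> - 1) * pochhammer \<kappa> n))" for n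
  have T_nonneg: "T n \<ge> 0" for n
    unfolding T_def using C c z \<kappa> by (intro mult_nonneg_nonneg divide_nonneg_nonneg pochhammer_nonneg) auto
  have "(\<integral>\<^sup>+t. ennreal (gamma_weight k l s t) * indicator {p..} t \<partial>lborel) =
        (\<integral>\<^sup>+t. (\<Sum>n. ennreal (C * c n * z ^ n) * (ennreal (t powr (- \<kappa>) * (1 - p / t) ^ n) * indicator {p..} t)) \<partial>lborel)"
  proof (intro nn_integral_cong)
    fix t :: real
    show "ennreal (gamma_weight k l s t) * indicator {p..} t =
       (\<Sum>n. ennreal (C * c n * z ^ n) * (ennreal (t powr (- \<kappa>) * (1 - p / t) ^ n) * indicator {p..} t))"
    proof (cases "t \<ge> p")
      case True
      have pt: "0 \<le> 1 - p / t" "1 - p / t < 1" using True p by auto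
      have "z * (1 - p / t) < 1 * 1" using pt z by (intro mult_strict_mono) auto
      then have "(\<lambda>n. c n * (z * (1 - p / t)) ^ n) sums (1 - z * (1 - p / t)) powr (- l)"
        unfolding c_def by (intro negative_binomial_series) (use pt z in auto)
      then have "(\<lambda>n. C * t powr (- \<kappa>) * (c n * (z * (1 - p / t)) ^ n)) sums
          (C * t powr (- \<kappa>) * (1 - z * (1 - p / t)) powr (- l))"
        by (rule sums_mult)
      then have "(\<lambda>n. C * c n * z ^ n * (t powr (- \<kappa>) * (1 - p / t) ^ n)) sums gamma_weight k l s t"
        unfolding factor[OF True] by (simp add: power_mult_distrib mult_ac)
      then have "(\<Sum>n. ennreal (C * c n * z ^ n * (t powr (- \<kappa>) * (1 - p / t) ^ n))) = ennreal (gamma_weight k l s t)"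
        by (intro suminf_ennreal_eq) (use C c z pt in auto)
      then show ?thesis using True C c z pt by (simp add: ennreal_mult')
    qed simp
  qed
  also have "\<dots> = (\<Sum>n. \<integral>\<^sup>+t. ennreal (C * c n * z ^ n) * (ennreal (t powr (- \<kappa>) * (1 - p / t) ^ n) * indicator {p..} t) \<partial>lborel)"
    by (rule nn_integral_suminf) measurable
  also have "\<dots> = (\<Sum>n. ennreal (T n))"
  proof (intro suminf_cong)
    fix n
    have "(\<integral>\<^sup>+t. ennreal (C * c n * z ^ n) * (ennreal (t powr (- \<kappa>) * (1 - p / t) ^ n) * indicator {p..} t) \<partial>lborel)
       = ennreal (C * c n * z ^ n) * (\<integral>\<^sup>+t. ennreal (t powr (- \<kappa>) * (1 - p / t) ^ n) * indicator {p..} t \<partial>lborel)"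
      by (rule nn_integral_cmult) measurable
    also have "\<dots> = ennreal (T n)"
      unfolding nn_integral_powr_one_minus_power[OF \<kappa> p] T_def
      by (rule ennreal_mult'[symmetric]) (use C c z in auto)
    finally show "(\<integral>\<^sup>+t. ennreal (C * c n * z ^ n) * (ennreal (t powr (- \<kappa>) * (1 - p / t) ^ n) * indicator {p..} t) \<partial>lborel) = ennreal (T n)" .
  qed
  finally have sum_T: "(\<integral>\<^sup>+t. ennreal (gamma_weight k l s t) * indicator {p..} t \<partial>lborel) = (\<Sum>n. ennreal (T n))" .
  then have "(\<Sum>n. ennreal (T n)) \<noteq> top_class.top" using finite by simp
  then have summable: "summable T" by (rule summable_suminf_not_top[OF T_nonneg])
  define D where "D = p powr (1 - k) * (p + s) powr (- l) / (k + l - 1)"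
  have D: "D > 0" using p s kl by (simp add: D_def)
  \<comment> \<open>The parameter 1 of the hypergeometric series is the factorial of the Beta
    integral, \<open>pochhammer 1 n = fact n\<close>.\<close>
  have T_eq: "T n = D * (pochhammer 1 n * pochhammer l n / pochhammer (k + l) n * (z ^ n / fact n))" for n
  proof -
    have "pochhammer \<kappa> n > 0" using \<kappa> by (intro pochhammer_pos) auto
    moreover have "p powr (1 - k) = p powr l * p powr (1 - \<kappa>)" by (simp add: \<kappa>_def flip: powr_add)
    ultimately show ?thesis
      using \<kappa> by (simp add: T_def D_def C_def c_def \<kappa>_def[symmetric] pochhammer_fact[symmetric] field_simps)
  qed
  have "summable (\<lambda>n. pochhammer 1 n * pochhammer l n / pochhammer (k + l) n * (z ^ n / fact n))"
    using summable D unfolding T_eq by (simp add: summable_mult_D)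
  then have "suminf T = D * hypergeo_2F1 1 l (k + l) z"
    unfolding T_eq hypergeo_2F1_def by (rule suminf_mult)
  then have "(\<integral>\<^sup>+t. ennreal (gamma_weight k l s t) * indicator {p..} t \<partial>lborel) = ennreal (D * hypergeo_2F1 1 l (k + l) z)"
    using sum_T suminf_ennreal2[OF T_nonneg summable] by simp
  moreover have "0 \<le> D * hypergeo_2F1 1 l (k + l) z"
    using suminf_nonneg[OF summable T_nonneg] \<open>suminf T = _\<close> by simp
  ultimately have "(gamma_weight k l s has_integral (D * hypergeo_2F1 1 l (k + l) z)) {p..}"
    by (intro nn_integral_atLeast_eq_iff[THEN iffD1]) (use nonneg in auto)
  then show ?thesis by (simp add: D_def z_def)
qed

subsection \<open>Truncated integrals of the incomplete Gamma function\<close>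

lemma integral_atLeast_pos:
  fixes f :: "real \<Rightarrow> real"
  assumes int: "f integrable_on {p..}" and cont: "continuous_on {p..} f" and pos: "\<And>t. p \<le> t \<Longrightarrow> 0 < f t"
  shows "0 < integral {p..} f"
proof -
  have int1: "f integrable_on {p..p+1}"
    by (intro integrable_continuous_interval continuous_on_subset[OF cont]) auto
  have "integral {p..p+1} f \<noteq> 0"
  proof
    assume "integral {p..p+1} f = 0"
    then have z: "(f has_integral 0) (cbox p (p + 1))"
      using int1 integrable_integral by fastforce
    have "f p = 0"
      by (rule has_integral_0_cbox_imp_0[OF _ _ z])
         (use pos in \<open>auto intro: continuous_on_subset[OF cont] less_imp_le\<close>)
    then show False using pos[of p] by simp
  qed
  moreover have "0 \<le> integral {p..p+1} f" by (rule integral_nonneg[OF int1]) (use pos less_imp_le in auto)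
  moreover have "integral {p..p+1} f \<le> integral {p..} f"
    by (rule integral_subset_le[OF _ int1 int]) (use pos less_imp_le in auto)
  ultimately show ?thesis by simp
qed

lemma integral_atLeast_split:
  fixes f :: "real \<Rightarrow> real"
  assumes "f integrable_on {p..}" "f integrable_on {p'..}" "f integrable_on {p..p'}" "p \<le> p'"
  shows "integral {p..} f = integral {p..p'} f + integral {p'..} f"
proof -
  have "negligible ({p..p'} \<inter> {p'..})" by (rule negligible_subset[of "{p'}"]) auto
  then have "(f has_integral (integral {p..p'} f + integral {p'..} f)) ({p..p'} \<union> {p'..})"
    by (intro has_integral_Un integrable_integral assms)
  moreover have "{p..p'} \<union> {p'..} = {p..}" using assms by auto
  ultimately show ?thesis by (simp add: integral_unique)
qed

definition gamma_weight_trunc :: "real \<Rightarrow> real \<Rightarrow> real \<Rightarrow> real \<Rightarrow> real \<Rightarrow> real" where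
  "gamma_weight_trunc k l s \<epsilon> t = gamma_weight k l s t * upper_Gamma l ((t + s) * \<epsilon>)"

definition trunc_ratio :: "real \<Rightarrow> real \<Rightarrow> real \<Rightarrow> real \<Rightarrow> real \<Rightarrow> real" where
  "trunc_ratio k l s \<epsilon> p =
     integral {p..} (gamma_weight_trunc k l s \<epsilon>) / (Gamma l * integral {p..} (gamma_weight k l s))"

context
  fixes k l s :: real
  assumes l: "0 < l" and kl: "1 < k + l" and s: "0 < s"
begin

lemma gamma_weight_integrable: "0 < p \<Longrightarrow> gamma_weight k l s integrable_on {p..}"
  using gamma_weight_has_integral[OF l kl s] by blast

lemma gamma_weight_continuous: "0 < p \<Longrightarrow> continuous_on {p..} (gamma_weight k l s)"
  unfolding gamma_weight_def using s by (auto intro!: continuous_intros)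

lemma gamma_weight_pos: "0 < t \<Longrightarrow> 0 < gamma_weight k l s t"
  using s by (simp add: gamma_weight_def)

lemma gamma_weight_trunc_continuous: "0 < \<epsilon> \<Longrightarrow> 0 < p \<Longrightarrow> continuous_on {p..} (gamma_weight_trunc k l s \<epsilon>)"
  unfolding gamma_weight_trunc_def using s
  by (intro continuous_on_mult gamma_weight_continuous continuous_on_compose2[OF continuous_on_upper_Gamma])
     (auto intro!: continuous_intros mult_pos_pos add_pos_pos)

lemma gamma_weight_trunc_pos: "0 < \<epsilon> \<Longrightarrow> 0 < t \<Longrightarrow> 0 < gamma_weight_trunc k l s \<epsilon> t"
  unfolding gamma_weight_trunc_def using s by (intro mult_pos_pos gamma_weight_pos upper_Gamma_pos) auto

lemma gamma_weight_trunc_le: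
  "0 < \<epsilon> \<Longrightarrow> 0 < t \<Longrightarrow> gamma_weight_trunc k l s \<epsilon> t \<le> Gamma l * gamma_weight k l s t"
  unfolding gamma_weight_trunc_def using s gamma_weight_pos[of t] upper_Gamma_le_Gamma[OF l, of "(t + s) * \<epsilon>"]
  by (subst mult.commute) (intro mult_right_mono; simp)

lemma gamma_weight_trunc_integrable:
  assumes "0 < \<epsilon>" "0 < p" shows "gamma_weight_trunc k l s \<epsilon> integrable_on {p..}"
proof (rule measurable_bounded_by_integrable_imp_integrable)
  show "gamma_weight_trunc k l s \<epsilon> \<in> borel_measurable (lebesgue_on {p..})"
    by (rule continuous_imp_measurable_on_sets_lebesgue[OF gamma_weight_trunc_continuous[OF assms]]) simp
  show "(\<lambda>t. Gamma l * gamma_weight k l s t) integrable_on {p..}"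
    by (subst real_scaleR_def[symmetric]) (intro integrable_cmul gamma_weight_integrable assms)
  show "norm (gamma_weight_trunc k l s \<epsilon> t) \<le> Gamma l * gamma_weight k l s t" if "t \<in> {p..}" for t
    using gamma_weight_trunc_le[OF assms(1), of t] gamma_weight_trunc_pos[OF assms(1), of t] that assms by simp
qed simp

text \<open>Rescaling the incomplete Gamma integral makes its lower limit p independent of y and
  leaves the power \<open>y powr (l - 1)\<close>. After exchanging the order, the y-integral is
  again an incomplete Gamma function, now of parameter l.\<close>

lemma truncated_Mellin_upper_Gamma:
  assumes \<epsilon>: "0 < \<epsilon>" and p: "0 < p"
  shows "((\<lambda>y. exp (- s * y) * y powr (k + l - 2) * upper_Gamma (1 - k) (p * y)) has_integral
           integral {p..} (gamma_weight_trunc k l s \<epsilon>)) {\<epsilon>..}"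
proof -
  \<comment> \<open>Both indicators are built in, so the two iterated integrals concern the same
    function.\<close>
  define h where "h y t = ennreal (exp (- s * y) * y powr (l - 1) * (exp (- y * t) * t powr (- k))) * indicator {p..} t * indicator {\<epsilon>..} y" for y t
  have [measurable]: "case_prod h \<in> borel_measurable (lborel \<Otimes>\<^sub>M lborel)"
    unfolding h_def by measurable
  have in1: "(\<integral>\<^sup>+t. h y t \<partial>lborel) =
      ennreal (exp (- s * y) * y powr (k + l - 2) * upper_Gamma (1 - k) (p * y)) * indicator {\<epsilon>..} y" for y
  proof (cases "y \<ge> \<epsilon>")
    case True
    have "(\<integral>\<^sup>+t. h y t \<partial>lborel) = (\<integral>\<^sup>+t. ennreal (exp (- s * y) * y powr (l - 1)) *
        (ennreal (exp (- y * t) * t powr ((1 - k) - 1)) * indicator {p..} t) \<partial>lborel)"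
      using True by (intro nn_integral_cong) (simp add: h_def ennreal_mult' mult.assoc)
    also have "\<dots> = ennreal (exp (- s * y) * y powr (l - 1)) *
        (\<integral>\<^sup>+t. (ennreal (exp (- y * t) * t powr ((1 - k) - 1)) * indicator {p..} t) \<partial>lborel)"
      by (rule nn_integral_cmult) measurable
    also have "\<dots> = ennreal (exp (- s * y) * y powr (l - 1) * (y powr (- (1 - k)) * upper_Gamma (1 - k) (y * p)))"
      using True \<epsilon> p by (subst nn_integral_exp_powr) (auto simp: ennreal_mult')
    also have "exp (- s * y) * y powr (l - 1) * (y powr (- (1 - k)) * upper_Gamma (1 - k) (y * p)) =
        exp (- s * y) * (y powr (l - 1) * y powr (- (1 - k))) * upper_Gamma (1 - k) (p * y)"
      by (simp add: mult_ac)
    also have "y powr (l - 1) * y powr (- (1 - k)) = y powr (k + l - 2)"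
      by (simp add: algebra_simps flip: powr_add)
    finally show ?thesis using True by simp
  qed (simp add: h_def)
  have in2: "(\<integral>\<^sup>+y. h y t \<partial>lborel) = ennreal (gamma_weight_trunc k l s \<epsilon> t) * indicator {p..} t" for t
  proof (cases "t \<ge> p")
    case True
    then have t: "t > 0" using p by simp
    have "(\<integral>\<^sup>+y. h y t \<partial>lborel) = (\<integral>\<^sup>+y. ennreal (t powr (- k)) *
        (ennreal (exp (- (t + s) * y) * y powr (l - 1)) * indicator {\<epsilon>..} y) \<partial>lborel)"
    proof (intro nn_integral_cong)
      fix y :: real
      have "exp (- s * y) * y powr (l - 1) * (exp (- y * t) * t powr (- k)) =
            t powr (- k) * ((exp (- s * y) * exp (- y * t)) * y powr (l - 1))" by (simp add: mult_ac)
      also have "exp (- s * y) * exp (- y * t) = exp (- (t + s) * y)"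
        by (simp add: algebra_simps flip: exp_add)
      finally show "h y t = ennreal (t powr (- k)) * (ennreal (exp (- (t + s) * y) * y powr (l - 1)) * indicator {\<epsilon>..} y)"
        using True unfolding h_def by (simp only: ennreal_mult' powr_ge_zero mult.assoc) simp
    qed
    also have "\<dots> = ennreal (t powr (- k)) * (\<integral>\<^sup>+y. (ennreal (exp (- (t + s) * y) * y powr (l - 1)) * indicator {\<epsilon>..} y) \<partial>lborel)"
      by (rule nn_integral_cmult) measurable
    also have "\<dots> = ennreal (t powr (- k) * ((t + s) powr (- l) * upper_Gamma l ((t + s) * \<epsilon>)))"
      by (subst nn_integral_exp_powr) (use t s \<epsilon> in \<open>auto simp: ennreal_mult'\<close>)
    finally show ?thesis using True by (simp add: gamma_weight_trunc_def gamma_weight_def mult.assoc)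
  qed (simp add: h_def)
  have "(\<integral>\<^sup>+y. ennreal (exp (- s * y) * y powr (k + l - 2) * upper_Gamma (1 - k) (p * y)) * indicator {\<epsilon>..} y \<partial>lborel)
      = (\<integral>\<^sup>+y. (\<integral>\<^sup>+t. h y t \<partial>lborel) \<partial>lborel)" by (simp only: in1)
  also have "\<dots> = (\<integral>\<^sup>+t. (\<integral>\<^sup>+y. h y t \<partial>lborel) \<partial>lborel)"
    by (rule lborel_pair.Fubini'[symmetric]) measurable
  also have "\<dots> = (\<integral>\<^sup>+t. ennreal (gamma_weight_trunc k l s \<epsilon> t) * indicator {p..} t \<partial>lborel)" by (simp only: in2)
  \<comment> \<open>Finiteness is known on the t side, by comparison with
    \<open>gamma_weight\<close>, and passes from there to the y side.\<close>
  also have "\<dots> = ennreal (integral {p..} (gamma_weight_trunc k l s \<epsilon>))"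
    by (rule nn_integral_has_integral_lebesgue'[OF _ integrable_integral[OF gamma_weight_trunc_integrable[OF \<epsilon> p]]])
       (use gamma_weight_trunc_pos[OF \<epsilon>] p in \<open>auto intro: less_imp_le\<close>)
  finally show ?thesis
  proof (rule nn_integral_atLeast_eq_iff[THEN iffD1, rotated -1])
    have "continuous_on {\<epsilon>..} (\<lambda>y. exp (- s * y) * y powr (k + l - 2) * upper_Gamma (1 - k) (p * y))"
      using \<epsilon> p by (intro continuous_on_mult continuous_on_compose2[OF continuous_on_upper_Gamma])
                   (auto intro!: continuous_intros)
    from borel_measurable_continuous_on_indicator[OF _ this]
    show "(\<lambda>y. exp (- s * y) * y powr (k + l - 2) * upper_Gamma (1 - k) (p * y) * indicator {\<epsilon>..} y) \<in> borel_measurable borel"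
      by (simp add: mult.commute)
    show "0 \<le> exp (- s * y) * y powr (k + l - 2) * upper_Gamma (1 - k) (p * y)" if "y \<ge> \<epsilon>" for y
      using upper_Gamma_nonneg[of "p * y" "1 - k"] that \<epsilon> p by simp
    show "0 \<le> integral {p..} (gamma_weight_trunc k l s \<epsilon>)"
      by (rule integral_nonneg[OF gamma_weight_trunc_integrable[OF \<epsilon> p]])
         (use gamma_weight_trunc_pos[OF \<epsilon>] p in \<open>auto intro: less_imp_le\<close>)
  qed
qed

lemma gamma_weight_integral_pos: "0 < p \<Longrightarrow> 0 < integral {p..} (gamma_weight k l s)"
  by (intro integral_atLeast_pos gamma_weight_integrable gamma_weight_continuous gamma_weight_pos) auto

lemma trunc_ratio_pos: "0 < \<epsilon> \<Longrightarrow> 0 < p \<Longrightarrow> 0 < trunc_ratio k l s \<epsilon> p"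
  unfolding trunc_ratio_def
  by (intro divide_pos_pos mult_pos_pos Gamma_real_pos l gamma_weight_integral_pos integral_atLeast_pos
        gamma_weight_trunc_integrable gamma_weight_trunc_continuous gamma_weight_trunc_pos) auto

lemma trunc_ratio_le_1:
  assumes "0 < \<epsilon>" "0 < p" shows "trunc_ratio k l s \<epsilon> p \<le> 1"
proof -
  have "integral {p..} (gamma_weight_trunc k l s \<epsilon>) \<le> integral {p..} (\<lambda>t. Gamma l *\<^sub>R gamma_weight k l s t)"
    by (rule integral_le[OF gamma_weight_trunc_integrable[OF assms] integrable_cmul[OF gamma_weight_integrable[OF assms(2)]]])
       (use gamma_weight_trunc_le[OF assms(1)] assms in auto)
  also have "\<dots> = Gamma l * integral {p..} (gamma_weight k l s)" by simp
  finally show ?thesis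
    unfolding trunc_ratio_def
    using gamma_weight_integral_pos[OF assms(2)] Gamma_real_pos[OF l] by (subst divide_le_eq_1_pos) auto
qed

text \<open>Up to a constant factor, the ratio is the average of the decreasing function
  \<open>t \<mapsto> upper_Gamma l ((t + s) * \<epsilon>)\<close> over the half-line \<open>{p..}\<close>.\<close>

lemma trunc_ratio_antimono:
  assumes \<epsilon>: "0 < \<epsilon>" shows "antimono_on {0<..} (trunc_ratio k l s \<epsilon>)"
proof (rule monotone_onI)
  fix p p' :: real assume "p \<in> {0<..}" "p' \<in> {0<..}" and le: "p \<le> p'"
  then have p: "0 < p" "0 < p'" by auto
  let ?w = "gamma_weight k l s" and ?v = "gamma_weight_trunc k l s \<epsilon>"
  \<comment> \<open>The value of the decreasing factor at \<open>p'\<close> separates the two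
    ranges: the average beyond \<open>p'\<close> is at most \<open>u\<close>, the integral before it
    at least \<open>u * w0\<close>. Adding the first range can therefore only raise the
    average.\<close>
  define u where "u = upper_Gamma l ((p' + s) * \<epsilon>)"
  have intw: "?w integrable_on {p..p'}" and intv: "?v integrable_on {p..p'}"
    using continuous_on_subset[OF gamma_weight_continuous[OF p(1)], of "{p..p'}"]
      continuous_on_subset[OF gamma_weight_trunc_continuous[OF \<epsilon> p(1)], of "{p..p'}"]
    by (auto intro!: integrable_continuous_interval)
  define w0 w1 v0 v1 where "w0 = integral {p..p'} ?w" "w1 = integral {p'..} ?w"
    "v0 = integral {p..p'} ?v" "v1 = integral {p'..} ?v"
  note defs = this
  have sw: "integral {p..} ?w = w0 + w1" and sv: "integral {p..} ?v = v0 + v1"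
    unfolding defs by (intro integral_atLeast_split gamma_weight_integrable gamma_weight_trunc_integrable intw intv \<epsilon> p le)+
  have "v1 \<le> integral {p'..} (\<lambda>t. u *\<^sub>R ?w t)"
    unfolding defs
  proof (rule integral_le[OF gamma_weight_trunc_integrable[OF \<epsilon> p(2)] integrable_cmul[OF gamma_weight_integrable[OF p(2)]]])
    fix t assume t: "t \<in> {p'..}"
    have "upper_Gamma l ((t + s) * \<epsilon>) \<le> u"
      unfolding u_def by (rule upper_Gamma_antimono) (use p s \<epsilon> t in auto)
    then show "?v t \<le> u *\<^sub>R ?w t"
      using gamma_weight_pos[of t] t p by (simp add: gamma_weight_trunc_def mult.commute)
  qed
  then have v1: "v1 \<le> u * w1" by (simp add: defs)
  have "integral {p..p'} (\<lambda>t. u *\<^sub>R ?w t) \<le> v0"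
    unfolding defs
  proof (rule integral_le[OF integrable_cmul[OF intw] intv])
    fix t assume t: "t \<in> {p..p'}"
    have "u \<le> upper_Gamma l ((t + s) * \<epsilon>)"
      unfolding u_def by (rule upper_Gamma_antimono) (use p s \<epsilon> t in auto)
    then show "u *\<^sub>R ?w t \<le> ?v t"
      using gamma_weight_pos[of t] t p by (simp add: gamma_weight_trunc_def mult.commute)
  qed
  then have v0: "u * w0 \<le> v0" by (simp add: defs)
  have w1: "w1 > 0" unfolding defs by (rule gamma_weight_integral_pos[OF p(2)])
  have w0: "w0 \<ge> 0" unfolding defs
    by (rule integral_nonneg[OF intw]) (use gamma_weight_pos p in \<open>auto intro: less_imp_le\<close>)
  have "v1 * w0 \<le> (u * w1) * w0" using v1 w0 by (rule mult_right_mono)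
  also have "\<dots> = (u * w0) * w1" by simp
  also have "\<dots> \<le> v0 * w1" using v0 w1 by (intro mult_right_mono) auto
  finally have "v1 / w1 \<le> (v0 + v1) / (w0 + w1)"
    using w0 w1 by (simp add: divide_simps algebra_simps)
  then have "v1 / w1 / Gamma l \<le> (v0 + v1) / (w0 + w1) / Gamma l"
    using Gamma_real_pos[OF l] by (intro divide_right_mono) auto
  then show "trunc_ratio k l s \<epsilon> p \<ge> trunc_ratio k l s \<epsilon> p'"
    unfolding trunc_ratio_def sw sv unfolding defs by (simp add: mult.commute)
qed

text \<open>\<open>Gamma l * gamma_weight k l s t\<close> dominates the truncated integrand for all
  \<epsilon>; the right-hand limit is tested along sequences to fit dominated convergence.\<close>

lemma trunc_ratio_tendsto_1:
  assumes p: "0 < p" shows "((\<lambda>\<epsilon>. trunc_ratio k l s \<epsilon> p) \<longlongrightarrow> 1) (at_right 0)"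
proof (rule tendsto_at_right_sequentially[of 0 1])
  fix S :: "nat \<Rightarrow> real" assume S: "\<And>n. 0 < S n" "S \<longlonglongrightarrow> 0"
  have lim: "(\<lambda>n. gamma_weight_trunc k l s (S n) t) \<longlonglongrightarrow> Gamma l * gamma_weight k l s t" if t: "t \<in> {p..}" for t
  proof -
    have ts: "t + s > 0" using t p s by simp
    have "filterlim (\<lambda>n. (t + s) * S n) (at_right 0) sequentially"
      unfolding filterlim_at using tendsto_mult_right_zero[OF S(2), of "t + s"] S(1) ts
      by (auto intro!: always_eventually simp: less_imp_neq[OF S(1), symmetric])
    from filterlim_compose[OF tendsto_upper_Gamma[OF l] this]
    have "(\<lambda>n. gamma_weight k l s t * upper_Gamma l ((t + s) * S n)) \<longlonglongrightarrow> gamma_weight k l s t * Gamma l"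
      by (intro tendsto_mult_left)
    then show ?thesis by (simp add: gamma_weight_trunc_def mult.commute)
  qed
  have "(\<lambda>n. integral {p..} (gamma_weight_trunc k l s (S n))) \<longlonglongrightarrow> integral {p..} (\<lambda>t. Gamma l * gamma_weight k l s t)"
  proof (rule dominated_convergence(2)[OF _ _ _ lim])
    show "gamma_weight_trunc k l s (S n) integrable_on {p..}" for n
      using gamma_weight_trunc_integrable S p by blast
    show "(\<lambda>t. Gamma l * gamma_weight k l s t) integrable_on {p..}"
      by (subst real_scaleR_def[symmetric]) (intro integrable_cmul gamma_weight_integrable p)
    show "norm (gamma_weight_trunc k l s (S n) t) \<le> Gamma l * gamma_weight k l s t" if "t \<in> {p..}" for n t
      using gamma_weight_trunc_le[OF S(1)[of n], of t] gamma_weight_trunc_pos[OF S(1)[of n], of t] that p by simp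
  qed
  then have "(\<lambda>n. trunc_ratio k l s (S n) p) \<longlonglongrightarrow> (Gamma l * integral {p..} (gamma_weight k l s)) / (Gamma l * integral {p..} (gamma_weight k l s))"
    unfolding trunc_ratio_def
    by (intro tendsto_divide tendsto_const)
       (use gamma_weight_integral_pos[OF p] Gamma_real_pos[OF l] in auto)
  then show "(\<lambda>n. trunc_ratio k l s (S n) p) \<longlonglongrightarrow> 1"
    using gamma_weight_integral_pos[OF p] Gamma_real_pos[OF l] by simp
qed simp

end

subsection \<open>Fourier expansions in real exponents\<close>

lemma norm_vector_smult: "norm (c *s v) = norm c * norm (v :: complex^'m::finite)"
  by (simp add: norm_vec_def norm_mult L2_set_right_distrib)

lemma of_real_vector_smult: "of_real r *s v = r *\<^sub>R (v :: complex^'m)"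
  by (simp add: vec_eq_iff complex_eq_iff)

lemma bounded_linear_vector_smult: "bounded_linear (\<lambda>v :: complex^'m::finite. c *s v)"
  by (rule bounded_linear_intro[of _ "norm c"])
     (simp_all add: vector_add_ldistrib norm_vector_smult vec_eq_iff mult.commute)

lemma bounded_linear_vector_smult_left: "bounded_linear (\<lambda>c. c *s (v :: complex^'m::finite))"
  by (rule bounded_linear_intro[of _ "norm v"])
     (simp_all add: norm_vector_smult vec_eq_iff algebra_simps)

lemma has_sum_sum_finite:
  fixes f :: "'j \<Rightarrow> 'a \<Rightarrow> 'b::topological_comm_monoid_add"
  assumes "finite J" "\<And>j. j \<in> J \<Longrightarrow> (f j has_sum s j) A"
  shows "((\<lambda>x. \<Sum>j\<in>J. f j x) has_sum (\<Sum>j\<in>J. s j)) A"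
  using assms by (induction J rule: finite_induct) (auto intro: has_sum_add)

section \<open>Bohr means along arithmetic progressions\<close>

lemma Cesaro_mean_powers:
  fixes w :: complex
  assumes "norm w = 1" "w \<noteq> 1"
  shows "(\<lambda>N. (\<Sum>j<N. w ^ j) / of_nat N) \<longlonglongrightarrow> 0"
proof (rule Lim_null_comparison)
  have "norm ((\<Sum>j<N. w ^ j) / of_nat N) \<le> (2 / norm (w - 1)) / real N" for N
  proof -
    have "(\<Sum>j<N. w ^ j) = (w ^ N - 1) / (w - 1)" using assms(2) by (rule geometric_sum)
    moreover have "norm (w ^ N - 1) \<le> 2"
      using norm_triangle_ineq4[of "w ^ N" 1] assms by (simp add: norm_power)
    ultimately have "norm (\<Sum>j<N. w ^ j) \<le> 2 / norm (w - 1)"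
      by (simp add: norm_divide divide_right_mono)
    then show ?thesis unfolding norm_divide norm_of_nat by (rule divide_right_mono) simp
  qed
  then show "\<forall>\<^sub>F N in sequentially. norm ((\<Sum>j<N. w ^ j) / of_nat N) \<le> (2 / norm (w - 1)) / real N"
    by (rule always_eventually[OF allI])
  show "(\<lambda>N. (2 / norm (w - 1)) / real N) \<longlonglongrightarrow> 0"
    by (rule lim_const_over_n)
qed

text \<open>A nonzero frequency m excludes only the countably many steps in \<open>(1 / m)\<close>
  times the integers, so some real step avoids resonance with all frequencies of a countable set at
  once.\<close>

lemma nonresonant_step_exists:
  assumes "countable D"
  obtains \<delta> :: real where "\<And>m. m \<in> D \<Longrightarrow> m \<noteq> 0 \<Longrightarrow> cis (2 * pi * m * \<delta>) \<noteq> 1"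
proof -
  have "countable (\<Union>m\<in>D. (\<lambda>z. of_int z / m) ` (UNIV :: int set))"
    using assms by (intro countable_UN) auto
  then obtain \<delta> where \<delta>: "\<delta> \<notin> (\<Union>m\<in>D. (\<lambda>z. of_int z / m) ` (UNIV :: int set))"
    using uncountable_UNIV_real by (metis UNIV_eq_I)
  show ?thesis
  proof
    fix m assume m: "m \<in> D" "m \<noteq> 0"
    show "cis (2 * pi * m * \<delta>) \<noteq> 1"
    proof
      assume "cis (2 * pi * m * \<delta>) = 1"
      then have "cos (2 * pi * m * \<delta>) = 1" by (metis cis.sel(1) one_complex.sel(1))
      then obtain z :: int where "2 * pi * m * \<delta> = of_int z * (2 * pi)"
        by (auto simp: cos_one_2pi_int)
      then have "\<delta> = of_int z / m" using m by (simp add: field_simps)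
      then show False using \<delta> m by blast
    qed
  qed
qed

text \<open>Bohr's mean value of an almost periodic function, sampled at multiples of \<delta>. The
  averaged powers \<open>K N m\<close> are bounded by 1 and tend to 1 at m = M and to 0 at the other
  frequencies, so \<open>norm (d m)\<close> is a majorant.\<close>

lemma Fourier_coefficient_mean:
  fixes d :: "real \<Rightarrow> complex^'m::finite"
  assumes sum: "\<And>x. ((\<lambda>m. cis (2 * pi * m * x) *s d m) has_sum g x) UNIV"
    and \<delta>: "\<And>m. d m \<noteq> 0 \<Longrightarrow> m \<noteq> M \<Longrightarrow> cis (2 * pi * (m - M) * \<delta>) \<noteq> 1"
  shows "(\<lambda>N. (1 / of_nat N) *s (\<Sum>j<N. cis (- (2 * pi * M * (real j * \<delta>))) *s g (real j * \<delta>))) \<longlonglongrightarrow> d M"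
proof -
  \<comment> \<open>Nonresonance is assumed only at frequencies that occur, so the sum is restricted
    to the support.\<close>
  define A where "A = {m. d m \<noteq> 0}"
  define w where "w m = cis (2 * pi * (m - M) * \<delta>)" for m
  define K where "K N m = (\<Sum>j<N. w m ^ j) / of_nat N" for N m
  have "(\<lambda>m. norm (cis (2 * pi * m * 0) *s d m)) summable_on UNIV"
    using sum[of 0] summable_on_euclidean_iff_abs_summable_on[of "\<lambda>m. cis (2 * pi * m * 0) *s d m" UNIV]
    by (auto simp: summable_on_def)
  then have "(\<lambda>m. norm (d m)) summable_on UNIV" by (simp add: norm_vector_smult)
  then have abs_d: "(\<lambda>m. norm (d m)) summable_on A" by (rule summable_on_subset_banach) simp
  have K_le: "norm (K N m) \<le> 1" for N m
  proof -
    have "norm (\<Sum>j<N. w m ^ j) \<le> (\<Sum>j<N. 1)"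
      by (rule sum_norm_le) (simp add: w_def norm_power)
    then show ?thesis by (cases "N = 0") (simp_all add: K_def norm_divide)
  qed
  have eq: "(1 / of_nat N) *s (\<Sum>j<N. cis (- (2 * pi * M * (real j * \<delta>))) *s g (real j * \<delta>)) = (\<Sum>\<^sub>\<infinity>m\<in>A. K N m *s d m)" for N
  proof -
    have "((\<lambda>m. \<Sum>j<N. cis (- (2 * pi * M * (real j * \<delta>))) *s (cis (2 * pi * m * (real j * \<delta>)) *s d m)) has_sum
         (\<Sum>j<N. cis (- (2 * pi * M * (real j * \<delta>))) *s g (real j * \<delta>))) UNIV"
      by (intro has_sum_sum_finite has_sum_bounded_linear[OF bounded_linear_vector_smult] sum) auto
    from has_sum_bounded_linear[OF bounded_linear_vector_smult this]
    have "((\<lambda>m. (1 / of_nat N) *s (\<Sum>j<N. cis (- (2 * pi * M * (real j * \<delta>))) *s (cis (2 * pi * m * (real j * \<delta>)) *s d m))) has_sum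
         (1 / of_nat N) *s (\<Sum>j<N. cis (- (2 * pi * M * (real j * \<delta>))) *s g (real j * \<delta>))) UNIV" .
    moreover have "(1 / of_nat N) *s (\<Sum>j<N. cis (- (2 * pi * M * (real j * \<delta>))) *s (cis (2 * pi * m * (real j * \<delta>)) *s d m)) = K N m *s d m" for m
    proof -
      have "cis (- (2 * pi * M * (real j * \<delta>))) * cis (2 * pi * m * (real j * \<delta>)) = w m ^ j" for j
      proof -
        have "cis (- (2 * pi * M * (real j * \<delta>))) * cis (2 * pi * m * (real j * \<delta>)) = cis (real j * (2 * pi * (m - M) * \<delta>))"
          by (simp add: cis_mult algebra_simps)
        then show ?thesis by (simp only: w_def Complex.DeMoivre)
      qed
      then show ?thesis
        by (simp add: K_def vector_smult_assoc vec_eq_iff sum_distrib_right flip: mult.assoc)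
    qed
    ultimately have "((\<lambda>m. K N m *s d m) has_sum
         (1 / of_nat N) *s (\<Sum>j<N. cis (- (2 * pi * M * (real j * \<delta>))) *s g (real j * \<delta>))) UNIV" by simp
    then have "((\<lambda>m. K N m *s d m) has_sum
         (1 / of_nat N) *s (\<Sum>j<N. cis (- (2 * pi * M * (real j * \<delta>))) *s g (real j * \<delta>))) A"
      by (rule has_sum_cong_neutral[THEN iffD1, rotated -1]) (auto simp: A_def)
    then show ?thesis by (simp add: infsumI)
  qed
  have "(\<lambda>N. \<Sum>\<^sub>\<infinity>m\<in>A. K N m *s d m) \<longlonglongrightarrow> (\<Sum>\<^sub>\<infinity>m\<in>A. (if m = M then 1 else 0) *s d m)"
  proof (rule tendsto_infsum_dominated[OF _ _ abs_d])
    fix m assume m: "m \<in> A"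
    have "(\<lambda>N. K N m) \<longlonglongrightarrow> (if m = M then 1 else 0)"
    proof (cases "m = M")
      case True
      then have "eventually (\<lambda>N. K N m = 1) sequentially"
        using eventually_gt_at_top[of 0] by (auto elim!: eventually_mono simp: K_def w_def)
      then show ?thesis using True by (simp add: tendsto_eventually)
    next
      case False
      then show ?thesis
        using Cesaro_mean_powers[of "w m"] \<delta>[of m] m by (simp add: K_def w_def A_def)
    qed
    then show "(\<lambda>N. K N m *s d m) \<longlonglongrightarrow> (if m = M then 1 else 0) *s d m"
      by (rule bounded_linear.tendsto[OF bounded_linear_vector_smult_left])
    next
    show "\<forall>\<^sub>F N in sequentially. \<forall>m\<in>A. norm (K N m *s d m) \<le> norm (d m)"
      using K_le by (intro always_eventually allI ballI) (simp add: norm_vector_smult mult_left_le_one_le)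
  qed simp
  also have "(\<Sum>\<^sub>\<infinity>m\<in>A. (if m = M then 1 else 0) *s d m) = (\<Sum>\<^sub>\<infinity>m\<in>{M}. d m)"
    by (rule infsum_cong_neutral) (auto simp: A_def)
  finally show ?thesis unfolding eq by simp
qed

lemma countable_Fourier_support:
  fixes d :: "real \<Rightarrow> complex^'m::finite"
  assumes "\<And>x. ((\<lambda>m. cis (2 * pi * m * x) *s d m) has_sum g x) UNIV"
  shows "countable {m. d m \<noteq> 0}"
proof -
  have "(\<lambda>m. norm (cis (2 * pi * m * 0) *s d m)) summable_on UNIV"
    using assms[of 0] summable_on_euclidean_iff_abs_summable_on[of "\<lambda>m. cis (2 * pi * m * 0) *s d m" UNIV]
    by (auto simp: summable_on_def)
  then have "(\<lambda>m. norm (d m)) summable_on UNIV" by (simp add: norm_vector_smult)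
  from summable_countable_real[OF this] show ?thesis by simp
qed

text \<open>The coefficient is a limit of averages of g with unimodular weights. With C = 0 this is
  uniqueness of coefficients; with a growth bound it gives vanishing in negative weight.\<close>

lemma Fourier_coefficient_norm_le:
  fixes d :: "real \<Rightarrow> complex^'m::finite"
  assumes sum: "\<And>x. ((\<lambda>m. cis (2 * pi * m * x) *s d m) has_sum g x) UNIV"
    and g: "\<And>x. norm (g x) \<le> C"
  shows "norm (d M) \<le> C"
proof -
  have C: "0 \<le> C" using g[of 0] norm_ge_zero order_trans by blast
  have "countable ((\<lambda>m. m - M) ` {m. d m \<noteq> 0})" by (intro countable_image countable_Fourier_support[OF sum])
  then obtain \<delta> where \<delta>: "\<And>m. m \<in> (\<lambda>m. m - M) ` {m. d m \<noteq> 0} \<Longrightarrow> m \<noteq> 0 \<Longrightarrow> cis (2 * pi * m * \<delta>) \<noteq> 1"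
    using nonresonant_step_exists by blast
  have "(\<lambda>N. (1 / of_nat N) *s (\<Sum>j<N. cis (- (2 * pi * M * (real j * \<delta>))) *s g (real j * \<delta>))) \<longlonglongrightarrow> d M"
    by (rule Fourier_coefficient_mean[OF sum]) (use \<delta> in auto)
  then show ?thesis
  proof (rule tendsto_upperbound[OF tendsto_norm])
    have "norm ((1 / of_nat N) *s (\<Sum>j<N. cis (- (2 * pi * M * (real j * \<delta>))) *s g (real j * \<delta>))) \<le> C" for N
    proof -
      have "norm (\<Sum>j<N. cis (- (2 * pi * M * (real j * \<delta>))) *s g (real j * \<delta>)) \<le> (\<Sum>j<N. C)"
        by (rule sum_norm_le) (simp add: norm_vector_smult g)
      then show ?thesis using C by (cases "N = 0") (simp_all add: norm_vector_smult norm_divide field_simps)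
    qed
    then show "\<forall>\<^sub>F N in sequentially. norm ((1 / of_nat N) *s (\<Sum>j<N. cis (- (2 * pi * M * (real j * \<delta>))) *s g (real j * \<delta>))) \<le> C"
      by (rule always_eventually[OF allI])
  qed simp
qed

text \<open>The bound comes from averaging against the nonnegative kernels
  \<open>1 \<plusminus> cos (2 * pi * M * x)\<close>, which have mean 1.\<close>

lemma Fourier_two_coefficients_norm_le:
  fixes d :: "real \<Rightarrow> complex^'m::finite"
  assumes sum: "\<And>x. ((\<lambda>m. cis (2 * pi * m * x) *s d m) has_sum g x) UNIV"
    and g: "\<And>x. norm (g x) \<le> C" and M: "M \<noteq> 0" and d: "d (- M) = 0"
  shows "(norm (d 0))\<^sup>2 + (norm (d M) / 2)\<^sup>2 \<le> C\<^sup>2"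
proof -
  have C: "0 \<le> C" using g[of 0] norm_ge_zero order_trans by blast
  define A where "A = {m. d m \<noteq> 0}"
  \<comment> \<open>The differences serve the three means at 0, M and -M; M itself is inserted for
    the mean of the cosine kernel.\<close>
  define D where "D = insert M ((\<lambda>m. m - 0) ` A \<union> (\<lambda>m. m - M) ` A \<union> (\<lambda>m. m - (- M)) ` A)"
  have "countable D"
    unfolding D_def A_def by (intro countable_insert countable_Un countable_image countable_Fourier_support[OF sum])
  then obtain \<delta> where \<delta>: "\<And>m. m \<in> D \<Longrightarrow> m \<noteq> 0 \<Longrightarrow> cis (2 * pi * m * \<delta>) \<noteq> 1"
    using nonresonant_step_exists by blast
  define x where "x j = real j * \<delta>" for j
  define mean where "mean P N = (1 / of_nat N) *s (\<Sum>j<N. cis (- (2 * pi * P * x j)) *s g (x j))" for P N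
  have mean: "mean P \<longlonglongrightarrow> d P" if "P \<in> {0, M, - M}" for P
    unfolding mean_def x_def
  proof (rule Fourier_coefficient_mean[OF sum])
    fix m assume "d m \<noteq> 0" "m \<noteq> P"
    then show "cis (2 * pi * (m - P) * \<delta>) \<noteq> 1"
      using that by (intro \<delta>) (auto simp: D_def A_def)
  qed
  \<comment> \<open>Averaging against the kernel \<open>1 + \<zeta> * cos (2 * pi * M * x)\<close>
    yields \<open>d 0\<close> plus \<open>\<zeta> / 2\<close> times \<open>d M + d (- M)\<close>,
    whose second summand is 0.\<close>
  have bound: "norm (d 0 + (\<zeta> / 2) *\<^sub>R d M) \<le> C" if \<zeta>: "\<zeta> \<in> {1, -1}" for \<zeta> :: real
  proof -
    define \<kappa> where "\<kappa> N = (\<Sum>j<N. 1 + \<zeta> * cos (2 * pi * M * x j)) / real N" for N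
    have "(\<lambda>N. mean 0 N + (\<zeta> / 2) *\<^sub>R (mean M N + mean (- M) N)) \<longlonglongrightarrow> d 0 + (\<zeta> / 2) *\<^sub>R (d M + d (- M))"
      by (intro tendsto_intros mean) auto
    then have lim: "(\<lambda>N. mean 0 N + (\<zeta> / 2) *\<^sub>R (mean M N + mean (- M) N)) \<longlonglongrightarrow> d 0 + (\<zeta> / 2) *\<^sub>R d M"
      using d by simp
    have le: "norm (mean 0 N + (\<zeta> / 2) *\<^sub>R (mean M N + mean (- M) N)) \<le> C * \<kappa> N" for N
    proof -
      have "mean 0 N + (\<zeta> / 2) *\<^sub>R (mean M N + mean (- M) N) =
          (1 / of_nat N) *s (\<Sum>j<N. (1 + \<zeta> * cos (2 * pi * M * x j)) *\<^sub>R g (x j))"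
      proof -
        have "cis (- (2 * pi * 0 * t)) *s v + (\<zeta> / 2) *\<^sub>R (cis (- (2 * pi * M * t)) *s v + cis (- (2 * pi * (- M) * t)) *s v)
           = (1 + \<zeta> * cos (2 * pi * M * t)) *\<^sub>R v" for t and v :: "complex^'m"
          by (simp add: vec_eq_iff complex_eq_iff algebra_simps)
        then have "(\<Sum>j<N. (1 + \<zeta> * cos (2 * pi * M * x j)) *\<^sub>R g (x j)) =
          (\<Sum>j<N. cis (- (2 * pi * 0 * x j)) *s g (x j)) + (\<zeta> / 2) *\<^sub>R ((\<Sum>j<N. cis (- (2 * pi * M * x j)) *s g (x j)) +
             (\<Sum>j<N. cis (- (2 * pi * (- M) * x j)) *s g (x j)))"
          by (simp only: scaleR_sum_right flip: sum.distrib)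
        then show ?thesis
          by (simp add: mean_def vec_eq_iff algebra_simps)
      qed
      also have "norm \<dots> \<le> norm (1 / complex_of_nat N) * (\<Sum>j<N. (1 + \<zeta> * cos (2 * pi * M * x j)) * C)"
        unfolding norm_vector_smult
      proof (intro mult_left_mono sum_norm_le)
        fix j
        have "0 \<le> 1 + \<zeta> * cos (2 * pi * M * x j)"
          using \<zeta> cos_ge_minus_one[of "2 * pi * M * x j"] cos_le_one[of "2 * pi * M * x j"]
          by (elim insertE emptyE; hypsubst; linarith)
        then show "norm ((1 + \<zeta> * cos (2 * pi * M * x j)) *\<^sub>R g (x j)) \<le> (1 + \<zeta> * cos (2 * pi * M * x j)) * C"
          using g[of "x j"] by (simp add: mult_left_mono)
      qed simp
      also have "\<dots> = C * \<kappa> N"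
        by (simp add: \<kappa>_def norm_divide sum_distrib_right[symmetric])
      finally show ?thesis .
    qed
    have "\<kappa> \<longlonglongrightarrow> 1"
    proof -
      define w where "w = cis (2 * pi * M * \<delta>)"
      have "w \<noteq> 1" unfolding w_def by (rule \<delta>) (auto simp: D_def M)
      then have "(\<lambda>N. Re ((\<Sum>j<N. w ^ j) / of_nat N)) \<longlonglongrightarrow> Re 0"
        by (intro tendsto_Re Cesaro_mean_powers) (auto simp: w_def)
      then have "(\<lambda>N. 1 + \<zeta> * Re ((\<Sum>j<N. w ^ j) / of_nat N)) \<longlonglongrightarrow> 1 + \<zeta> * Re 0"
        by (rule tendsto_add[OF tendsto_const tendsto_mult_left])
      moreover have "\<forall>\<^sub>F N in sequentially. 1 + \<zeta> * Re ((\<Sum>j<N. w ^ j) / of_nat N) = \<kappa> N"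
      proof (rule eventually_mono[OF eventually_gt_at_top[of 0]])
        fix N :: nat assume N: "0 < N"
        have "Re (w ^ j) = cos (2 * pi * M * x j)" for j
          by (simp add: w_def x_def Complex.DeMoivre mult_ac)
        then have "Re ((\<Sum>j<N. w ^ j) / of_nat N) = (\<Sum>j<N. cos (2 * pi * M * x j)) / real N"
          by (simp add: Re_divide_of_nat)
        moreover have "(\<Sum>j<N. 1 + \<zeta> * cos (2 * pi * M * x j)) = real N + \<zeta> * (\<Sum>j<N. cos (2 * pi * M * x j))"
          by (simp add: sum.distrib sum_distrib_left)
        ultimately show "1 + \<zeta> * Re ((\<Sum>j<N. w ^ j) / of_nat N) = \<kappa> N"
          using N by (simp add: \<kappa>_def field_simps)
      qed
      ultimately show ?thesis using Lim_transform_eventually by fastforce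
    qed
    then have "(\<lambda>N. C * \<kappa> N) \<longlonglongrightarrow> C * 1" by (intro tendsto_mult_left)
    from tendsto_le[OF _ this tendsto_norm[OF lim]] le show ?thesis by simp
  qed
  \<comment> \<open>The parallelogram law turns the bounds for both signs into one for the sum of
    squares.\<close>
  define u v where "u = d 0" and "v = (1 / 2) *\<^sub>R d M"
  have "norm (u + v) \<le> C" "norm (u - v) \<le> C" using bound[of 1] bound[of "-1"] by (auto simp: u_def v_def)
  then have "(norm (u + v))\<^sup>2 \<le> C\<^sup>2" "(norm (u - v))\<^sup>2 \<le> C\<^sup>2" by (auto intro: power_mono)
  moreover have "(norm (u + v))\<^sup>2 + (norm (u - v))\<^sup>2 = 2 * (norm u)\<^sup>2 + 2 * (norm v)\<^sup>2"
    by (simp add: power2_norm_eq_inner algebra_simps inner_commute)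
  ultimately have "(norm u)\<^sup>2 + (norm v)\<^sup>2 \<le> C\<^sup>2" by simp
  then show ?thesis by (simp add: u_def v_def)
qed

lemma q_pow_eq: "q_pow m \<tau> = of_real (exp (- 2 * pi * m * Im \<tau>)) * cis (2 * pi * m * Re \<tau>)"
  by (simp add: q_pow_def cis_conv_exp exp_of_real[symmetric] flip: exp_add)
     (simp add: complex_eq_iff exp_eq_polar)

lemma norm_q_pow: "norm (q_pow m \<tau>) = exp (- 2 * pi * m * Im \<tau>)"
  by (simp add: q_pow_eq norm_mult)

text \<open>At a fixed height the difference of two expansions, with the exponential factor absorbed
  into \<open>d\<close>, represents the zero function, so its coefficients vanish and the
  description operator has a unique value.\<close>

lemma fourier_coeff_eqI:
  fixes H :: "complex \<Rightarrow> complex^'m::finite"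
  assumes c: "has_fourier_expansion H c" and y: "0 < y"
  shows "fourier_coeff H m y = c m y"
  unfolding fourier_coeff_def
proof (rule the_equality)
  fix v assume "\<exists>c. has_fourier_expansion H c \<and> c m y = v"
  then obtain c' where c': "has_fourier_expansion H c'" "c' m y = v" by blast
  define d where "d m = exp (- 2 * pi * m * y) *\<^sub>R (c' m y - c m y)" for m
  have "((\<lambda>m. cis (2 * pi * m * x) *s d m) has_sum 0) UNIV" for x
  proof -
    have "Complex x y \<in> uhp" using y by (simp add: uhp_def)
    then have "((\<lambda>m. q_pow m (Complex x y) *s c m y) has_sum H (Complex x y)) UNIV"
      "((\<lambda>m. q_pow m (Complex x y) *s c' m y) has_sum H (Complex x y)) UNIV"
      using c c'(1) by (fastforce simp: has_fourier_expansion_def)+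
      note has_sum_add[OF this(2) has_sum_bounded_linear[OF bounded_linear_minus[OF bounded_linear_ident] this(1)]]
    moreover have "q_pow m (Complex x y) *s c' m y + - (q_pow m (Complex x y) *s c m y) = cis (2 * pi * m * x) *s d m" for m
      by (simp add: q_pow_eq d_def vec_eq_iff algebra_simps flip: of_real_vector_smult)
    ultimately show ?thesis by simp
  qed
  from Fourier_coefficient_norm_le[OF this, of 0 m] show "v = c m y"
    using c'(2) by (simp add: d_def mult_le_0_iff)
qed (use c in blast)

subsection \<open>Modular forms of non-positive weight\<close>

lemma norm_conj_transpose_mult:
  fixes A :: "complex^'m::finite^'m"
  assumes "A ** conj_transpose A = mat 1"
  shows "norm (conj_transpose A *v x) = norm x"
proof -
  have AA: "(\<Sum>i\<in>UNIV. A $ j $ i * cnj (A $ k $ i)) = (if j = k then 1 else 0)" for j k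
    using arg_cong[OF assms, of "\<lambda>M. M $ j $ k"]
    by (simp add: matrix_matrix_mult_def conj_transpose_def mat_def)
  have sq: "complex_of_real ((norm v)\<^sup>2) = (\<Sum>i\<in>UNIV. v $ i * cnj (v $ i))" for v :: "complex^'m"
    by (simp add: norm_vec_def L2_set_def sum_nonneg complex_norm_square[symmetric])
  have "complex_of_real ((norm (conj_transpose A *v x))\<^sup>2) =
      (\<Sum>i\<in>UNIV. (\<Sum>j\<in>UNIV. cnj (A $ j $ i) * x $ j) * (\<Sum>k\<in>UNIV. A $ k $ i * cnj (x $ k)))"
    unfolding sq by (simp add: matrix_vector_mult_def conj_transpose_def)
  also have "\<dots> = (\<Sum>i\<in>UNIV. \<Sum>j\<in>UNIV. \<Sum>k\<in>UNIV. (x $ j * cnj (x $ k)) * (A $ k $ i * cnj (A $ j $ i)))"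
    by (simp add: sum_product mult_ac)
  also have "\<dots> = (\<Sum>j\<in>UNIV. \<Sum>i\<in>UNIV. \<Sum>k\<in>UNIV. (x $ j * cnj (x $ k)) * (A $ k $ i * cnj (A $ j $ i)))"
    by (rule sum.swap)
  also have "\<dots> = (\<Sum>j\<in>UNIV. \<Sum>k\<in>UNIV. \<Sum>i\<in>UNIV. (x $ j * cnj (x $ k)) * (A $ k $ i * cnj (A $ j $ i)))"
    by (intro sum.cong refl sum.swap)
  also have "\<dots> = (\<Sum>j\<in>UNIV. \<Sum>k\<in>UNIV. (x $ j * cnj (x $ k)) * (if k = j then 1 else 0))"
    by (simp only: sum_distrib_left[symmetric] AA)
  also have "\<dots> = complex_of_real ((norm x)\<^sup>2)"
    unfolding sq by (simp add: if_distrib[where f = "\<lambda>z. _ * z"] cong: if_cong)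
  finally have "(norm (conj_transpose A *v x))\<^sup>2 = (norm x)\<^sup>2" using of_real_eq_iff by blast
  then show ?thesis by (simp add: power2_eq_iff_nonneg)
qed

lemma norm_unitary_inv_mult:
  assumes \<rho>: "unitary_rep \<rho>" and \<gamma>: "\<gamma> \<in> carrier Mp2"
  shows "norm (matrix_inv (\<rho> \<gamma>) *v x) = norm x"
proof -
  have "\<rho> \<gamma> \<in> carrier unitary_group"
    using \<rho> \<gamma> by (auto simp: unitary_rep_def hom_def)
  then have A: "\<rho> \<gamma> ** conj_transpose (\<rho> \<gamma>) = mat 1" "conj_transpose (\<rho> \<gamma>) ** \<rho> \<gamma> = mat 1"
    by (auto simp: unitary_group_def)
  \<comment> \<open>\<open>matrix_inv\<close> is a choice among inverses; the conjugate transpose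
    shows that one exists, and cancellation identifies the two.\<close>
  have inv: "\<rho> \<gamma> ** matrix_inv (\<rho> \<gamma>) = mat 1"
    unfolding matrix_inv_def by (rule someI2[of _ "conj_transpose (\<rho> \<gamma>)"]) (use A in auto)
  have "matrix_inv (\<rho> \<gamma>) = (conj_transpose (\<rho> \<gamma>) ** \<rho> \<gamma>) ** matrix_inv (\<rho> \<gamma>)"
    unfolding A(2) by simp
  then have "matrix_inv (\<rho> \<gamma>) = conj_transpose (\<rho> \<gamma>)"
    unfolding matrix_mul_assoc[symmetric] inv by simp
  then show ?thesis using norm_conj_transpose_mult[OF A(1)] by simp
qed

lemma Im_moebius_act:
  assumes det: "det g = 1" and \<tau>: "\<tau> \<in> uhp"
  shows "aut_factor g \<tau> \<noteq> 0" and "Im (moebius_act g \<tau>) = Im \<tau> / (norm (aut_factor g \<tau>))\<^sup>2"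
proof -
  have y: "Im \<tau> > 0" using \<tau> by (simp add: uhp_def)
  have det': "real_of_int (g$1$1) * real_of_int (g$2$2) - real_of_int (g$1$2) * real_of_int (g$2$1) = 1"
    using det unfolding det_2 by (metis of_int_1 of_int_diff of_int_mult)
  show nz: "aut_factor g \<tau> \<noteq> 0"
  proof
    assume "aut_factor g \<tau> = 0"
    then have "Im (aut_factor g \<tau>) = 0" "Re (aut_factor g \<tau>) = 0" by simp_all
    then have "g$2$1 = 0" "g$2$2 = 0" using y by (auto simp: aut_factor_def)
    then show False using det' by simp
  qed
  have "Im (moebius_act g \<tau>) = (Im \<tau> * (real_of_int (g$1$1) * real_of_int (g$2$2) - real_of_int (g$1$2) * real_of_int (g$2$1))) / (norm (aut_factor g \<tau>))\<^sup>2"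
    unfolding moebius_act_def Im_divide cmod_power2
    by (simp add: aut_factor_def algebra_simps)
  then show "Im (moebius_act g \<tau>) = Im \<tau> / (norm (aut_factor g \<tau>))\<^sup>2" using det' by simp
qed

text \<open>The unitary factor preserves norms, and the modulus of the automorphy factor cancels
  against the change of \<open>Im \<tau> powr (l / 2)\<close>. This invariant carries estimates
  along orbits.\<close>

lemma slash_invariant_norm:
  assumes \<rho>: "unitary_rep \<rho>" and l: "2 * l \<in> \<int>" and inv: "slash_invariant l \<rho> G"
    and \<gamma>: "(g, \<omega>) \<in> carrier Mp2" and \<tau>: "\<tau> \<in> uhp"
  shows "moebius_act g \<tau> \<in> uhp"
    and "Im (moebius_act g \<tau>) powr (l / 2) * norm (G (moebius_act g \<tau>)) = Im \<tau> powr (l / 2) * norm (G \<tau>)"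
proof -
  have det: "det g = 1" and \<omega>: "(\<omega> \<tau>)\<^sup>2 = aut_factor g \<tau>"
    using \<gamma> \<tau> by (auto simp: Mp2_def)
  note nz = Im_moebius_act(1)[OF det \<tau>] and Im = Im_moebius_act(2)[OF det \<tau>]
  have y: "Im \<tau> > 0" using \<tau> by (simp add: uhp_def)
  show "moebius_act g \<tau> \<in> uhp" using nz y by (simp add: uhp_def Im)
  define w where "w = norm (\<omega> \<tau>)"
  have w2: "norm (aut_factor g \<tau>) = w\<^sup>2" unfolding w_def using \<omega> by (simp flip: norm_power)
  then have w: "w > 0" using nz by (auto simp: w_def)
  have floor: "real_of_int \<lfloor>2 * l\<rfloor> = 2 * l" using l by (metis Ints_cases floor_of_int)
  have powi: "w powi (- \<lfloor>2 * l\<rfloor>) = w powr (- 2 * l)"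
    using powr_real_of_int'[of w "- \<lfloor>2 * l\<rfloor>"] w by (simp add: floor)
  have "slash l \<rho> G (g, \<omega>) \<tau> = G \<tau>" using inv \<gamma> \<tau> by (simp add: slash_invariant_def)
  then have "norm (G \<tau>) = norm (\<omega> \<tau> powi (- \<lfloor>2 * l\<rfloor>)) * norm (G (moebius_act g \<tau>))"
    unfolding slash_def by (metis norm_unitary_inv_mult[OF \<rho> \<gamma>] norm_vector_smult fst_conv snd_conv)
  then have eq: "norm (G \<tau>) = w powr (- 2 * l) * norm (G (moebius_act g \<tau>))"
    by (simp only: norm_power_int w_def[symmetric] powi)
  have "Im (moebius_act g \<tau>) powr (l / 2) = Im \<tau> powr (l / 2) * w powr (- 2 * l)"
  proof -
    have "Im (moebius_act g \<tau>) = Im \<tau> * w powr (- 4)"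
      unfolding Im w2 using w by (simp add: powr_minus powr_numeral divide_simps)
    then have "Im (moebius_act g \<tau>) powr (l / 2) = Im \<tau> powr (l / 2) * (w powr (- 4)) powr (l / 2)"
      by (simp only: powr_mult)
    then show ?thesis by (simp add: powr_powr)
  qed
  then show "Im (moebius_act g \<tau>) powr (l / 2) * norm (G (moebius_act g \<tau>)) = Im \<tau> powr (l / 2) * norm (G \<tau>)"
    by (simp add: eq)
qed

text \<open>The principal square root is holomorphic where its argument avoids the nonpositive
  reals. Here the argument is nonreal for c \<noteq> 0 and equal to 1 for c = 0, d = 1.\<close>

lemma Mp2_lift_exists:
  fixes a b c d :: int
  assumes det: "a * d - b * c = 1" and c: "c \<noteq> 0 \<or> d = 1"
  obtains g :: "int^2^2" and \<omega> where "(g, \<omega>) \<in> carrier Mp2" "g$1$1 = a" "g$1$2 = b" "g$2$1 = c" "g$2$2 = d"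
proof -
  define g :: "int^2^2" where "g = vector [vector [a, b], vector [c, d]]"
  have g: "g$1$1 = a" "g$1$2 = b" "g$2$1 = c" "g$2$2 = d" by (simp_all add: g_def)
  define \<omega> where "\<omega> = restrict (\<lambda>\<tau>. csqrt (aut_factor g \<tau>)) uhp"
  have "(\<lambda>\<tau>. csqrt (aut_factor g \<tau>)) holomorphic_on uhp"
  proof (rule holomorphic_on_csqrt')
    show "aut_factor g holomorphic_on uhp"
      unfolding aut_factor_def by (intro holomorphic_intros)
    fix \<tau> assume "\<tau> \<in> uhp"
    then have "Im \<tau> > 0" by (simp add: uhp_def)
    then show "aut_factor g \<tau> \<notin> \<real>\<^sub>\<le>\<^sub>0"
      using c by (cases "c = 0") (auto simp: aut_factor_def g complex_nonpos_Reals_iff)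
  qed
  then have "\<omega> holomorphic_on uhp"
    by (rule holomorphic_transform) (simp add: \<omega>_def)
  then have "(g, \<omega>) \<in> carrier Mp2"
    using det by (auto simp: Mp2_def \<omega>_def det_2 g)
  then show ?thesis using that g by blast
qed

text \<open>Dirichlet approximation of \<open>Re \<tau>\<close> with denominators up to \<open>Im \<tau> powr (- 1 / 2)\<close> moves
  \<open>\<tau>\<close> up to a fixed height in one step.\<close>

lemma reduction_step:
  assumes \<tau>: "\<tau> \<in> uhp" "Im \<tau> \<le> 1"
  obtains g :: "int^2^2" and \<omega> where "(g, \<omega>) \<in> carrier Mp2" "1 / 5 \<le> Im (moebius_act g \<tau>)"
proof -
  define y where "y = Im \<tau>"
  have y: "0 < y" "y \<le> 1" using \<tau> by (auto simp: y_def uhp_def)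
  \<comment> \<open>Rounding up a number that is at least 1 at most doubles it. The lower bound on N
    makes the approximation error at most \<open>sqrt y\<close>, the upper one makes
    \<open>c * y\<close> at most \<open>2 * sqrt y\<close>.\<close>
  define N where "N = nat \<lceil>1 / sqrt y\<rceil>"
  have "1 / sqrt y \<ge> 1" using y by simp
  then have N: "1 / sqrt y \<le> real N" "real N \<le> 2 / sqrt y" "N > 0"
    unfolding N_def by linarith+
  obtain h c where hc: "coprime h c" "0 < c" "c \<le> int N" "\<bar>of_int c * Re \<tau> - of_int h\<bar> < 1 / real N"
    using Dirichlet_approx_coprime[OF N(3), of "Re \<tau>"] by metis
  \<comment> \<open>Bezout completes the lower row \<open>(c, - h)\<close> given by the
    approximation to a matrix of determinant 1.\<close>
  obtain u v where "u * h + v * c = 1" using bezout_int[of h c] hc(1) by auto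
  then have det: "(- u) * (- h) - (- v) * c = 1" by simp
  obtain g \<omega> where g: "(g, \<omega>) \<in> carrier Mp2" "g$1$1 = - u" "g$1$2 = - v" "g$2$1 = c" "g$2$2 = - h"
    using Mp2_lift_exists[OF det] hc(2) by (metis less_irrefl)
  \<comment> \<open>Real and imaginary parts contribute \<open>y\<close> and \<open>4 * y\<close>;
    this is the origin of the height \<open>1 / 5\<close>.\<close>
  have "(norm (aut_factor g \<tau>))\<^sup>2 \<le> 5 * y"
  proof -
    have "\<bar>of_int c * Re \<tau> - of_int h\<bar> \<le> sqrt y"
    proof -
      have "1 / real N \<le> sqrt y" using N y by (simp add: field_simps)
      then show ?thesis using hc(4) by simp
    qed
    then have "(of_int c * Re \<tau> - of_int h)\<^sup>2 \<le> y"
      using y by (metis abs_le_square_iff abs_of_pos real_sqrt_gt_0_iff real_sqrt_pow2 less_imp_le)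
    moreover have "of_int c * y \<le> 2 * sqrt y"
    proof -
      have "of_int c \<le> 2 / sqrt y" using hc(3) N(2) by linarith
      then have "of_int c * y \<le> 2 / sqrt y * y" using y by (intro mult_right_mono) auto
      also have "\<dots> = 2 * sqrt y" using y by (simp add: field_simps)
      finally show ?thesis .
    qed
    then have "(of_int c * y)\<^sup>2 \<le> (2 * sqrt y)\<^sup>2" using hc(2) y by (intro power_mono) auto
    then have "(of_int c * y)\<^sup>2 \<le> 4 * y" using y by (simp add: power_mult_distrib)
    moreover have "(norm (aut_factor g \<tau>))\<^sup>2 = (of_int c * Re \<tau> - of_int h)\<^sup>2 + (of_int c * y)\<^sup>2"
      by (simp add: cmod_power2 aut_factor_def g y_def)
    ultimately show ?thesis by simp
  qed
  moreover have det_g: "det g = 1" using g(1) by (auto simp: Mp2_def)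
  moreover have "(norm (aut_factor g \<tau>))\<^sup>2 > 0" using Im_moebius_act(1)[OF det_g \<tau>(1)] by simp
  ultimately have "1 / 5 \<le> Im (moebius_act g \<tau>)"
    unfolding Im_moebius_act(2)[OF det_g \<tau>(1)] y_def[symmetric] by (simp only: pos_le_divide_eq)
  then show ?thesis using that g(1) by blast
qed

lemma translation_step:
  assumes "\<tau> \<in> uhp"
  obtains g :: "int^2^2" and \<omega> where "(g, \<omega>) \<in> carrier Mp2" "Im (moebius_act g \<tau>) = Im \<tau>"
    "0 \<le> Re (moebius_act g \<tau>)" "Re (moebius_act g \<tau>) \<le> 1"
proof -
  obtain g \<omega> where g: "(g, \<omega>) \<in> carrier Mp2" "g$1$1 = 1" "g$1$2 = - \<lfloor>Re \<tau>\<rfloor>" "g$2$1 = 0" "g$2$2 = 1"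
    using Mp2_lift_exists[of 1 1 "- \<lfloor>Re \<tau>\<rfloor>" 0] by auto
  have "moebius_act g \<tau> = \<tau> - of_int \<lfloor>Re \<tau>\<rfloor>"
    by (simp add: moebius_act_def aut_factor_def g)
  then show ?thesis using that[OF g(1)] by (simp; linarith)
qed

text \<open>The half-strip stands in for a fundamental domain: it meets every orbit, possibly
  several times, which is enough for estimates of suprema.\<close>

lemma slash_invariant_reduction:
  assumes \<rho>: "unitary_rep \<rho>" and l: "2 * l \<in> \<int>" and inv: "slash_invariant l \<rho> G" and \<tau>: "\<tau> \<in> uhp"
  obtains \<tau>' where "1 / 5 \<le> Im \<tau>'" "0 \<le> Re \<tau>'" "Re \<tau>' \<le> 1"
    "Im \<tau>' powr (l / 2) * norm (G \<tau>') = Im \<tau> powr (l / 2) * norm (G \<tau>)"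
proof -
  obtain \<tau>1 where \<tau>1: "\<tau>1 \<in> uhp" "1 / 5 \<le> Im \<tau>1"
     "Im \<tau>1 powr (l / 2) * norm (G \<tau>1) = Im \<tau> powr (l / 2) * norm (G \<tau>)"
  proof (cases "Im \<tau> \<le> 1")
    case True
    obtain g \<omega> where "(g, \<omega>) \<in> carrier Mp2" "1 / 5 \<le> Im (moebius_act g \<tau>)"
      using reduction_step[OF \<tau> True] .
    then show ?thesis using that slash_invariant_norm[OF \<rho> l inv _ \<tau>] by blast
  qed (use that \<tau> in auto)
  obtain g \<omega> where "(g, \<omega>) \<in> carrier Mp2" "Im (moebius_act g \<tau>1) = Im \<tau>1"
    "0 \<le> Re (moebius_act g \<tau>1)" "Re (moebius_act g \<tau>1) \<le> 1"
    using translation_step[OF \<tau>1(1)] .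
  then show ?thesis
    using that[of "moebius_act g \<tau>1"] slash_invariant_norm[OF \<rho> l inv _ \<tau>1(1)] \<tau>1 by metis
qed

lemma compact_strip: "compact {\<tau>. 0 \<le> Re \<tau> \<and> Re \<tau> \<le> 1 \<and> a \<le> Im \<tau> \<and> Im \<tau> \<le> b}"
proof -
  have "{\<tau>. 0 \<le> Re \<tau> \<and> Re \<tau> \<le> 1 \<and> a \<le> Im \<tau> \<and> Im \<tau> \<le> b} = cbox (Complex 0 a) (Complex 1 b)"
    by (auto simp: cbox_complex_eq)
  then show ?thesis by (simp only: compact_cbox)
qed

lemma modular_form_continuous:
  assumes "G \<in> modular_forms l \<sigma>" shows "continuous_on uhp G"
proof -
  have "continuous_on uhp (\<lambda>\<tau>. \<chi> i. G \<tau> $ i)"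
    using assms by (intro continuous_on_vec_lambda holomorphic_on_imp_continuous_on) (auto simp: modular_forms_def)
  then show ?thesis by simp
qed

lemma holomorphic_expansion_line:
  assumes "holomorphic_expansion G c" "0 < y"
  shows "((\<lambda>m. cis (2 * pi * m * x) *s (exp (- 2 * pi * m * y) *\<^sub>R (if m < 0 then 0 else c m))) has_sum G (Complex x y)) UNIV"
proof -
  have "Complex x y \<in> uhp" using assms by (simp add: uhp_def)
  then have "((\<lambda>m. q_pow m (Complex x y) *s c m) has_sum G (Complex x y)) {0..}"
    using assms by (simp add: holomorphic_expansion_def)
  then show ?thesis
    by (rule has_sum_cong_neutral[THEN iffD1, rotated -1])
       (auto simp: q_pow_eq vec_eq_iff mult_ac simp flip: of_real_vector_smult)
qed

section \<open>Vanishing of coefficients in weight at most 0\<close>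

text \<open>For l \<le> 0 the factor \<open>Im \<tau> powr (l / 2)\<close> is bounded on the
  half-strip. G is bounded there too, near the cusp by definition and on the rest by compactness, so
  the invariant is bounded everywhere.\<close>

lemma modular_form_bound_nonpos_weight:
  assumes \<sigma>: "unitary_rep \<sigma>" and l: "2 * l \<in> \<int>" "l \<le> 0" and G: "G \<in> modular_forms l \<sigma>"
  obtains C where "\<And>\<tau>. \<tau> \<in> uhp \<Longrightarrow> norm (G \<tau>) \<le> C * Im \<tau> powr (- l / 2)"
proof -
  have inv: "slash_invariant l \<sigma> G" using G by (simp add: modular_forms_def)
  have "\<exists>B. \<forall>\<^sub>F \<tau> in at_i_infty. norm (G \<tau>) \<le> B" using G by (simp add: modular_forms_def)
  then obtain B Y where B: "\<And>\<tau>. Y \<le> Im \<tau> \<Longrightarrow> norm (G \<tau>) \<le> B"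
    unfolding eventually_filtercomap eventually_at_top_linorder by blast
  define K where "K = {\<tau>. 0 \<le> Re \<tau> \<and> Re \<tau> \<le> 1 \<and> 1 / 5 \<le> Im \<tau> \<and> Im \<tau> \<le> Y}"
  have "compact (G ` K)"
    unfolding K_def
    by (rule compact_continuous_image[OF continuous_on_subset[OF modular_form_continuous[OF G]] compact_strip])
       (auto simp: uhp_def)
  then obtain B' where B': "\<And>\<tau>. \<tau> \<in> K \<Longrightarrow> norm (G \<tau>) \<le> B'"
    using compact_imp_bounded bounded_iff by (metis imageI)
  show ?thesis
  proof
    fix \<tau> assume \<tau>: "\<tau> \<in> uhp"
    then have y: "Im \<tau> > 0" by (simp add: uhp_def)
    obtain \<tau>' where \<tau>': "1 / 5 \<le> Im \<tau>'" "0 \<le> Re \<tau>'" "Re \<tau>' \<le> 1"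
      "Im \<tau>' powr (l / 2) * norm (G \<tau>') = Im \<tau> powr (l / 2) * norm (G \<tau>)"
      using slash_invariant_reduction[OF \<sigma> l(1) inv \<tau>] .
    have "norm (G \<tau>') \<le> \<bar>B\<bar> + \<bar>B'\<bar>"
      using B[of \<tau>'] B'[of \<tau>'] \<tau>' by (cases "Y \<le> Im \<tau>'") (auto simp: K_def)
    moreover have "Im \<tau>' powr (l / 2) \<le> (1 / 5) powr (l / 2)"
      using \<tau>'(1) l by (intro powr_mono2') auto
    ultimately have "Im \<tau>' powr (l / 2) * norm (G \<tau>') \<le> (1 / 5) powr (l / 2) * (\<bar>B\<bar> + \<bar>B'\<bar>)"
      by (intro mult_mono) auto
    then have "Im \<tau> powr (l / 2) * norm (G \<tau>) \<le> (1 / 5) powr (l / 2) * (\<bar>B\<bar> + \<bar>B'\<bar>)"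
      using \<tau>'(4) by simp
    then show "norm (G \<tau>) \<le> ((1 / 5) powr (l / 2) * (\<bar>B\<bar> + \<bar>B'\<bar>)) * Im \<tau> powr (- l / 2)"
      using y by (simp add: powr_minus field_simps)
  qed
qed

text \<open>Hecke's estimate: the coefficient at height y is at most
  \<open>C * y powr (- l / 2)\<close>, which tends to 0 with y since \<open>- l / 2 > 0\<close>,
  while the exponential factor tends to 1.\<close>

lemma negative_weight_coeff_eq_0:
  assumes \<sigma>: "unitary_rep \<sigma>" and l: "2 * l \<in> \<int>" "l < 0" and G: "G \<in> modular_forms l \<sigma>"
    and c: "holomorphic_expansion G c" and m: "0 \<le> m"
  shows "c m = 0"
proof -
  obtain C where C: "\<And>\<tau>. \<tau> \<in> uhp \<Longrightarrow> norm (G \<tau>) \<le> C * Im \<tau> powr (- l / 2)"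
    using modular_form_bound_nonpos_weight[OF \<sigma> l(1) less_imp_le[OF l(2)] G] by blast
  have "norm (exp (- 2 * pi * m * y) *\<^sub>R c m) \<le> C * y powr (- l / 2)" if y: "0 < y" for y
    using Fourier_coefficient_norm_le[OF holomorphic_expansion_line[OF c y], of "C * y powr (- l / 2)" m]
      C[of "Complex x y" for x] y m by (simp add: uhp_def)
  then have "\<forall>\<^sub>F y in at_right 0. norm (exp (- 2 * pi * m * y) *\<^sub>R c m) \<le> C * y powr (- l / 2)"
    by (auto simp: eventually_at_right_field intro!: exI[of _ 1])
  moreover have "((\<lambda>y. norm (exp (- 2 * pi * m * y) *\<^sub>R c m)) \<longlongrightarrow> norm (exp (- 2 * pi * m * 0) *\<^sub>R c m)) (at_right 0)"
    by (intro tendsto_intros)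
  moreover have "((\<lambda>y. C * y powr (- l / 2)) \<longlongrightarrow> C * 0 powr (- l / 2)) (at_right 0)"
    by (intro tendsto_mult_left tendsto_powr2 tendsto_const tendsto_ident_at)
       (use l in \<open>auto simp: eventually_at_right_field intro!: exI[of _ 1]\<close>)
  ultimately have "norm (exp (- 2 * pi * m * 0) *\<^sub>R c m) \<le> C * 0 powr (- l / 2)"
    using tendsto_le[of "at_right (0::real)"] by fastforce
  then show ?thesis by simp
qed

text \<open>As all exponents are nonnegative, the terms at \<open>\<i>\<close> dominate those at
  every \<tau> with \<open>Im \<tau> \<ge> 1\<close>, so termwise decay of the positive exponents
  passes to the sum.\<close>

lemma holomorphic_expansion_tendsto:
  fixes G :: "complex \<Rightarrow> complex^'m::finite"
  assumes c: "holomorphic_expansion G c"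
  shows "(G \<longlongrightarrow> c 0) at_i_infty"
proof -
  have large: "\<forall>\<^sub>F \<tau> in at_i_infty. b \<le> Im \<tau>" for b
    by (rule eventually_filtercomapI[OF eventually_ge_at_top])
  have "\<i> \<in> uhp" by (simp add: uhp_def)
  then have "(\<lambda>m. q_pow m \<i> *s c m) summable_on {0..}"
    using c by (auto simp: holomorphic_expansion_def summable_on_def)
  then have M: "(\<lambda>m. norm (q_pow m \<i> *s c m)) summable_on {0..}"
    by (rule summable_on_euclidean_iff_abs_summable_on[THEN iffD1])
  have "((\<lambda>\<tau>. \<Sum>\<^sub>\<infinity>m\<in>{0..}. q_pow m \<tau> *s c m) \<longlongrightarrow> (\<Sum>\<^sub>\<infinity>m\<in>{0..}. if m = 0 then c m else 0)) at_i_infty"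
  proof (rule tendsto_infsum_dominated[OF _ _ M])
    fix m :: real assume m: "m \<in> {0..}"
    show "((\<lambda>\<tau>. q_pow m \<tau> *s c m) \<longlongrightarrow> (if m = 0 then c m else 0)) at_i_infty"
    proof (cases "m = 0")
      case True
      then show ?thesis by (simp add: q_pow_def)
    next
      case False
      have "((\<lambda>y. exp (- 2 * pi * m * y) * norm (c m)) \<longlongrightarrow> 0) at_top"
      proof -
        have "((\<lambda>y. exp (- 2 * pi * m * y)) \<longlongrightarrow> 0) at_top"
          by (rule filterlim_compose[OF exp_at_bot])
             (use m False filterlim_tendsto_neg_mult_at_bot[OF tendsto_const _ filterlim_ident, of "- 2 * pi * m"] in auto)
        from tendsto_mult_left_zero[OF this] show ?thesis .
      qed
      from filterlim_compose[OF this filterlim_filtercomap[of Im at_top]]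
      have "((\<lambda>\<tau>. norm (q_pow m \<tau> *s c m)) \<longlongrightarrow> 0) at_i_infty"
        by (simp add: norm_vector_smult norm_q_pow)
      then show ?thesis using False by (simp add: tendsto_norm_zero_iff)
    qed
  next
    show "\<forall>\<^sub>F \<tau> in at_i_infty. \<forall>m\<in>{0..}. norm (q_pow m \<tau> *s c m) \<le> norm (q_pow m \<i> *s c m)"
      by (rule eventually_mono[OF large[of 1]])
         (auto simp: norm_vector_smult norm_q_pow mult_le_cancel_left1 mult_less_0_iff intro!: mult_right_mono)
    show "at_i_infty \<noteq> bot"
      by (rule filtercomap_neq_bot_surj) (auto simp: surj_def intro: exI[of _ "Complex 0 _"])
  qed
  also have "(\<Sum>\<^sub>\<infinity>m\<in>{0..}. if m = 0 then c m else 0) = (\<Sum>\<^sub>\<infinity>m\<in>{0::real}. c m)"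
    by (rule infsum_cong_neutral) auto
  finally have "((\<lambda>\<tau>. \<Sum>\<^sub>\<infinity>m\<in>{0..}. q_pow m \<tau> *s c m) \<longlongrightarrow> c 0) at_i_infty" by simp
  then show ?thesis
  proof (rule Lim_transform_eventually)
    show "\<forall>\<^sub>F \<tau> in at_i_infty. (\<Sum>\<^sub>\<infinity>m\<in>{0..}. q_pow m \<tau> *s c m) = G \<tau>"
      by (rule eventually_mono[OF large[of 1]]) (use c in \<open>auto simp: holomorphic_expansion_def uhp_def intro!: infsumI\<close>)
  qed
qed

text \<open>If a coefficient at a positive exponent were nonzero, the supremum of \<open>norm (G \<tau>)\<close> would exceed
  the norm of the constant term and hence be attained, against the maximum modulus principle.\<close>

lemma weight_0_coeff_eq_0:
  fixes G :: "complex \<Rightarrow> complex^'m::finite"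
  assumes \<sigma>: "unitary_rep \<sigma>" and G: "G \<in> modular_forms 0 \<sigma>"
    and c: "holomorphic_expansion G c" and m: "0 < m"
  shows "c m = 0"
proof (rule ccontr)
  assume cm: "c m \<noteq> 0"
  have inv: "slash_invariant 0 \<sigma> G" using G by (simp add: modular_forms_def)
  obtain C0 where C0: "\<And>\<tau>. \<tau> \<in> uhp \<Longrightarrow> norm (G \<tau>) \<le> C0"
    using modular_form_bound_nonpos_weight[OF \<sigma> _ _ G] by (force simp: uhp_def)
  define C where "C = (SUP \<tau>\<in>uhp. norm (G \<tau>))"
  have bdd: "bdd_above ((\<lambda>\<tau>. norm (G \<tau>)) ` uhp)" using C0 by (auto intro!: bdd_aboveI2)
  have le_C: "norm (G \<tau>) \<le> C" if "\<tau> \<in> uhp" for \<tau>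
    unfolding C_def by (rule cSUP_upper[OF that bdd])
  have ne: "uhp \<noteq> {}" by (auto simp: uhp_def intro!: exI[of _ \<i>])
  have "C \<ge> 0" by (rule order_trans[OF norm_ge_zero le_C[of \<i>]]) (simp add: uhp_def)
  \<comment> \<open>At height 1, the inequality for the exponents 0 and m forces a strict gap
    between \<open>norm (c 0)\<close> and \<open>C\<close>; the exponent -m is absent from the
    expansion.\<close>
  have "norm (G (Complex x 1)) \<le> C" for x by (rule le_C) (simp add: uhp_def)
  from Fourier_two_coefficients_norm_le[OF holomorphic_expansion_line[OF c zero_less_one] this, of m]
  have "(norm (c 0))\<^sup>2 + (exp (- 2 * pi * m) * norm (c m) / 2)\<^sup>2 \<le> C\<^sup>2"
    using m by simp
  moreover have "(exp (- 2 * pi * m) * norm (c m) / 2)\<^sup>2 > 0" using cm by simp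
  ultimately have "(norm (c 0))\<^sup>2 < C\<^sup>2" by linarith
  then have "norm (c 0) < C" using \<open>C \<ge> 0\<close> by (rule power2_less_imp_less)
  \<comment> \<open>A level strictly inside the gap: above height \<open>Y\<close> the norm stays
    below r, so the supremum is approached only in the compact part \<open>K\<close>.\<close>
  define r where "r = (norm (c 0) + C) / 2"
  have r: "norm (c 0) < r" "r < C" "0 \<le> r"
    using \<open>norm (c 0) < C\<close> \<open>C \<ge> 0\<close> by (auto simp: r_def)
  have "\<forall>\<^sub>F \<tau> in at_i_infty. norm (G \<tau>) < r"
    using order_tendstoD(2)[OF tendsto_norm[OF holomorphic_expansion_tendsto[OF c]] r(1)] .
  then obtain Y where Y: "\<And>\<tau>. Y \<le> Im \<tau> \<Longrightarrow> norm (G \<tau>) < r"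
    unfolding eventually_filtercomap eventually_at_top_linorder by blast
  define K where "K = {\<tau>. 0 \<le> Re \<tau> \<and> Re \<tau> \<le> 1 \<and> 1 / 5 \<le> Im \<tau> \<and> Im \<tau> \<le> max Y 1}"
  have K: "compact K" "K \<subseteq> uhp" "Complex 0 1 \<in> K"
    unfolding K_def by (rule compact_strip) (auto simp: uhp_def)
  have "continuous_on K (\<lambda>\<tau>. norm (G \<tau>))"
    by (intro continuous_intros continuous_on_subset[OF modular_form_continuous[OF G] K(2)])
  then obtain \<tau>0 where \<tau>0: "\<tau>0 \<in> K" "\<And>\<tau>. \<tau> \<in> K \<Longrightarrow> norm (G \<tau>) \<le> norm (G \<tau>0)"
    using continuous_attains_sup[OF K(1)] K(3) by blast
  have "norm (G \<tau>) \<le> max r (norm (G \<tau>0))" if \<tau>: "\<tau> \<in> uhp" for \<tau>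
  proof -
    obtain \<tau>' where \<tau>': "1 / 5 \<le> Im \<tau>'" "0 \<le> Re \<tau>'" "Re \<tau>' \<le> 1"
      "Im \<tau>' powr (0 / 2) * norm (G \<tau>') = Im \<tau> powr (0 / 2) * norm (G \<tau>)"
      using slash_invariant_reduction[OF \<sigma> _ inv \<tau>] by auto
    have "Im \<tau>' \<noteq> 0" "Im \<tau> \<noteq> 0" using \<tau>'(1) \<tau> by (auto simp: uhp_def)
    then have eq: "norm (G \<tau>) = norm (G \<tau>')" using \<tau>'(4) by simp
    show ?thesis
    proof (cases "Y \<le> Im \<tau>'")
      case True
      then show ?thesis unfolding eq using Y[of \<tau>'] by linarith
    next
      case False
      then have "\<tau>' \<in> K" using \<tau>' by (simp add: K_def)
      then show ?thesis unfolding eq using \<tau>0(2)[of \<tau>'] by linarith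
    qed
  qed
  then have "C \<le> max r (norm (G \<tau>0))" unfolding C_def by (intro cSUP_least ne)
  then have C: "norm (G \<tau>0) = C" using r le_C[of \<tau>0] \<tau>0(1) K(2) by force
  \<comment> \<open>Pairing with the extremal vector reduces the vector-valued maximum principle to
    the scalar one; Cauchy-Schwarz keeps the modulus below its value at
    \<open>\<tau>0\<close>.\<close>
  define f where "f \<tau> = (\<Sum>i\<in>UNIV. cnj (G \<tau>0 $ i) * G \<tau> $ i)" for \<tau>
  have f_le: "norm (f \<tau>) \<le> C * norm (G \<tau>)" for \<tau>
  proof -
    have "norm (f \<tau>) \<le> (\<Sum>i\<in>UNIV. norm (cnj (G \<tau>0 $ i) * G \<tau> $ i))"
      unfolding f_def by (rule norm_sum)
    also have "\<dots> = (\<Sum>i\<in>UNIV. \<bar>norm (G \<tau>0 $ i)\<bar> * \<bar>norm (G \<tau> $ i)\<bar>)" by (simp add: norm_mult)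
    also have "\<dots> \<le> L2_set (\<lambda>i. norm (G \<tau>0 $ i)) UNIV * L2_set (\<lambda>i. norm (G \<tau> $ i)) UNIV"
      by (rule L2_set_mult_ineq)
    finally show ?thesis by (simp add: norm_vec_def[symmetric] C)
  qed
  have f0: "f \<tau>0 = of_real (C\<^sup>2)"
    by (simp add: f_def C[symmetric] norm_vec_def L2_set_def sum_nonneg mult.commute complex_norm_square[symmetric])
  have "f holomorphic_on uhp"
    unfolding f_def using G by (intro holomorphic_intros) (auto simp: modular_forms_def)
  moreover have "open uhp" "connected uhp"
    unfolding uhp_def by (simp_all add: open_halfspace_Im_gt convex_connected convex_halfspace_Im_gt)
  moreover have "norm (f \<tau>) \<le> norm (f \<tau>0)" if "\<tau> \<in> uhp" for \<tau>
  proof -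
    have "norm (f \<tau>) \<le> C * norm (G \<tau>)" by (rule f_le)
    also have "\<dots> \<le> C * C" using le_C[OF that] \<open>C \<ge> 0\<close> by (rule mult_left_mono)
    finally show ?thesis unfolding f0 norm_of_real by (simp add: power2_eq_square)
  qed
  ultimately have const: "f constant_on uhp"
    using maximum_modulus_principle[of f uhp uhp \<tau>0] \<tau>0(1) K(2) by blast
  \<comment> \<open>A point high enough for norm below r, where constancy of f would force norm at
    least C.\<close>
  define \<tau>1 where "\<tau>1 = Complex 0 (max Y 1)"
  have "\<tau>1 \<in> uhp" by (simp add: \<tau>1_def uhp_def)
  then have f1: "f \<tau>1 = f \<tau>0" using const \<tau>0(1) K(2) by (auto simp: constant_on_def)
  have "C * C \<le> C * norm (G \<tau>1)"
    using f_le[of \<tau>1] unfolding f1 f0 norm_of_real by (simp add: power2_eq_square)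
  also have "norm (G \<tau>1) < r" by (rule Y) (simp add: \<tau>1_def)
  finally show False using r by (auto simp: mult_less_cancel_left)
qed

lemma nonpos_weight_coeff_eq_0:
  assumes "unitary_rep \<sigma>" "2 * l \<in> \<int>" "l \<le> 0" "G \<in> modular_forms l \<sigma>"
    "holomorphic_expansion G c" "0 < m"
  shows "c m = 0"
  using negative_weight_coeff_eq_0[of \<sigma> l G c m] weight_0_coeff_eq_0[of \<sigma> G c m] assms
  by (cases "l = 0") auto

subsection \<open>The holomorphic projection\<close>

lemma norm_tensor_vec: "norm (v \<otimes>\<^sub>v w) = norm v * norm w"
  for v :: "complex^'m::finite" and w :: "complex^'n::finite"
proof -
  have "(norm (v \<otimes>\<^sub>v w))\<^sup>2 = (\<Sum>p\<in>UNIV. (norm (v $ fst p))\<^sup>2 * (norm (w $ snd p))\<^sup>2)"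
    by (simp add: norm_vec_def L2_set_def sum_nonneg tensor_vec_def norm_mult power_mult_distrib)
  also have "\<dots> = (\<Sum>i\<in>UNIV. \<Sum>j\<in>UNIV. (norm (v $ i))\<^sup>2 * (norm (w $ j))\<^sup>2)"
    by (simp add: sum.cartesian_product case_prod_beta)
  also have "\<dots> = (norm v)\<^sup>2 * (norm w)\<^sup>2"
    by (simp add: norm_vec_def L2_set_def sum_nonneg sum_product)
  finally have "(norm (v \<otimes>\<^sub>v w))\<^sup>2 = (norm v * norm w)\<^sup>2" by (simp add: power_mult_distrib)
  then show ?thesis by (simp add: power2_eq_iff_nonneg)
qed

lemma tensor_vec_simps:
  "(c *s v) \<otimes>\<^sub>v w = c *s (v \<otimes>\<^sub>v w)" "v \<otimes>\<^sub>v (c *s w) = c *s (v \<otimes>\<^sub>v w)" "v \<otimes>\<^sub>v 0 = 0"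
  by (simp_all add: vec_eq_iff tensor_vec_def)

lemma bounded_linear_tensor_vec_right: "bounded_linear (\<lambda>w :: complex^'n::finite. (v :: complex^'m::finite) \<otimes>\<^sub>v w)"
proof (rule bounded_linear_intro[of _ "norm v"])
qed (simp add: vec_eq_iff tensor_vec_def algebra_simps, simp add: vec_eq_iff tensor_vec_def, simp add: norm_tensor_vec)

lemma bounded_linear_tensor_vec_left: "bounded_linear (\<lambda>v :: complex^'m::finite. v \<otimes>\<^sub>v (w :: complex^'n::finite))"
proof (rule bounded_linear_intro[of _ "norm w"])
qed (simp add: vec_eq_iff tensor_vec_def algebra_simps, simp add: vec_eq_iff tensor_vec_def, simp add: norm_tensor_vec)

text \<open>Both sums converge absolutely and the norm is multiplicative on tensors, so the double
  family is absolutely summable and may be summed iteratively.\<close>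

lemma has_sum_tensor_vec:
  fixes f :: "'i \<Rightarrow> complex^'m::finite" and g :: "'j \<Rightarrow> complex^'n::finite"
  assumes f: "(f has_sum v) A" and g: "(g has_sum w) B"
  shows "((\<lambda>(i, j). f i \<otimes>\<^sub>v g j) has_sum (v \<otimes>\<^sub>v w)) (A \<times> B)"
proof (rule has_sum_SigmaI)
  show "((\<lambda>j. case (i, j) of (i, j) \<Rightarrow> f i \<otimes>\<^sub>v g j) has_sum (f i \<otimes>\<^sub>v w)) B" for i
    using has_sum_bounded_linear[OF bounded_linear_tensor_vec_right g] by simp
  show "((\<lambda>i. f i \<otimes>\<^sub>v w) has_sum (v \<otimes>\<^sub>v w)) A"
    by (rule has_sum_bounded_linear[OF bounded_linear_tensor_vec_left f])
  have f': "(\<lambda>i. norm (f i)) summable_on A" and g': "(\<lambda>j. norm (g j)) summable_on B"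
    using f g summable_on_euclidean_iff_abs_summable_on[of f A] summable_on_euclidean_iff_abs_summable_on[of g B]
    by (auto simp: summable_on_def)
  have "(\<lambda>p. norm (case p of (i, j) \<Rightarrow> f i \<otimes>\<^sub>v g j)) summable_on Sigma A (\<lambda>_. B)"
  proof (rule Infinite_Sum.abs_summable_on_Sigma_iff[THEN iffD2], intro conjI ballI)
    fix i assume "i \<in> A"
    show "(\<lambda>j. norm (case (i, j) of (i, j) \<Rightarrow> f i \<otimes>\<^sub>v g j)) summable_on B"
      using summable_on_cmult_right[OF g', of "norm (f i)"] by (simp add: norm_tensor_vec)
  next
    show "(\<lambda>i. norm (\<Sum>\<^sub>\<infinity>j\<in>B. norm (case (i, j) of (i, j) \<Rightarrow> f i \<otimes>\<^sub>v g j))) summable_on A"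
      using summable_on_cmult_left[OF f', of "\<Sum>\<^sub>\<infinity>j\<in>B. norm (g j)"]
      by (simp add: norm_tensor_vec infsum_cmult_right' infsum_nonneg abs_mult)
  qed
  then show "(\<lambda>(i, j). f i \<otimes>\<^sub>v g j) summable_on Sigma A (\<lambda>_. B)"
    by (rule abs_summable_summable)
qed

lemma q_pow_add: "q_pow (a + b) \<tau> = q_pow a \<tau> * q_pow b \<tau>"
  by (simp add: q_pow_def algebra_simps flip: exp_add)

text \<open>The absolutely convergent product of the two expansions is regrouped along
  \<open>m + t = N\<close>; uniqueness identifies the inner sums with the Fourier
  coefficients.\<close>

lemma fourier_coeff_nonholomorphic_tensor:
  fixes Fm :: "complex \<Rightarrow> complex^'m::finite" and G :: "complex \<Rightarrow> complex^'n::finite"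
  assumes F: "maass_splitting k F Fp Fm cp cm" and G: "holomorphic_expansion G cG" and y: "0 < y" and n: "0 < n"
  defines "u \<equiv> \<lambda>m y. - ((4 * pi) powr (k - 1) * \<bar>m\<bar> powr (k - 1) * upper_Gamma (1 - k) (4 * pi * \<bar>m\<bar> * y))"
  shows "fourier_coeff (\<lambda>\<tau>. Fm \<tau> \<otimes>\<^sub>v G \<tau>) n y = (\<Sum>\<^sub>\<infinity>t\<in>{n<..}. u (n - t) y *\<^sub>R (cm (n - t) \<otimes>\<^sub>v cG t))"
    and "(\<lambda>t. norm (u (n - t) y *\<^sub>R (cm (n - t) \<otimes>\<^sub>v cG t))) summable_on {n<..}"
proof -
  \<comment> \<open>The condition \<open>N < t\<close> says that \<open>m = N - t\<close> is
    negative. For n > 0 it implies \<open>0 \<le> t\<close>, so \<open>B n\<close> is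
    \<open>{n<..}\<close>.\<close>
  define B where "B N = {t::real. 0 \<le> t \<and> N < t}" for N
  define v where "v y N t = u (N - t) y *\<^sub>R (cm (N - t) \<otimes>\<^sub>v cG t)" for y N t
  define c where "c N y = infsum (v y N) (B N)" for N y
  have product: "((\<lambda>(N, t). q_pow N \<tau> *s v (Im \<tau>) N t) has_sum (Fm \<tau> \<otimes>\<^sub>v G \<tau>)) (Sigma UNIV B)" if \<tau>: "\<tau> \<in> uhp" for \<tau>
  proof -
    let ?f = "\<lambda>m. (of_real (u m (Im \<tau>)) * q_pow m \<tau>) *s cm m" and ?g = "\<lambda>t. q_pow t \<tau> *s cG t"
    have "(?f has_sum Fm \<tau>) {m. m < 0}"
      using F \<tau> by (simp add: maass_splitting_def u_def)
    moreover have "(?g has_sum G \<tau>) {0..}"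
      using G \<tau> by (simp add: holomorphic_expansion_def)
    ultimately have "((\<lambda>(m, t). ?f m \<otimes>\<^sub>v ?g t) has_sum (Fm \<tau> \<otimes>\<^sub>v G \<tau>)) ({m. m < 0} \<times> {0..})"
      by (rule has_sum_tensor_vec)
    also have "?this \<longleftrightarrow> ?thesis"
    proof (rule has_sum_reindex_bij_witness[where i = "\<lambda>(N, t). (N - t, t)" and j = "\<lambda>(m, t). (m + t, t)"])
      fix p :: "real \<times> real"
      obtain m t where p: "p = (m, t)" by (cases p)
      have "?f m \<otimes>\<^sub>v ?g t = q_pow (m + t) \<tau> *s v (Im \<tau>) (m + t) t"
        by (simp add: v_def tensor_vec_simps q_pow_add mult_ac flip: of_real_vector_smult)
      then show "(case case p of (m, t) \<Rightarrow> (m + t, t) of (N, t) \<Rightarrow> q_pow N \<tau> *s v (Im \<tau>) N t) =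
          (case p of (m, t) \<Rightarrow> ?f m \<otimes>\<^sub>v ?g t)"
        by (simp add: p)
    qed (auto simp: B_def)
    finally show ?thesis .
  qed
  have summable_v: "v y N summable_on B N" if "0 < y" for y N
  proof -
    define \<tau> where "\<tau> = Complex 0 y"
    have \<tau>: "\<tau> \<in> uhp" "Im \<tau> = y" using that by (auto simp: \<tau>_def uhp_def)
    have "(\<lambda>(N, t). q_pow N \<tau> *s v y N t) summable_on Sigma UNIV B"
      using product[OF \<tau>(1)] \<tau>(2) by (auto simp: summable_on_def)
    then have "(\<lambda>(N, t). q_pow N \<tau> *s v y N t) summable_on Pair N ` B N"
      by (rule summable_on_subset_banach) auto
    then have "((\<lambda>(N, t). q_pow N \<tau> *s v y N t) \<circ> Pair N) summable_on B N"
      by (subst (asm) summable_on_reindex) (auto simp: inj_on_def)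
    then have "(\<lambda>t. q_pow N \<tau> *s v y N t) summable_on B N" by (simp add: o_def)
    from summable_on_bounded_linear[OF bounded_linear_vector_smult this, of "inverse (q_pow N \<tau>)"]
    show ?thesis by (simp add: vector_smult_assoc q_pow_def)
  qed
  have "has_fourier_expansion (\<lambda>\<tau>. Fm \<tau> \<otimes>\<^sub>v G \<tau>) c"
    unfolding has_fourier_expansion_def
  proof
    fix \<tau> assume \<tau>: "\<tau> \<in> uhp"
    then have "0 < Im \<tau>" by (simp add: uhp_def)
    then have "(v (Im \<tau>) N has_sum c N (Im \<tau>)) (B N)" for N
      unfolding c_def by (intro has_sum_infsum summable_v)
    then have "((\<lambda>t. q_pow N \<tau> *s v (Im \<tau>) N t) has_sum q_pow N \<tau> *s c N (Im \<tau>)) (B N)" for N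
      by (rule has_sum_bounded_linear[OF bounded_linear_vector_smult])
    then show "((\<lambda>N. q_pow N \<tau> *s c N (Im \<tau>)) has_sum Fm \<tau> \<otimes>\<^sub>v G \<tau>) UNIV"
      by (intro has_sum_SigmaD[OF product[OF \<tau>]]) simp
  qed
  from fourier_coeff_eqI[OF this y] have "fourier_coeff (\<lambda>\<tau>. Fm \<tau> \<otimes>\<^sub>v G \<tau>) n y = c n y" .
  moreover have B: "B n = {n<..}" using n by (auto simp: B_def)
  ultimately show "fourier_coeff (\<lambda>\<tau>. Fm \<tau> \<otimes>\<^sub>v G \<tau>) n y = (\<Sum>\<^sub>\<infinity>t\<in>{n<..}. u (n - t) y *\<^sub>R (cm (n - t) \<otimes>\<^sub>v cG t))"
    by (simp add: c_def v_def[abs_def])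
  show "(\<lambda>t. norm (u (n - t) y *\<^sub>R (cm (n - t) \<otimes>\<^sub>v cG t))) summable_on {n<..}"
    using summable_v[OF y, of n] summable_on_euclidean_iff_abs_summable_on[of "v y n" "{n<..}"]
    unfolding B v_def by simp
qed

text \<open>For gauge integrals an improper integral is a proper one: convergence of the truncated
  integrals is continuity at 0 of an antiderivative, which suffices for the fundamental theorem on
  \<open>{0..1}\<close>. The endpoint 0 is negligible.\<close>

lemma has_integral_improper_at_0:
  fixes f :: "real \<Rightarrow> 'b::euclidean_space"
  assumes cont: "continuous_on {0<..} f" and I: "\<And>\<epsilon>. 0 < \<epsilon> \<Longrightarrow> (f has_integral I \<epsilon>) {\<epsilon>..}"
    and L: "(I \<longlongrightarrow> L) (at_right 0)"
  shows "(f has_integral L) {0<..}"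
proof -
  \<comment> \<open>The integral over (0, x], expressed through its prescribed value
    \<open>L\<close>.\<close>
  define \<Phi> where "\<Phi> x = (if x = 0 then 0 else L - I x)" for x
  have \<Phi>_eq: "\<Phi> z = \<Phi> a + integral {a..z} f" if "0 < a" "a \<le> z" for a z
  proof -
    have int: "f integrable_on {a..z}"
      by (intro integrable_continuous_interval continuous_on_subset[OF cont]) (use that in auto)
    have "negligible ({a..z} \<inter> {z..})" by (rule negligible_subset[of "{z}"]) auto
    then have "(f has_integral (integral {a..z} f + I z)) ({a..z} \<union> {z..})"
      by (intro has_integral_Un integrable_integral int I) (use that in auto)
    moreover have "{a..z} \<union> {z..} = {a..}" using that by auto
    ultimately have "integral {a..z} f + I z = I a"
      using has_integral_unique[OF I[OF that(1)]] by simp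
    then show ?thesis using that by (simp add: \<Phi>_def algebra_simps)
  qed
  have deriv: "(\<Phi> has_vector_derivative f x) (at x)" if x: "0 < x" for x
  proof -
    have "continuous_on {x/2..x+1} f" by (rule continuous_on_subset[OF cont]) (use x in auto)
    then have "((\<lambda>z. integral {x/2..z} f) has_vector_derivative f x) (at x within {x/2..x+1})"
      by (rule integral_has_vector_derivative) (use x in auto)
    then have "((\<lambda>z. integral {x/2..z} f) has_vector_derivative f x) (at x)"
      by (simp add: at_within_Icc_at x)
    then have "((\<lambda>z. \<Phi> (x/2) + integral {x/2..z} f) has_vector_derivative f x) (at x)"
      by (auto intro!: derivative_eq_intros)
    then show ?thesis
    proof (rule has_vector_derivative_transform_within_open[of _ _ _ "{x/2<..}"])
      show "\<Phi> (x/2) + integral {x/2..z} f = \<Phi> z" if "z \<in> {x/2<..}" for z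
        by (rule \<Phi>_eq[symmetric]) (use x that in auto)
    qed (use x in auto)
  qed
  have "continuous_on {0..1} \<Phi>"
    unfolding continuous_on_def
  proof
    fix x :: real assume "x \<in> {0..1}"
    then consider "x = 0" | "0 < x" by fastforce
    then show "(\<Phi> \<longlongrightarrow> \<Phi> x) (at x within {0..1})"
    proof cases
      case 1
      have "((\<lambda>\<epsilon>. L - I \<epsilon>) \<longlongrightarrow> L - L) (at_right 0)" by (intro tendsto_intros L)
      then have "(\<Phi> \<longlongrightarrow> 0) (at_right 0)"
        by (intro Lim_transform_eventually[where g = \<Phi>, of "\<lambda>\<epsilon>. L - I \<epsilon>"])
           (auto simp: \<Phi>_def eventually_at_right_field intro!: exI[of _ 1])
      then show ?thesis by (simp add: 1 \<Phi>_def at_within_Icc_at_right)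
    next
      case 2
      then have "isCont \<Phi> x" using deriv has_vector_derivative_continuous by blast
      then show ?thesis unfolding isCont_def by (rule tendsto_within_subset) simp
    qed
  qed
  then have "(f has_integral \<Phi> 1 - \<Phi> 0) {0..1}"
    by (intro fundamental_theorem_of_calculus_interior deriv) auto
  moreover have "negligible ({0..1} \<inter> {1::real..})" by (rule negligible_subset[of "{1}"]) auto
  ultimately have "(f has_integral ((\<Phi> 1 - \<Phi> 0) + I 1)) ({0..1} \<union> {1..})"
    by (intro has_integral_Un I) auto
  moreover have "{0..1} \<union> {1..} = {0::real..}" by auto
  ultimately have "(f has_integral L) {0..}" by (simp add: \<Phi>_def)
  then show ?thesis
    by (rule has_integral_spike_set_eq[THEN iffD1, rotated -1]) (auto intro: negligible_subset[of "{0}"])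
qed

text \<open>Factors independent of t gather in \<open>K\<close>; what remains of the truncated t-th
  term is \<open>a t\<close> times a multiplier, which Abel summation removes.\<close>

lemma hol_proj_integral:
  fixes b :: "real \<Rightarrow> 'b::euclidean_space" and k l n :: real
  assumes l: "0 < l" and kl: "1 < k + l" and n: "0 < n"
  defines "u \<equiv> \<lambda>t y. - ((4 * pi) powr (k - 1) * (t - n) powr (k - 1) * upper_Gamma (1 - k) (4 * pi * (t - n) * y))"
  defines "a \<equiv> \<lambda>t. ((n / t) powr l * hypergeo_2F1 1 l (k + l) (n / t)) *\<^sub>R b t"
  assumes b: "\<And>y. 0 < y \<Longrightarrow> (\<lambda>t. norm (u t y *\<^sub>R b t)) summable_on {n<..}"
    and S: "((\<lambda>X. infsum a {n<..X}) \<longlongrightarrow> S) at_top"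
  shows "((\<lambda>y. (exp (- 4 * pi * n * y) * y powr (k + l - 2)) *\<^sub>R (\<Sum>\<^sub>\<infinity>t\<in>{n<..}. u t y *\<^sub>R b t)) has_integral
           (- (Gamma l * (4 * pi * n) powr (- l) / (k + l - 1))) *\<^sub>R S) {0<..}"
proof -
  define s where "s = 4 * pi * n"
  have s: "0 < s" using n by (simp add: s_def)
  define p where "p t = 4 * pi * (t - n)" for t
  have p: "0 < p t" if "t \<in> {n<..}" for t using that by (simp add: p_def)
  define w where "w t = (4 * pi) powr (k - 1) * (t - n) powr (k - 1)" for t
  have w: "0 \<le> w t" for t by (simp add: w_def)
  define g where "g y = exp (- s * y) * y powr (k + l - 2)" for y
  define K where "K = Gamma l * s powr (- l) / (k + l - 1)"
  have K: "0 < K" using Gamma_real_pos[OF l] s kl by (simp add: K_def)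
  define f where "f t y = (- (w t * (g y * upper_Gamma (1 - k) (p t * y)))) *\<^sub>R b t" for t y
  define V where "V \<epsilon> t = integral {p t..} (gamma_weight_trunc k l s \<epsilon>)" for \<epsilon> t
  define \<phi> where "\<phi> \<epsilon> t = trunc_ratio k l s \<epsilon> (p t)" for \<epsilon> t
  have u_eq: "u t y = - (w t * upper_Gamma (1 - k) (p t * y))" for t y
    by (simp add: u_def w_def p_def mult_ac)
  \<comment> \<open>The terms at height \<epsilon> form a majorant on \<open>{\<epsilon>..}\<close>,
    summable because the Fourier coefficient at height \<epsilon> converges absolutely.\<close>
  have u_mono: "norm (u t y *\<^sub>R b t) \<le> norm (u t \<epsilon> *\<^sub>R b t)" if "t \<in> {n<..}" "0 < \<epsilon>" "\<epsilon> \<le> y" for t \<epsilon> y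
  proof -
    have "upper_Gamma (1 - k) (p t * y) \<le> upper_Gamma (1 - k) (p t * \<epsilon>)"
      by (rule upper_Gamma_antimono) (use p[OF that(1)] that in auto)
    moreover have "0 \<le> upper_Gamma (1 - k) (p t * y)"
      by (rule upper_Gamma_nonneg) (use p[OF that(1)] that in auto)
    ultimately show ?thesis
      using w[of t] by (simp add: u_eq abs_mult mult_left_mono mult_right_mono)
  qed
  have f_eq: "f t y = g y *\<^sub>R (u t y *\<^sub>R b t)" for t y by (simp add: f_def u_eq mult_ac)
  have g_nonneg: "0 \<le> g y" for y by (simp add: g_def)
  have g_int: "g integrable_on {\<epsilon>..}" if \<epsilon>: "0 < \<epsilon>" for \<epsilon>
  proof -
    have "(g has_integral (s powr (- (k + l - 1)) * upper_Gamma (k + l - 1) (s * \<epsilon>))) {\<epsilon>..}"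
    proof (rule nn_integral_atLeast_eq_iff[THEN iffD1])
      show "(\<integral>\<^sup>+t. ennreal (g t) * indicator {\<epsilon>..} t \<partial>lborel) = ennreal (s powr (- (k + l - 1)) * upper_Gamma (k + l - 1) (s * \<epsilon>))"
        using nn_integral_exp_powr[OF s \<epsilon>, of "k + l - 1"] by (simp add: g_def diff_diff_eq)
      show "(\<lambda>t. g t * indicator {\<epsilon>..} t) \<in> borel_measurable borel"
        unfolding g_def by measurable
      show "0 \<le> s powr (- (k + l - 1)) * upper_Gamma (k + l - 1) (s * \<epsilon>)"
        by (intro mult_nonneg_nonneg upper_Gamma_nonneg) (use s \<epsilon> in auto)
    qed (rule g_nonneg)
    then show ?thesis by blast
  qed
  have f_int: "(f t has_integral (- (w t * V \<epsilon> t)) *\<^sub>R b t) {\<epsilon>..}" if t: "t \<in> {n<..}" and \<epsilon>: "0 < \<epsilon>" for t \<epsilon>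
  proof -
    have "((\<lambda>y. g y * upper_Gamma (1 - k) (p t * y)) has_integral V \<epsilon> t) {\<epsilon>..}"
      using truncated_Mellin_upper_Gamma[OF l kl s \<epsilon> p[OF t]] by (simp add: g_def V_def)
    then have "((\<lambda>y. - w t * (g y * upper_Gamma (1 - k) (p t * y))) has_integral - w t * V \<epsilon> t) {\<epsilon>..}"
      by (rule has_integral_mult_right)
    from has_integral_scaleR_left[OF this, of "b t"] show ?thesis unfolding f_def[abs_def] by simp
  qed
  have f_bound: "norm (f t y) \<le> norm (u t \<epsilon> *\<^sub>R b t) * g y" if "t \<in> {n<..}" "y \<in> {\<epsilon>..}" "0 < \<epsilon>" for t y \<epsilon>
  proof -
    have "norm (f t y) = norm (u t y *\<^sub>R b t) * g y" using g_nonneg[of y] by (simp add: f_eq abs_mult mult.commute)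
    also have "\<dots> \<le> norm (u t \<epsilon> *\<^sub>R b t) * g y"
      using u_mono[of t \<epsilon> y] that g_nonneg by (intro mult_right_mono) auto
    finally show ?thesis .
  qed
  note exchange = has_integral_infsum[OF f_int f_bound b norm_ge_zero g_int g_nonneg]
  define Q where "Q y = (\<Sum>\<^sub>\<infinity>t\<in>{n<..}. u t y *\<^sub>R b t)" for y
  have sum_f: "(\<Sum>\<^sub>\<infinity>t\<in>{n<..}. f t y) = g y *\<^sub>R Q y" if "0 < y" for y
    unfolding f_eq Q_def by (rule infsum_scaleR_right)
  \<comment> \<open>\<open>w t\<close> equals \<open>p t powr (k - 1)\<close> and cancels the power
    from the hypergeometric integral; \<open>p t + s = 4 * pi * t\<close> makes the argument
    \<open>n / t\<close> and leaves \<open>(n / t) powr l\<close>.\<close>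
  have weight: "w t * V \<epsilon> t = K * (\<phi> \<epsilon> t * ((n / t) powr l * hypergeo_2F1 1 l (k + l) (n / t)))" if t: "t \<in> {n<..}" for t \<epsilon>
  proof -
    have t0: "0 < t" using t n by simp
    have W: "integral {p t..} (gamma_weight k l s) =
        p t powr (1 - k) * (p t + s) powr (- l) / (k + l - 1) * hypergeo_2F1 1 l (k + l) (s / (p t + s))"
      by (rule integral_unique[OF gamma_weight_has_integral[OF l kl s p[OF t]]])
    have ps: "p t + s = 4 * pi * t" by (simp add: p_def s_def algebra_simps)
    have z: "s / (p t + s) = n / t" unfolding ps by (simp add: s_def)
    have wp: "w t * p t powr (1 - k) = 1"
    proof -
      have "w t = p t powr (k - 1)" unfolding w_def p_def by (rule powr_mult[symmetric])
      then have "w t * p t powr (1 - k) = p t powr 0" by (simp flip: powr_add)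
      then show ?thesis using p[OF t] by simp
    qed
    have tl: "(p t + s) powr (- l) = s powr (- l) * (n / t) powr l"
    proof -
      have "p t + s = s / (n / t)" unfolding ps using n t0 by (simp add: s_def)
      also have "\<dots> powr (- l) = s powr (- l) * (n / t) powr l"
        unfolding powr_divide using n t0 by (simp add: powr_minus field_simps)
      finally show ?thesis .
    qed
    have "Gamma l \<noteq> 0" "integral {p t..} (gamma_weight k l s) \<noteq> 0"
      using Gamma_real_pos[OF l] gamma_weight_integral_pos[OF l kl s p[OF t]] by auto
    then have "V \<epsilon> t = \<phi> \<epsilon> t * (Gamma l * integral {p t..} (gamma_weight k l s))"
      by (simp add: V_def \<phi>_def trunc_ratio_def)
    then have "w t * V \<epsilon> t = (w t * p t powr (1 - k)) * (\<phi> \<epsilon> t * (Gamma l * (s powr (- l) * (n / t) powr l / (k + l - 1) * hypergeo_2F1 1 l (k + l) (n / t))))"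
      unfolding W z tl by (simp add: mult_ac)
    then show ?thesis unfolding wp K_def by (simp add: mult_ac)
  qed
  have I_eq: "(- (w t * V \<epsilon> t)) *\<^sub>R b t = (- K) *\<^sub>R (\<phi> \<epsilon> t *\<^sub>R a t)" if "t \<in> {n<..}" for t \<epsilon>
    unfolding weight[OF that] a_def by simp
  have int_Q: "((\<lambda>y. g y *\<^sub>R Q y) has_integral (- K) *\<^sub>R (\<Sum>\<^sub>\<infinity>t\<in>{n<..}. \<phi> \<epsilon> t *\<^sub>R a t)) {\<epsilon>..}" if \<epsilon>: "0 < \<epsilon>" for \<epsilon>
  proof -
    have "((\<lambda>y. \<Sum>\<^sub>\<infinity>t\<in>{n<..}. f t y) has_integral (\<Sum>\<^sub>\<infinity>t\<in>{n<..}. (- (w t * V \<epsilon> t)) *\<^sub>R b t)) {\<epsilon>..}"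
      by (rule exchange(1)) (use \<epsilon> in auto)
    also have "(\<Sum>\<^sub>\<infinity>t\<in>{n<..}. (- (w t * V \<epsilon> t)) *\<^sub>R b t) = (\<Sum>\<^sub>\<infinity>t\<in>{n<..}. (- K) *\<^sub>R (\<phi> \<epsilon> t *\<^sub>R a t))"
      by (rule infsum_cong) (rule I_eq)
    also have "\<dots> = (- K) *\<^sub>R (\<Sum>\<^sub>\<infinity>t\<in>{n<..}. \<phi> \<epsilon> t *\<^sub>R a t)" by (rule infsum_scaleR_right)
    finally show ?thesis
      by (rule has_integral_eq[rotated]) (use sum_f \<epsilon> in auto)
  qed
  have summable_a: "(\<lambda>t. norm (\<phi> \<epsilon> t *\<^sub>R a t)) summable_on {n<..}" if \<epsilon>: "0 < \<epsilon>" for \<epsilon>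
  proof -
    have "(\<lambda>t. norm ((- (w t * V \<epsilon> t)) *\<^sub>R b t)) summable_on {n<..}"
      by (rule exchange(2)) (use \<epsilon> in auto)
    then have "(\<lambda>t. K * norm (\<phi> \<epsilon> t *\<^sub>R a t)) summable_on {n<..}"
      by (rule summable_on_cong[THEN iffD1, rotated]) (use I_eq K in \<open>simp add: abs_mult\<close>)
    then show ?thesis using K by (simp add: summable_on_cmult_right')
  qed
  have "((\<lambda>\<epsilon>. \<Sum>\<^sub>\<infinity>t\<in>{n<..}. \<phi> \<epsilon> t *\<^sub>R a t) \<longlongrightarrow> S) (at_right 0)"
  proof (rule Abel_summation_limit[OF _ _ summable_a _ S])
    show "antimono_on {n<..} (\<phi> \<epsilon>)" if \<epsilon>: "0 < \<epsilon>" for \<epsilon>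
      using trunc_ratio_antimono[OF l kl s \<epsilon>] by (auto simp: monotone_on_def \<phi>_def p_def)
    show "0 < \<phi> \<epsilon> t \<and> \<phi> \<epsilon> t \<le> 1" if "0 < \<epsilon>" "n < t" for \<epsilon> t
      using trunc_ratio_pos[OF l kl s that(1)] trunc_ratio_le_1[OF l kl s that(1)] p[of t] that(2) by (auto simp: \<phi>_def)
    show "((\<lambda>\<epsilon>. \<phi> \<epsilon> t) \<longlongrightarrow> 1) (at_right 0)" if "n < t" for t
      using trunc_ratio_tendsto_1[OF l kl s] p[of t] that by (simp add: \<phi>_def)
  qed
  then have lim: "((\<lambda>\<epsilon>. (- K) *\<^sub>R (\<Sum>\<^sub>\<infinity>t\<in>{n<..}. \<phi> \<epsilon> t *\<^sub>R a t)) \<longlongrightarrow> (- K) *\<^sub>R S) (at_right 0)"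
    by (intro tendsto_intros)
  \<comment> \<open>The improper limit differentiates an indefinite integral and so needs a
    continuous integrand; convergence is uniform on each \<open>{x/2..}\<close>.\<close>
  have cont_Q: "continuous_on {0<..} Q"
    unfolding continuous_on_eq_continuous_at[OF open_greaterThan]
  proof
    fix x :: real assume "x \<in> {0<..}"
    then have x: "0 < x" by simp
    have "uniform_limit {x/2..} (\<lambda>X y. \<Sum>t\<in>X. u t y *\<^sub>R b t) Q (finite_subsets_at_top {n<..})"
      unfolding Q_def
      by (rule Weierstrass_m_test_general[OF _ b[of "x/2"]]) (use u_mono x in auto)
    moreover have "continuous_on {x/2..} (\<lambda>y. \<Sum>t\<in>X. u t y *\<^sub>R b t)" if "X \<subseteq> {n<..}" for X
      unfolding u_eq
      by (intro continuous_intros continuous_on_compose2[OF continuous_on_upper_Gamma])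
         (use p that x in \<open>auto simp: subset_iff\<close>)
    then have "\<forall>\<^sub>F X in finite_subsets_at_top {n<..}. continuous_on {x/2..} (\<lambda>y. \<Sum>t\<in>X. u t y *\<^sub>R b t)"
      by (intro eventually_finite_subsets_at_top_weakI)
    ultimately have "continuous_on {x/2..} Q"
      by (intro uniform_limit_theorem[of _ "\<lambda>X y. \<Sum>t\<in>X. u t y *\<^sub>R b t" "finite_subsets_at_top {n<..}"]) auto
    then show "isCont Q x" by (rule continuous_on_interior) (use x in auto)
  qed
  have "continuous_on {0<..} (\<lambda>y. g y *\<^sub>R Q y)"
    unfolding g_def by (intro continuous_intros cont_Q) auto
  from has_integral_improper_at_0[OF this int_Q lim] show ?thesis
    by (simp add: g_def Q_def K_def s_def)
qed

text \<open>The series is read as the limit of its partial sums in order of increasing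
  \<open>m'\<close>; each partial sum converges absolutely, by comparison with a damped series when
  l > 0 and trivially otherwise.\<close>

theorem theorem3p5:
  fixes \<rho> :: "'m::finite mp2_rep" and \<sigma> :: "'n::finite mp2_rep"
    and k l n :: real
    and F Fp Fm :: "complex \<Rightarrow> complex^'m" and G :: "complex \<Rightarrow> complex^'n"
    and cp cm :: "real \<Rightarrow> complex^'m" and cG :: "real \<Rightarrow> complex^'n"
    and S :: "complex^('m \<times> 'n)"
  assumes "unitary_rep \<rho>" and "unitary_rep \<sigma>"
    and "2 * k \<in> \<int>" and "2 * l \<in> \<int>" and "k + l \<ge> 2" and "k \<noteq> 1"
    and "F \<in> harmonic_maass_cuspidal k \<rho>" and "maass_splitting k F Fp Fm cp cm"
    and "G \<in> modular_forms l \<sigma>" and "holomorphic_expansion G cG"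
    and "n > 0"
    and series_converges:
      "((\<lambda>X. \<Sum>\<^sub>\<infinity>(m, m')\<in>{(m, m'). m + m' = n \<and> m < 0 \<and> m' \<le> X}.
           of_real ((n / m') powr l * hypergeo_2F1 1 l (k + l) (n / m')) *s (cm m \<otimes>\<^sub>v cG m'))
        \<longlongrightarrow> S) at_top"
  shows "hol_proj_coeff (k + l) (\<lambda>\<tau>. Fm \<tau> \<otimes>\<^sub>v G \<tau>) n =
           of_real (- ((4 * pi) powr (k - 1)) * Gamma l / Gamma (k + l) * n powr (k - 1)) *s S"
proof -
  note \<sigma> = assms(2) and l = assms(4) and kl = assms(5) and F = assms(8)
    and G = assms(9) and cG = assms(10) and n = assms(11)
  define b where "b t = cm (n - t) \<otimes>\<^sub>v cG t" for t
  define a where "a t = ((n / t) powr l * hypergeo_2F1 1 l (k + l) (n / t)) *\<^sub>R b t" for t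
  define u where "u t y = - ((4 * pi) powr (k - 1) * (t - n) powr (k - 1) * upper_Gamma (1 - k) (4 * pi * (t - n) * y))" for t y
  have u_eq: "- ((4 * pi) powr (k - 1) * \<bar>n - t\<bar> powr (k - 1) * upper_Gamma (1 - k) (4 * pi * \<bar>n - t\<bar> * y)) = u t y"
    if "t \<in> {n<..}" for t y
    using that by (simp add: u_def)
  have coeff: "fourier_coeff (\<lambda>\<tau>. Fm \<tau> \<otimes>\<^sub>v G \<tau>) n y = (\<Sum>\<^sub>\<infinity>t\<in>{n<..}. u t y *\<^sub>R b t)"
    and summable: "(\<lambda>t. norm (u t y *\<^sub>R b t)) summable_on {n<..}" if "0 < y" for y
  proof -
    have "(\<Sum>\<^sub>\<infinity>t\<in>{n<..}. u t y *\<^sub>R b t) =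
        (\<Sum>\<^sub>\<infinity>t\<in>{n<..}. (- ((4 * pi) powr (k - 1) * \<bar>n - t\<bar> powr (k - 1) * upper_Gamma (1 - k) (4 * pi * \<bar>n - t\<bar> * y))) *\<^sub>R (cm (n - t) \<otimes>\<^sub>v cG t))"
      by (intro infsum_cong) (simp only: u_eq b_def)
    then show "fourier_coeff (\<lambda>\<tau>. Fm \<tau> \<otimes>\<^sub>v G \<tau>) n y = (\<Sum>\<^sub>\<infinity>t\<in>{n<..}. u t y *\<^sub>R b t)"
      using fourier_coeff_nonholomorphic_tensor(1)[OF F cG that n] by simp
    show "(\<lambda>t. norm (u t y *\<^sub>R b t)) summable_on {n<..}"
      using fourier_coeff_nonholomorphic_tensor(2)[OF F cG that n]
      by (rule summable_on_cong[THEN iffD1, rotated]) (simp only: u_eq b_def)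
  qed
  \<comment> \<open>Pairs with \<open>m + m' = n\<close> and \<open>m < 0\<close> correspond to
    \<open>t = m' > n\<close>.\<close>
  have S: "((\<lambda>X. infsum a {n<..X}) \<longlongrightarrow> S) at_top"
  proof -
    have "(\<Sum>\<^sub>\<infinity>(m, m')\<in>{(m, m'). m + m' = n \<and> m < 0 \<and> m' \<le> X}.
           of_real ((n / m') powr l * hypergeo_2F1 1 l (k + l) (n / m')) *s (cm m \<otimes>\<^sub>v cG m')) = infsum a {n<..X}" for X
      by (rule infsum_reindex_bij_witness[where i = "\<lambda>t. (n - t, t)" and j = snd])
         (auto simp: a_def b_def eq_diff_eq simp flip: of_real_vector_smult)
    then show ?thesis using series_converges by simp
  qed
  show ?thesis
  proof (cases "0 < l")
    case False
    \<comment> \<open>Only exponents t > n > 0 of G occur, so a constant term surviving in weight 0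
      does no harm. \<open>Gamma l\<close> may stand at a pole here, but it multiplies S =
      0.\<close>
    have "cG t = 0" if "0 < t" for t
      by (rule nonpos_weight_coeff_eq_0[OF \<sigma> l _ G cG that]) (use False in simp)
    then have b0: "b t = 0" if "t \<in> {n<..}" for t
      using that n by (simp add: b_def tensor_vec_simps)
    have "infsum a {n<..X} = 0" for X by (rule infsum_0) (simp add: a_def b0)
    then have "S = 0" using S by (simp add: tendsto_const_iff)
    moreover have "fourier_coeff (\<lambda>\<tau>. Fm \<tau> \<otimes>\<^sub>v G \<tau>) n y = 0" if "0 < y" for y
      unfolding coeff[OF that] by (rule infsum_0) (simp add: b0)
    then have "integral {0<..} (\<lambda>y. of_real (exp (- 4 * pi * n * y) * y powr (k + l - 2)) *s
        fourier_coeff (\<lambda>\<tau>. Fm \<tau> \<otimes>\<^sub>v G \<tau>) n y) = integral {0<..} (\<lambda>y::real. 0)"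
      by (intro Henstock_Kurzweil_Integration.integral_cong) (simp add: vec_eq_iff)
    ultimately show ?thesis by (simp add: hol_proj_coeff_def vec_eq_iff)
  next
    case True
    define K where "K = Gamma l * (4 * pi * n) powr (- l) / (k + l - 1)"
    have "((\<lambda>y. (exp (- 4 * pi * n * y) * y powr (k + l - 2)) *\<^sub>R (\<Sum>\<^sub>\<infinity>t\<in>{n<..}. u t y *\<^sub>R b t)) has_integral
           (- K) *\<^sub>R S) {0<..}"
      unfolding K_def u_def
      by (rule hol_proj_integral[OF True _ n]) (use kl summable S in \<open>simp_all add: u_def a_def[abs_def]\<close>)
    then have "((\<lambda>y. of_real (exp (- 4 * pi * n * y) * y powr (k + l - 2)) *s
        fourier_coeff (\<lambda>\<tau>. Fm \<tau> \<otimes>\<^sub>v G \<tau>) n y) has_integral (- K) *\<^sub>R S) {0<..}"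
      by (rule has_integral_eq[rotated]) (simp only: of_real_vector_smult coeff greaterThan_iff)
    then have "hol_proj_coeff (k + l) (\<lambda>\<tau>. Fm \<tau> \<otimes>\<^sub>v G \<tau>) n =
        of_real ((4 * pi * n) powr (k + l - 1) / Gamma (k + l - 1)) *s ((- K) *\<^sub>R S)"
      unfolding hol_proj_coeff_def by (simp only: integral_unique)
    also have "\<dots> = ((4 * pi * n) powr (k + l - 1) / Gamma (k + l - 1) * (- K)) *\<^sub>R S"
      by (simp only: of_real_vector_smult scaleR_scaleR)
    \<comment> \<open>The functional equation of Gamma absorbs the denominator of \<open>K\<close>,
      and the exponents \<open>k + l - 1\<close> and \<open>- l\<close> combine to
      \<open>k - 1\<close>.\<close>
    also have "(4 * pi * n) powr (k + l - 1) / Gamma (k + l - 1) * (- K) =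
        - ((4 * pi) powr (k - 1)) * Gamma l / Gamma (k + l) * n powr (k - 1)"
    proof -
      have "k + l - 1 \<notin> \<int>\<^sub>\<le>\<^sub>0" using kl by (auto dest: nonpos_Ints_nonpos)
      from Gamma_plus1[OF this] have Gam: "Gamma (k + l) = (k + l - 1) * Gamma (k + l - 1)" by simp
      have "(4 * pi * n) powr (k + l - 1) * (4 * pi * n) powr (- l) = (4 * pi * n) powr (k - 1)"
        by (simp flip: powr_add)
      then have pw: "(4 * pi * n) powr (k + l - 1) * (4 * pi * n) powr (- l) = (4 * pi) powr (k - 1) * n powr (k - 1)"
        by (simp only: powr_mult)
      have "(4 * pi * n) powr (k + l - 1) / Gamma (k + l - 1) * (- K) =
          - ((4 * pi * n) powr (k + l - 1) * (4 * pi * n) powr (- l)) * Gamma l / ((k + l - 1) * Gamma (k + l - 1))"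
        by (simp add: K_def mult_ac)
      then show ?thesis unfolding pw Gam by (simp add: mult_ac)
    qed
    finally show ?thesis by (simp only: of_real_vector_smult)
  qed
qed

end
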